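(* Let $n\ge1$ and let $U$ be a depth-$d$ $\mathrm{QAC}^0$ circuit with $n$ input qubits and $a$ ancilla qubits initialized in the state $\psi$. For $k\le n$, let $\mathcal E_{U,\psi}(\rho)=\mathrm{Tr}_{[k]^c}\big[U(\rho\otimes\psi)U^\dagger\big]$ be the channel from $n$ to $k$ qubits that keeps the first $k$ output qubits, and let $\Phi_{U,\psi}=(\mathcal E_{U,\psi}\otimes\mathrm{id})(\mathrm{EPR}_n)$ be its Choi representation. Then for $\ell=\tilde O\big((n+a)^{1-3^{-d}}k^{3^{-d}/2}\big)$ and $\varepsilon=O(d/n)$, $$\deg_\varepsilon\big(2^{-k}\Phi_{U,\psi}\big)\le\ell.$$
   Context: A depth-$d$ $\mathrm{QAC}^0$ circuit on $m$ qubits is a unitary $U=L_dM_d\cdots L_1M_1L_0$ where each $L_i$ is a tensor product of single-qubit unitaries and each $M_i$ is a tensor product of multi-qubit CZ gates $I-2|1^s\rangle\langle1^s|$ on pairwise disjoint sets of qubits. $\mathrm{EPR}_n=\sum_{x,y\in\{0,1\}^n}|x\rangle\langle y|\otimes|x\rangle\langle y|$ (the unnormalized projector onto $\sum_x|x\rangle|x\rangle$); $\mathrm{Tr}_{[k]^c}$ traces out all qubits except the first $k$. Pauli degree: with $P_\sigma=\bigotimes_iP_{\sigma_i}$, $P_0=I,P_1=X,P_2=Y,P_3=Z$, write $A=\sum_\sigma\hat A(\sigma)P_\sigma$; $\deg(A)=\max\{|\{i:\sigma_i\ne0\}|:\hat A(\sigma)\neq0\}$; $\deg_\varepsilon(A)=\min\{\deg(B):\|A-B\|\le\varepsilon\}$,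 spectral norm. $O$ hides absolute constants and $\tilde O$ also polylogarithmic factors.
   Formalization: The depth is assumed to satisfy d ≥ 1; for d = 0 the claim fails (ε = 0, and the identity circuit with k = n, a = 0 has exact degree 2n, exceeding Õ(√n)). *)

theory Defs
  imports "HOL-Analysis.Analysis" "Jordan_Normal_Form.Matrix"
begin

text \<open>An operator on m qubits is a complex 2^m x 2^m matrix.  Computational basis
  states of m qubits are indexed by x < 2^m; qubit i (for i < m) of basis state x is
  bit i of x.  Thus "the first k qubits" are bits 0..k-1, and for an operator A on the
  first m1 qubits and B on the next m2 qubits, (A tensor B) has entry
  A(x,x') * B(y,y') at index (x + 2^m1 * y, x' + 2^m1 * y').\<close>

definition qbit :: "nat \<Rightarrow> nat \<Rightarrow> nat" where
  "qbit x i = (x div 2 ^ i) mod 2"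

definition is_op :: "nat \<Rightarrow> complex mat \<Rightarrow> bool" where
  "is_op m A \<longleftrightarrow> A \<in> carrier_mat (2 ^ m) (2 ^ m)"

definition adj :: "complex mat \<Rightarrow> complex mat" where
  "adj A = mat (dim_col A) (dim_row A) (\<lambda>(i, j). cnj (A $$ (j, i)))"

definition tr :: "complex mat \<Rightarrow> complex" where
  "tr A = (\<Sum>i<dim_row A. A $$ (i, i))"

definition tensor :: "nat \<Rightarrow> nat \<Rightarrow> complex mat \<Rightarrow> complex mat \<Rightarrow> complex mat" where
  "tensor m1 m2 A B = mat (2 ^ (m1 + m2)) (2 ^ (m1 + m2))
     (\<lambda>(i, j). A $$ (i mod 2 ^ m1, j mod 2 ^ m1) * B $$ (i div 2 ^ m1, j div 2 ^ m1))"

definition ptrace_keep :: "nat \<Rightarrow> nat \<Rightarrow> complex mat \<Rightarrow> complex mat" where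
  "ptrace_keep m k B = mat (2 ^ k) (2 ^ k)
     (\<lambda>(p, p'). \<Sum>r<2 ^ (m - k). B $$ (p + 2 ^ k * r, p' + 2 ^ k * r))"

definition ket_bra :: "nat \<Rightarrow> nat \<Rightarrow> nat \<Rightarrow> complex mat" where
  "ket_bra m x y = mat (2 ^ m) (2 ^ m) (\<lambda>(i, j). if i = x \<and> j = y then 1 else 0)"

definition vnorm :: "complex vec \<Rightarrow> real" where
  "vnorm v = sqrt (\<Sum>i<dim_vec v. (cmod (v $ i))\<^sup>2)"

definition opnorm :: "complex mat \<Rightarrow> real" where
  "opnorm A = Sup {vnorm (A *\<^sub>v v) | v. v \<in> carrier_vec (dim_col A) \<and> vnorm v \<le> 1}"

definition density_op :: "nat \<Rightarrow> complex mat \<Rightarrow> bool" where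
  "density_op m \<psi> \<longleftrightarrow> is_op m \<psi> \<and> adj \<psi> = \<psi> \<and>
     (\<forall>v \<in> carrier_vec (2 ^ m). 0 \<le> Re (v \<bullet>c (\<psi> *\<^sub>v v))) \<and> tr \<psi> = 1"

definition unitary2 :: "complex mat \<Rightarrow> bool" where
  "unitary2 u \<longleftrightarrow> u \<in> carrier_mat 2 2 \<and> u * adj u = 1\<^sub>m 2"

definition single_layer :: "nat \<Rightarrow> (nat \<Rightarrow> complex mat) \<Rightarrow> complex mat" where
  "single_layer m u = mat (2 ^ m) (2 ^ m)
     (\<lambda>(x, y). \<Prod>i<m. u i $$ (qbit x i, qbit y i))"

definition is_single_layer :: "nat \<Rightarrow> complex mat \<Rightarrow> bool" where
  "is_single_layer m L \<longleftrightarrow> (\<exists>u. (\<forall>i<m. unitary2 (u i)) \<and> L = single_layer m u)"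

text \<open>Tensor product of multi-qubit CZ gates I - 2|1^s><1^s| acting on the pairwise
  disjoint (nonempty) qubit sets in G; qubits outside all sets are acted on by identity.\<close>
definition cz_layer :: "nat \<Rightarrow> nat set set \<Rightarrow> complex mat" where
  "cz_layer m G = mat (2 ^ m) (2 ^ m)
     (\<lambda>(x, y). if x = y then (\<Prod>S\<in>G. if (\<forall>i\<in>S. qbit x i = 1) then -1 else 1) else 0)"

definition is_cz_layer :: "nat \<Rightarrow> complex mat \<Rightarrow> bool" where
  "is_cz_layer m M \<longleftrightarrow> (\<exists>G. (\<forall>S\<in>G. S \<noteq> {} \<and> S \<subseteq> {..<m}) \<and>
      (\<forall>S\<in>G. \<forall>T\<in>G. S \<noteq> T \<longrightarrow> S \<inter> T = {}) \<and> M = cz_layer m G)"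

fun circ :: "nat \<Rightarrow> (nat \<Rightarrow> complex mat) \<Rightarrow> (nat \<Rightarrow> complex mat) \<Rightarrow> complex mat" where
  "circ 0 L M = L 0"
| "circ (Suc j) L M = L (Suc j) * M (Suc j) * circ j L M"

definition qac0_circuit :: "nat \<Rightarrow> nat \<Rightarrow> complex mat \<Rightarrow> bool" where
  "qac0_circuit m d U \<longleftrightarrow> (\<exists>L M. (\<forall>j\<le>d. is_single_layer m (L j)) \<and>
      (\<forall>j\<in>{1..d}. is_cz_layer m (M j)) \<and> U = circ d L M)"

definition channel :: "nat \<Rightarrow> nat \<Rightarrow> nat \<Rightarrow> complex mat \<Rightarrow> complex mat \<Rightarrow> complex mat \<Rightarrow> complex mat" where
  "channel n a k U \<psi> \<rho> = ptrace_keep (n + a) k (U * tensor n a \<rho> \<psi> * adj U)"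

text \<open>Choi representation (E tensor id)(EPR_n) = sum_{x,y} E(|x><y|) tensor |x><y|, an
  operator on k + n qubits (first k: channel output; last n: reference).\<close>
text \<open>Written entrywise: the (p + 2^k q, p' + 2^k q') entry of
  sum_{x,y} E(|x><y|) tensor |x><y| equals the (p,p') entry of E(|q><q'|).\<close>
definition choi :: "nat \<Rightarrow> nat \<Rightarrow> nat \<Rightarrow> complex mat \<Rightarrow> complex mat \<Rightarrow> complex mat" where
  "choi n a k U \<psi> = mat (2 ^ (k + n)) (2 ^ (k + n))
     (\<lambda>(i, j). channel n a k U \<psi> (ket_bra n (i div 2 ^ k) (j div 2 ^ k)) $$ (i mod 2 ^ k, j mod 2 ^ k))"

definition pauli :: "nat \<Rightarrow> complex mat" where
  "pauli s = (if s = 1 then mat 2 2 (\<lambda>(i, j). if i \<noteq> j then 1 else 0)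
     else if s = 2 then mat 2 2 (\<lambda>(i, j). if i = 0 \<and> j = 1 then - \<i> else if i = 1 \<and> j = 0 then \<i> else 0)
     else if s = 3 then mat 2 2 (\<lambda>(i, j). if i = j then (if i = 0 then 1 else -1) else 0)
     else 1\<^sub>m 2)"

definition pauli_string :: "nat \<Rightarrow> (nat \<Rightarrow> nat) \<Rightarrow> complex mat" where
  "pauli_string m \<sigma> = mat (2 ^ m) (2 ^ m)
     (\<lambda>(x, y). \<Prod>i<m. pauli (\<sigma> i) $$ (qbit x i, qbit y i))"

definition pauli_strings :: "nat \<Rightarrow> (nat \<Rightarrow> nat) set" where
  "pauli_strings m = {\<sigma>. (\<forall>i<m. \<sigma> i < 4) \<and> (\<forall>i\<ge>m. \<sigma> i = 0)}"

text \<open>Pauli coefficient hat A(sigma), the unique coefficients with A = sum hat A(sigma) P_sigma.\<close>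
definition pauli_coeff :: "nat \<Rightarrow> complex mat \<Rightarrow> (nat \<Rightarrow> nat) \<Rightarrow> complex" where
  "pauli_coeff m A \<sigma> = tr (adj (pauli_string m \<sigma>) * A) / 2 ^ m"

definition pauli_weight :: "nat \<Rightarrow> (nat \<Rightarrow> nat) \<Rightarrow> nat" where
  "pauli_weight m \<sigma> = card {i. i < m \<and> \<sigma> i \<noteq> 0}"

definition pauli_degree :: "nat \<Rightarrow> complex mat \<Rightarrow> nat" where
  "pauli_degree m A = Max ({0} \<union> {pauli_weight m \<sigma> | \<sigma>. \<sigma> \<in> pauli_strings m \<and> pauli_coeff m A \<sigma> \<noteq> 0})"

definition approx_degree :: "nat \<Rightarrow> real \<Rightarrow> complex mat \<Rightarrow> nat" where
  "approx_degree m \<epsilon> A = (LEAST l. \<exists>B. is_op m B \<and> opnorm (A - B) \<le> \<epsilon> \<and> pauli_degree m B = l)"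

end

theory Submission
  imports Defs "Jordan_Normal_Form.Determinant"
begin

text \<open>
  Up to transposition, the operator \<open>2\<^bsup>-k\<^esup> \<Phi>\<close> is obtained from the normalised projector onto \<open>k\<close> EPR pairs
  by conjugating with the circuit in the Heisenberg picture and contracting the ancillas with \<open>\<psi>\<close>; the
  contraction increases neither the norm nor the degree. The EPR projector is a product of two conjunctions
  of \<open>k\<close> commuting two-qubit tests, so Chebyshev polynomials approximate it in degree of order \<open>sqrt k\<close>,
  up to logarithms.

  Conjugation by single-qubit layers preserves the degree. For a CZ layer on \<open>N\<close> qubits fix a threshold \<open>s\<close>.
  Gates on at most \<open>s\<close> qubits multiply the degree by at most \<open>s\<close>. Every larger gate \<open>1 - 2 AND\<^bsub>S\<^esub>\<close> is replaced
  by a Chebyshev approximation of degree of order \<open>sqrt |S|\<close>; as the gates are disjoint and larger than \<open>s\<close>,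
  these degrees add up to order \<open>N / sqrt s\<close>. Balancing \<open>s\<close> turns degree \<open>l\<close> into \<open>N\<^bsup>2/3\<^esup> l\<^bsup>1/3\<^esup>\<close> up to logarithms,
  and \<open>d\<close> iterations give the exponents of the theorem. Using squares of Chebyshev polynomials keeps the
  approximants of the gates in \<open>[-1, 1]\<close>, so that all norms stay at most one and errors only add up. The
  logarithmic factors contribute with exponents \<open>1 + 1/3 + 1/9 + \<dots> \<le> 3/2\<close>, independently of \<open>d\<close>.
\<close>

section \<open>Product operators and Pauli degree\<close>

text \<open>Pauli expansions are avoided until the end. Spans of product operators with arbitrary
  2x2 factors and bounded support are stable under single-qubit conjugation, and products and
  contractions can be computed on one product operator at a time; a vanishing trace finally converts
  support size into Pauli degree. The accuracy parameter is \<open>1 + ln N\<close> for N qubits,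
  which makes the error of one approximated conjunction at most 1/N^2. Up to N gates in each of d
  layers then cost O(d/N), and this is where the error d/n comes from; the price is one logarithmic
  factor per layer. In the degree, small gates contribute s l and large ones N / sqrt s up to
  logarithms; the two agree at s = (N/l)^(2/3). The argument runs on N = k + n + a qubits, since the
  k outputs get EPR partners that the circuit leaves alone; N is at most 2 (n + a), so this costs
  only constants. The case k = 0 is separate: the claimed degree is then exactly 0, and it follows
  from unitarity of the circuit.\<close>

lemma sum_lessThan_mult:
  "(\<Sum>I<A * B. F I) = (\<Sum>y<B. \<Sum>i<A. F (i + A * y))" for A B :: nat
proof -
  have "(\<Sum>i<A. F (i + A * y)) = sum F {y * A..<y * A + A}" for y
    using sum.shift_bounds_nat_ivl[of F 0 "y * A" A] by (simp add: atLeast0LessThan ac_simps)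
  then show ?thesis using sum.nat_group[of F A B] by (simp add: mult.commute)
qed

lemma sum_lessThan_2: "(\<Sum>i<2::nat. f i) = f 0 + f 1"
  by (simp add: numeral_2_eq_2)

lemma qbit_less_2 [simp]: "qbit x i < 2"
  by (simp add: qbit_def)

lemma qbit_cases: "qbit x i = 0 \<or> qbit x i = 1"
  using qbit_less_2[of x i] by linarith

lemma qbit_low: "j < m \<Longrightarrow> qbit (p + 2 ^ m * y) j = qbit p j"
proof -
  assume "j < m"
  then obtain r where m: "m = j + Suc r" using less_imp_Suc_add by fastforce
  have "p + 2 ^ m * y = p + 2 ^ j * (2 * (2 ^ r * y))" by (simp add: m power_add)
  then have "(p + 2 ^ m * y) div 2 ^ j = p div 2 ^ j + 2 * (2 ^ r * y)"
    by (simp only: div_mult_self2 power_eq_0_iff) simp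
  then show ?thesis by (simp add: qbit_def)
qed

lemma qbit_high: "p < 2 ^ m \<Longrightarrow> qbit (p + 2 ^ m * y) (m + j) = qbit y j"
  by (simp add: qbit_def power_add div_mult2_eq)

lemma qbit_mod: "j < m \<Longrightarrow> qbit (x mod 2 ^ m) j = qbit x j"
  using qbit_low[of j m "x mod 2 ^ m" "x div 2 ^ m"] by simp

lemma qbit_div: "qbit (x div 2 ^ m) j = qbit x (m + j)"
  by (simp add: qbit_def power_add div_mult2_eq)

lemma qbit_eqI:
  assumes "x < 2 ^ m" "y < 2 ^ m" "\<And>i. i < m \<Longrightarrow> qbit x i = qbit y i"
  shows "x = y"
proof (rule bit_eqI)
  fix i
  show "bit x i = bit y i"
  proof (cases "i < m")
    case True
    then show ?thesis using assms(3)[OF True] by (simp add: qbit_def bit_iff_odd even_iff_mod_2_eq_zero)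
  next
    case False
    then have "(2::nat) ^ m \<le> 2 ^ i" by simp
    then have "x < 2 ^ i" "y < 2 ^ i" using assms(1,2) by linarith+
    then show ?thesis by (simp add: bit_iff_odd)
  qed
qed

lemma add_mult_less_power:
  "p < 2 ^ m \<Longrightarrow> y < 2 ^ a \<Longrightarrow> p + 2 ^ m * y < (2 ^ (m + a) :: nat)"
proof -
  assume "p < 2 ^ m" "y < 2 ^ a"
  then have "p + 2 ^ m * y < 2 ^ m * Suc y" "2 ^ m * Suc y \<le> 2 ^ m * (2 ^ a :: nat)"
    by (simp, intro mult_left_mono) auto
  then show ?thesis by (simp add: power_add)
qed

lemma sum_power_split:
  fixes F :: "nat \<Rightarrow> 'a::comm_monoid_add"
  shows "(\<Sum>I<2 ^ (m + a). F I) = (\<Sum>y<2 ^ a. \<Sum>i<2 ^ m. F (i + 2 ^ m * y))"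
  by (simp add: power_add sum_lessThan_mult)

text \<open>Distributivity, one bit at a time: a basis state is a free choice of m bits. Products
  and traces of tensor-product matrices become factorwise through this identity, and so does the EPR
  computation.\<close>

lemma sum_prod_qbit:
  "(\<Sum>x<2 ^ m. \<Prod>i<m. f i (qbit x i)) = (\<Prod>i<m. f i 0 + f i 1)"
  for f :: "nat \<Rightarrow> nat \<Rightarrow> complex"
proof (induction m)
  case (Suc m)
  have "(\<Sum>x<2 ^ Suc m. \<Prod>i<Suc m. f i (qbit x i))
      = (\<Sum>y<2 ^ 1. \<Sum>x<2 ^ m. \<Prod>i<Suc m. f i (qbit (x + 2 ^ m * y) i))"
    using sum_power_split[of "\<lambda>x. \<Prod>i<Suc m. f i (qbit x i)" m 1] by simp
  also have "\<dots> = (\<Sum>y<2. \<Sum>x<2 ^ m. (\<Prod>i<m. f i (qbit x i)) * f m y)"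
  proof -
    have "qbit (x + 2 ^ m * y) m = y" if "x < 2 ^ m" "y < 2" for x y
      using qbit_high[of x m y 0] that by (simp add: qbit_def)
    then show ?thesis by (simp add: qbit_low)
  qed
  also have "\<dots> = (\<Prod>i<Suc m. f i 0 + f i 1)"
    by (simp add: sum_lessThan_2 sum_distrib_right[symmetric] Suc[unfolded One_nat_def] distrib_left)
  finally show ?case .
qed simp

section \<open>Matrices given as tensor products of 2x2 factors\<close>

lemma mult_carrier_square [simp]:
  "A \<in> carrier_mat n n \<Longrightarrow> B \<in> carrier_mat n n \<Longrightarrow> A * B \<in> carrier_mat n n"
  by (rule mult_carrier_mat)

lemma index_mult_mat_sum:
  assumes "A \<in> carrier_mat n n" "B \<in> carrier_mat n n" "i < n" "j < n"
  shows "(A * B) $$ (i, j) = (\<Sum>l<n. A $$ (i, l) * B $$ (l, j))"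
  using assms by (simp add: scalar_prod_def atLeast0LessThan)

lemma single_layer_carrier [simp]: "single_layer m u \<in> carrier_mat (2 ^ m) (2 ^ m)"
  by (simp add: single_layer_def)

lemma index_single_layer:
  "x < 2 ^ m \<Longrightarrow> y < 2 ^ m \<Longrightarrow> single_layer m u $$ (x, y) = (\<Prod>i<m. u i $$ (qbit x i, qbit y i))"
  by (simp add: single_layer_def)

lemma single_layer_cong: "(\<And>i. i < m \<Longrightarrow> u i = v i) \<Longrightarrow> single_layer m u = single_layer m v"
  by (simp add: single_layer_def)

lemma single_layer_mult:
  assumes "\<And>i. i < m \<Longrightarrow> u i \<in> carrier_mat 2 2" "\<And>i. i < m \<Longrightarrow> v i \<in> carrier_mat 2 2"
  shows "single_layer m u * single_layer m v = single_layer m (\<lambda>i. u i * v i)"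
proof (rule eq_matI)
  fix x y
  assume "x < dim_row (single_layer m (\<lambda>i. u i * v i))" "y < dim_col (single_layer m (\<lambda>i. u i * v i))"
  then have xy: "x < 2 ^ m" "y < 2 ^ m" by (simp_all add: single_layer_def)
  have "(single_layer m u * single_layer m v) $$ (x, y)
     = (\<Sum>l<2 ^ m. \<Prod>i<m. u i $$ (qbit x i, qbit l i) * v i $$ (qbit l i, qbit y i))"
    using xy by (simp add: index_mult_mat_sum[of _ "2 ^ m"] index_single_layer prod.distrib del: index_mult_mat)
  also have "\<dots> = (\<Prod>i<m. u i $$ (qbit x i, 0) * v i $$ (0, qbit y i)
                     + u i $$ (qbit x i, 1) * v i $$ (1, qbit y i))"
    by (rule sum_prod_qbit)
  also have "\<dots> = (\<Prod>i<m. (u i * v i) $$ (qbit x i, qbit y i))"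
  proof (intro prod.cong refl)
    fix i assume "i \<in> {..<m}"
    then show "u i $$ (qbit x i, 0) * v i $$ (0, qbit y i) + u i $$ (qbit x i, 1) * v i $$ (1, qbit y i)
        = (u i * v i) $$ (qbit x i, qbit y i)"
      using index_mult_mat_sum[OF assms, of i i "qbit x i" "qbit y i"] by (simp add: sum_lessThan_2)
  qed
  finally show "(single_layer m u * single_layer m v) $$ (x, y)
      = single_layer m (\<lambda>i. u i * v i) $$ (x, y)"
    using xy by (simp add: index_single_layer)
qed (simp_all add: single_layer_def)

lemma single_layer_one: "single_layer m (\<lambda>_. 1\<^sub>m 2) = 1\<^sub>m (2 ^ m)"
proof (rule eq_matI)
  fix x y assume "x < dim_row (1\<^sub>m (2 ^ m) :: complex mat)" "y < dim_col (1\<^sub>m (2 ^ m) :: complex mat)"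
  then have xy: "x < 2 ^ m" "y < 2 ^ m" by simp_all
  show "single_layer m (\<lambda>_. 1\<^sub>m 2) $$ (x, y) = (1\<^sub>m (2 ^ m) :: complex mat) $$ (x, y)"
  proof (cases "x = y")
    case False
    then obtain i where "i < m" "qbit x i \<noteq> qbit y i" using qbit_eqI[OF xy] by blast
    then have "(\<Prod>i<m. 1\<^sub>m 2 $$ (qbit x i, qbit y i)) = (0 :: complex)"
      by (intro prod_zero) (auto intro!: bexI[of _ i])
    then show ?thesis using False xy by (simp add: index_single_layer)
  qed (use xy in \<open>simp add: index_single_layer\<close>)
qed (simp_all add: single_layer_def)

lemma adj_carrier [simp]: "A \<in> carrier_mat n k \<Longrightarrow> adj A \<in> carrier_mat k n"
  by (simp add: adj_def)

lemma index_adj: "A \<in> carrier_mat n k \<Longrightarrow> i < k \<Longrightarrow> j < n \<Longrightarrow> adj A $$ (i, j) = cnj (A $$ (j, i))"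
  by (simp add: adj_def)

lemma adj_mult:
  assumes "A \<in> carrier_mat n n" "B \<in> carrier_mat n n"
  shows "adj (A * B) = adj B * adj A"
proof (rule eq_matI)
  fix i j assume "i < dim_row (adj B * adj A)" "j < dim_col (adj B * adj A)"
  then have ij: "i < n" "j < n" using assms by (simp_all add: adj_def)
  show "adj (A * B) $$ (i, j) = (adj B * adj A) $$ (i, j)"
    using assms ij
    by (simp add: index_adj[of _ n n] index_mult_mat_sum[of _ n] mult.commute del: index_mult_mat(1))
qed (use assms in \<open>simp_all add: adj_def\<close>)

lemma adj_single_layer:
  assumes "\<And>i. i < m \<Longrightarrow> u i \<in> carrier_mat 2 2"
  shows "adj (single_layer m u) = single_layer m (\<lambda>i. adj (u i))"
proof (rule eq_matI)
  fix x y
  assume "x < dim_row (single_layer m (\<lambda>i. adj (u i)))" "y < dim_col (single_layer m (\<lambda>i. adj (u i)))"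
  then have xy: "x < 2 ^ m" "y < 2 ^ m" by (simp_all add: single_layer_def)
  have "(\<Prod>i<m. cnj (u i $$ (qbit y i, qbit x i))) = (\<Prod>i<m. adj (u i) $$ (qbit x i, qbit y i))"
    by (intro prod.cong) (use assms in \<open>auto simp: index_adj[of _ 2 2]\<close>)
  then show "adj (single_layer m u) $$ (x, y) = single_layer m (\<lambda>i. adj (u i)) $$ (x, y)"
    using xy by (simp add: index_adj[OF single_layer_carrier] index_single_layer)
qed (simp_all add: adj_def single_layer_def)

lemma tr_single_layer:
  assumes "\<And>i. i < m \<Longrightarrow> u i \<in> carrier_mat 2 2"
  shows "tr (single_layer m u) = (\<Prod>i<m. tr (u i))"
proof -
  have "tr (single_layer m u) = (\<Sum>x<2 ^ m. \<Prod>i<m. u i $$ (qbit x i, qbit x i))"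
    by (simp add: tr_def single_layer_def)
  also have "\<dots> = (\<Prod>i<m. u i $$ (0, 0) + u i $$ (1, 1))"
    using sum_prod_qbit[of "\<lambda>i b. u i $$ (b, b)" m] by simp
  also have "\<dots> = (\<Prod>i<m. tr (u i))"
  proof (intro prod.cong refl)
    fix i assume "i \<in> {..<m}"
    then have "dim_row (u i) = 2" using assms by auto
    then show "u i $$ (0, 0) + u i $$ (1, 1) = tr (u i)" by (simp add: tr_def numeral_2_eq_2)
  qed
  finally show ?thesis .
qed

section \<open>Spans of product operators with prescribed supports\<close>

definition factor_support :: "nat \<Rightarrow> (nat \<Rightarrow> complex mat) \<Rightarrow> nat set" where
  "factor_support m v = {i. i < m \<and> v i \<noteq> 1\<^sub>m 2}"

text \<open>\<open>Q\<close> speaks of supports rather than sizes, so that one closure theory serves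
  both the degree (\<open>low_degree\<close>) and the confinement to a fixed set of qubits used for
  small gates. The support is read off the chosen factors and may overestimate the true one, which
  is harmless for upper bounds.\<close>

inductive spanned :: "nat \<Rightarrow> (nat set \<Rightarrow> bool) \<Rightarrow> complex mat \<Rightarrow> bool" for m Q where
  spanned_product: "(\<And>i. i < m \<Longrightarrow> v i \<in> carrier_mat 2 2) \<Longrightarrow> Q (factor_support m v) \<Longrightarrow>
    spanned m Q (single_layer m v)"
| spanned_smult: "spanned m Q A \<Longrightarrow> spanned m Q (c \<cdot>\<^sub>m A)"
| spanned_add: "spanned m Q A \<Longrightarrow> spanned m Q B \<Longrightarrow> spanned m Q (A + B)"

abbreviation low_degree :: "nat \<Rightarrow> real \<Rightarrow> complex mat \<Rightarrow> bool" where
  "low_degree m l \<equiv> spanned m (\<lambda>T. real (card T) \<le> l)"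

lemma spanned_carrier: "spanned m Q A \<Longrightarrow> A \<in> carrier_mat (2 ^ m) (2 ^ m)"
  by (induction rule: spanned.induct) auto

lemma factor_support_subset: "factor_support m v \<subseteq> {..<m}"
  by (auto simp: factor_support_def)

lemma spanned_mono:
  assumes "spanned m Q A" "\<And>T. T \<subseteq> {..<m} \<Longrightarrow> Q T \<Longrightarrow> Q' T"
  shows "spanned m Q' A"
  using assms(1)
proof (induction rule: spanned.induct)
  case (spanned_product v)
  then show ?case using assms(2)[OF factor_support_subset] by (blast intro: spanned.spanned_product)
qed (auto intro: spanned.intros)

text \<open>Product operators multiply factorwise, and the product is the identity wherever both
  factors are. \<open>Q\<close> has to accept every subset \<open>T\<close> of the union because two
  nontrivial factors can multiply to the identity.\<close>

lemma spanned_mult: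
  assumes "spanned m Q1 A" "spanned m Q2 B"
    and Q: "\<And>T1 T2 T. Q1 T1 \<Longrightarrow> Q2 T2 \<Longrightarrow> T \<subseteq> T1 \<union> T2 \<Longrightarrow> T1 \<subseteq> {..<m} \<Longrightarrow> T2 \<subseteq> {..<m} \<Longrightarrow> Q T"
  shows "spanned m Q (A * B)"
  using assms(1)
proof (induction rule: spanned.induct)
  case (spanned_product u)
  note u = this
  from assms(2) show ?case
  proof (induction rule: spanned.induct)
    case (spanned_product v)
    have "factor_support m (\<lambda>i. u i * v i) \<subseteq> factor_support m u \<union> factor_support m v"
      by (auto simp: factor_support_def)
    then have "Q (factor_support m (\<lambda>i. u i * v i))"
      using Q u(2) spanned_product(2) factor_support_subset by blast
    then have "spanned m Q (single_layer m (\<lambda>i. u i * v i))"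
        using u(1) spanned_product(1) by (intro spanned.spanned_product) simp_all
    then show ?case using u(1) spanned_product(1) by (simp add: single_layer_mult)
  next
    case (spanned_smult B c)
    then show ?case
      by (simp add: mult_smult_distrib[OF single_layer_carrier spanned_carrier] spanned.spanned_smult)
  next
    case (spanned_add B B')
    then show ?case
      by (simp add: mult_add_distrib_mat[OF single_layer_carrier spanned_carrier spanned_carrier]
          spanned.spanned_add)
  qed
next
  case (spanned_smult A c)
  then show ?case
    by (simp add: mult_smult_assoc_mat[OF spanned_carrier spanned_carrier[OF assms(2)]] spanned.spanned_smult)
next
  case (spanned_add A A')
  then show ?case
    by (simp add: add_mult_distrib_mat[OF spanned_carrier spanned_carrier spanned_carrier[OF assms(2)]]
        spanned.spanned_add)
qed

lemma low_degree_mult: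
  assumes "low_degree m l A" "low_degree m l' B"
  shows "low_degree m (l + l') (A * B)"
proof (rule spanned_mult[OF assms])
  fix T1 T2 T :: "nat set"
  assume *: "real (card T1) \<le> l" "real (card T2) \<le> l'" "T \<subseteq> T1 \<union> T2" "T1 \<subseteq> {..<m}" "T2 \<subseteq> {..<m}"
  then have "card T \<le> card (T1 \<union> T2)" by (intro card_mono) (auto intro: finite_subset[of _ "{..<m}"])
  also have "\<dots> \<le> card T1 + card T2" by (rule card_Un_le)
  finally show "real (card T) \<le> l + l'" using *(1,2) by linarith
qed

lemma low_degree_mono: "low_degree m l A \<Longrightarrow> l \<le> l' \<Longrightarrow> low_degree m l' A"
  by (erule spanned_mono) auto

lemma low_degree_trivial:
  assumes "spanned m Q A" shows "low_degree m (real m) A"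
proof (rule spanned_mono[OF assms])
  show "real (card T) \<le> real m" if "T \<subseteq> {..<m}" for T
    using card_mono[OF _ that] by simp
qed

section \<open>From support size to Pauli coefficients\<close>

lemma pauli_carrier [simp]: "pauli s \<in> carrier_mat 2 2"
  by (simp add: pauli_def)

lemma tr_adj_pauli: "s \<noteq> 0 \<Longrightarrow> s < 4 \<Longrightarrow> tr (adj (pauli s)) = 0"
  by (auto simp: tr_def adj_def pauli_def numeral_2_eq_2)

lemma pauli_coeff_linear:
  assumes "A \<in> carrier_mat (2 ^ m) (2 ^ m)" "B \<in> carrier_mat (2 ^ m) (2 ^ m)"
  shows "pauli_coeff m (A + B) \<sigma> = pauli_coeff m A \<sigma> + pauli_coeff m B \<sigma>"
    and "pauli_coeff m (c \<cdot>\<^sub>m A) \<sigma> = c * pauli_coeff m A \<sigma>"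
proof -
  have P: "adj (pauli_string m \<sigma>) \<in> carrier_mat (2 ^ m) (2 ^ m)"
    by (simp add: pauli_string_def adj_def)
  show "pauli_coeff m (A + B) \<sigma> = pauli_coeff m A \<sigma> + pauli_coeff m B \<sigma>"
    using assms P
    by (simp add: pauli_coeff_def mult_add_distrib_mat[OF P assms] tr_def sum.distrib add_divide_distrib
        del: index_mult_mat(1))
  show "pauli_coeff m (c \<cdot>\<^sub>m A) \<sigma> = c * pauli_coeff m A \<sigma>"
    using assms P
    by (simp add: pauli_coeff_def mult_smult_distrib[OF P assms(1)] tr_def sum_distrib_left
        del: index_mult_mat(1))
qed

text \<open>A string heavier than the support of a product operator has a non-identity Pauli at some
  qubit where the operator has factor 1. The trace factors over the qubits, and the factor there is
  the trace of a traceless matrix. Linearity covers the span.\<close>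

lemma pauli_coeff_eq_0:
  assumes "low_degree m l A" "\<sigma> \<in> pauli_strings m" "l < real (pauli_weight m \<sigma>)"
  shows "pauli_coeff m A \<sigma> = 0"
  using assms(1)
proof (induction rule: spanned.induct)
  case (spanned_product v)
  have "\<not> {i. i < m \<and> \<sigma> i \<noteq> 0} \<subseteq> factor_support m v"
  proof
    assume "{i. i < m \<and> \<sigma> i \<noteq> 0} \<subseteq> factor_support m v"
    then have "pauli_weight m \<sigma> \<le> card (factor_support m v)"
      unfolding pauli_weight_def
      by (intro card_mono) (auto intro: finite_subset[OF factor_support_subset])
    then show False using spanned_product(2) assms(3) by linarith
  qed
  then obtain i where i: "i < m" "\<sigma> i \<noteq> 0" "v i = 1\<^sub>m 2" by (auto simp: factor_support_def)
  have "pauli_string m \<sigma> = single_layer m (\<lambda>i. pauli (\<sigma> i))"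
    by (simp add: pauli_string_def single_layer_def)
  then have "adj (pauli_string m \<sigma>) * single_layer m v = single_layer m (\<lambda>i. adj (pauli (\<sigma> i)) * v i)"
    using spanned_product(1) by (simp add: adj_single_layer single_layer_mult)
  moreover have "tr (single_layer m (\<lambda>i. adj (pauli (\<sigma> i)) * v i)) = (\<Prod>i<m. tr (adj (pauli (\<sigma> i)) * v i))"
    by (rule tr_single_layer) (use spanned_product(1) in simp)
  moreover have "tr (adj (pauli (\<sigma> i)) * v i) = 0"
    using i tr_adj_pauli[of "\<sigma> i"] assms(2) right_mult_one_mat[OF adj_carrier[OF pauli_carrier]]
    by (simp add: pauli_strings_def)
  ultimately have "tr (adj (pauli_string m \<sigma>) * single_layer m v) = 0"
    using i(1) by (auto intro!: prod_zero)
  then show ?case by (simp add: pauli_coeff_def)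
qed (simp_all add: pauli_coeff_linear[OF spanned_carrier spanned_carrier] pauli_coeff_linear(2)[OF spanned_carrier spanned_carrier])

lemma pauli_degree_le:
  assumes "low_degree m l A" "0 \<le> l"
  shows "real (pauli_degree m A) \<le> l"
proof -
  let ?W = "{0} \<union> {pauli_weight m \<sigma> | \<sigma>. \<sigma> \<in> pauli_strings m \<and> pauli_coeff m A \<sigma> \<noteq> 0}"
  have "pauli_weight m \<sigma> \<le> m" for \<sigma>
    unfolding pauli_weight_def using card_mono[of "{..<m}" "{i. i < m \<and> \<sigma> i \<noteq> 0}"] by auto
  then have fin: "finite ?W" by (intro finite_subset[of ?W "{..m}"]) auto
  have "Max ?W \<in> ?W" by (rule Max_in[OF fin]) auto
  then show ?thesis
    using pauli_coeff_eq_0[OF assms(1)] assms(2) unfolding pauli_degree_def by force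
qed

section \<open>Operator norm bounds and diagonal operators\<close>

text \<open>An inequality for all vectors avoids handling the supremum in \<open>opnorm\<close> at
  every sum and product; \<open>opnorm_le\<close> translates once at the end.\<close>

definition op_bounded :: "complex mat \<Rightarrow> real \<Rightarrow> bool" where
  "op_bounded A c \<longleftrightarrow> (\<forall>v \<in> carrier_vec (dim_col A). vnorm (A *\<^sub>v v) \<le> c * vnorm v)"

abbreviation l2 :: "nat \<Rightarrow> (nat \<Rightarrow> complex) \<Rightarrow> real" where
  "l2 n u \<equiv> L2_set (\<lambda>i. cmod (u i)) {..<n}"

lemma vnorm_eq_l2: "v \<in> carrier_vec n \<Longrightarrow> vnorm v = l2 n (\<lambda>i. v $ i)"
  by (auto simp: vnorm_def L2_set_def)

lemma vnorm_nonneg [simp]: "0 \<le> vnorm v"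
  by (simp add: vnorm_def sum_nonneg)

lemma vnorm_add:
  assumes "u \<in> carrier_vec n" "v \<in> carrier_vec n"
  shows "vnorm (u + v) \<le> vnorm u + vnorm v"
proof -
  have "vnorm (u + v) = l2 n (\<lambda>i. u $ i + v $ i)"
    using assms by (auto simp: vnorm_def L2_set_def)
  also have "\<dots> \<le> L2_set (\<lambda>i. cmod (u $ i) + cmod (v $ i)) {..<n}"
    by (intro L2_set_mono norm_triangle_ineq) simp
  also have "\<dots> \<le> l2 n (\<lambda>i. u $ i) + l2 n (\<lambda>i. v $ i)" by (rule L2_set_triangle_ineq)
  finally show ?thesis using assms by (simp add: vnorm_eq_l2)
qed

lemma index_mult_mat_vec_sum:
  assumes "A \<in> carrier_mat n n" "v \<in> carrier_vec n" "i < n"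
  shows "(A *\<^sub>v v) $ i = (\<Sum>j<n. A $$ (i, j) * v $ j)"
  using assms by (simp add: scalar_prod_def atLeast0LessThan)

lemma op_bounded_add:
  assumes "op_bounded A c" "op_bounded B c'" "A \<in> carrier_mat n n" "B \<in> carrier_mat n n"
  shows "op_bounded (A + B) (c + c')"
  unfolding op_bounded_def
proof
  fix v :: "complex vec" assume "v \<in> carrier_vec (dim_col (A + B))"
  then have v: "v \<in> carrier_vec n" using assms by simp
  have "vnorm ((A + B) *\<^sub>v v) = vnorm (A *\<^sub>v v + B *\<^sub>v v)"
    using assms v by (simp add: add_mult_distrib_mat_vec)
  also have "\<dots> \<le> vnorm (A *\<^sub>v v) + vnorm (B *\<^sub>v v)"
    by (rule vnorm_add[of _ n]) (use assms v in auto)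
  also have "\<dots> \<le> c * vnorm v + c' * vnorm v"
    using assms v by (intro add_mono) (auto simp: op_bounded_def)
  finally show "vnorm ((A + B) *\<^sub>v v) \<le> (c + c') * vnorm v" by (simp add: distrib_right)
qed

lemma op_bounded_mult:
  assumes "op_bounded A c" "op_bounded B c'" "A \<in> carrier_mat n n" "B \<in> carrier_mat n n" "0 \<le> c"
  shows "op_bounded (A * B) (c * c')"
  unfolding op_bounded_def
proof
  fix v :: "complex vec" assume "v \<in> carrier_vec (dim_col (A * B))"
  then have v: "v \<in> carrier_vec n" using assms by simp
  have "vnorm ((A * B) *\<^sub>v v) = vnorm (A *\<^sub>v (B *\<^sub>v v))"
    using assms v by simp
  also have "\<dots> \<le> c * vnorm (B *\<^sub>v v)" using assms v by (auto simp: op_bounded_def)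
  also have "\<dots> \<le> c * (c' * vnorm v)"
    using assms v by (intro mult_left_mono) (auto simp: op_bounded_def)
  finally show "vnorm ((A * B) *\<^sub>v v) \<le> (c * c') * vnorm v" by simp
qed

lemma op_boundedD:
  assumes "op_bounded A c" "A \<in> carrier_mat n n"
  shows "cmod (\<Sum>i<n. \<Sum>j<n. u i * A $$ (i, j) * v j) \<le> c * l2 n u * l2 n v"
proof -
  let ?v = "Matrix.vec n v"
  have v: "?v \<in> carrier_vec n" by simp
  have "(\<Sum>i<n. \<Sum>j<n. u i * A $$ (i, j) * v j) = (\<Sum>i<n. u i * (A *\<^sub>v ?v) $ i)"
    using assms(2) by (intro sum.cong refl)
      (simp add: index_mult_mat_vec_sum[OF assms(2) v] sum_distrib_left mult.assoc del: index_mult_mat_vec)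
  also have "cmod \<dots> \<le> (\<Sum>i<n. \<bar>cmod (u i)\<bar> * \<bar>cmod ((A *\<^sub>v ?v) $ i)\<bar>)"
    by (intro order_trans[OF norm_sum]) (simp add: norm_mult)
  also have "\<dots> \<le> l2 n u * l2 n (\<lambda>i. (A *\<^sub>v ?v) $ i)" by (rule L2_set_mult_ineq)
  also have "l2 n (\<lambda>i. (A *\<^sub>v ?v) $ i) = vnorm (A *\<^sub>v ?v)"
    using vnorm_eq_l2[of "A *\<^sub>v ?v" n] assms(2) by simp
  also have "l2 n u * vnorm (A *\<^sub>v ?v) \<le> l2 n u * (c * vnorm ?v)"
    using assms by (intro mult_left_mono) (auto simp: op_bounded_def)
  also have "vnorm ?v = l2 n v" by (simp add: vnorm_def L2_set_def)
  finally show ?thesis by (simp add: mult_ac)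
qed

lemma sum_mult_cnj_eq_l2: "(\<Sum>i<n. cnj (u i) * u i) = complex_of_real ((l2 n u)\<^sup>2)"
  by (simp add: L2_set_def sum_nonneg complex_norm_square[symmetric] mult.commute[of "cnj _"])

text \<open>Testing with u equal to the conjugate of A v bounds |A v|^2 by c |v| |A v|, and |A v|
  cancels unless it is 0. Together with \<open>op_boundedD\<close> this turns norm bounds into
  statements about bilinear forms, where sums over matrix entries can be rearranged freely.\<close>

lemma op_boundedI:
  assumes "A \<in> carrier_mat n n" "0 \<le> c"
    and *: "\<And>u v. cmod (\<Sum>i<n. \<Sum>j<n. u i * A $$ (i, j) * v j) \<le> c * l2 n u * l2 n v"
  shows "op_bounded A c"
  unfolding op_bounded_def
proof
  fix v :: "complex vec" assume "v \<in> carrier_vec (dim_col A)"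
  then have v: "v \<in> carrier_vec n" using assms by simp
  let ?w = "\<lambda>i. (A *\<^sub>v v) $ i"
  have "complex_of_real ((l2 n ?w)\<^sup>2) = (\<Sum>i<n. cnj (?w i) * ?w i)" by (rule sum_mult_cnj_eq_l2[symmetric])
  also have "\<dots> = (\<Sum>i<n. \<Sum>j<n. cnj (?w i) * A $$ (i, j) * v $ j)"
    by (intro sum.cong refl)
      (simp add: index_mult_mat_vec_sum[OF assms(1) v] sum_distrib_left mult.assoc del: index_mult_mat_vec)
  finally have "cmod (complex_of_real ((l2 n ?w)\<^sup>2)) \<le> c * l2 n (\<lambda>i. cnj (?w i)) * l2 n (\<lambda>i. v $ i)"
    using *[of "\<lambda>i. cnj (?w i)" "\<lambda>i. v $ i"] by simp
  then have "(l2 n ?w)\<^sup>2 \<le> (c * l2 n (\<lambda>i. v $ i)) * l2 n ?w"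
    by (simp add: norm_power mult_ac)
  then have "l2 n ?w \<le> c * l2 n (\<lambda>i. v $ i)"
  proof (cases "l2 n ?w = 0")
    case False
    then have "0 < l2 n ?w" using L2_set_nonneg[of "\<lambda>i. cmod (?w i)"] by (simp add: less_le)
    then show ?thesis
      using \<open>(l2 n ?w)\<^sup>2 \<le> (c * l2 n (\<lambda>i. v $ i)) * l2 n ?w\<close> unfolding power2_eq_square
      by (rule mult_right_le_imp_le[rotated])
  qed (use assms(2) L2_set_nonneg in \<open>simp\<close>)
  moreover have "A *\<^sub>v v \<in> carrier_vec n" using assms(1) v by simp
  ultimately show "vnorm (A *\<^sub>v v) \<le> c * vnorm v" using vnorm_eq_l2 v by metis
qed

lemma op_bounded_isometry:
  assumes "A \<in> carrier_mat n n" "adj A * A = 1\<^sub>m n"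
  shows "op_bounded A 1"
  unfolding op_bounded_def
proof
  fix v :: "complex vec" assume "v \<in> carrier_vec (dim_col A)"
  then have v: "v \<in> carrier_vec n" using assms by simp
  let ?w = "\<lambda>i. (A *\<^sub>v v) $ i"
  have I: "(\<Sum>i<n. cnj (A $$ (i, j)) * A $$ (i, l)) = (if j = l then 1 else 0)" if "j < n" "l < n" for j l
  proof -
    have "(\<Sum>i<n. cnj (A $$ (i, j)) * A $$ (i, l)) = (adj A * A) $$ (j, l)"
      using index_mult_mat_sum[OF adj_carrier[OF assms(1)] assms(1) that] assms(1) that
      by (simp add: index_adj[OF assms(1)])
    then show ?thesis using that assms(2) by simp
  qed
  have "complex_of_real ((l2 n ?w)\<^sup>2) = (\<Sum>i<n. cnj (?w i) * ?w i)" by (rule sum_mult_cnj_eq_l2[symmetric])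
  also have "\<dots> = (\<Sum>i<n. \<Sum>j<n. \<Sum>l<n. cnj (v $ j) * (cnj (A $$ (i, j)) * A $$ (i, l)) * v $ l)"
    by (intro sum.cong refl)
      (simp add: index_mult_mat_vec_sum[OF assms(1) v] sum_product del: index_mult_mat_vec,
        simp add: mult_ac)
  also have "\<dots> = (\<Sum>j<n. \<Sum>i<n. \<Sum>l<n. cnj (v $ j) * (cnj (A $$ (i, j)) * A $$ (i, l)) * v $ l)"
    by (rule sum.swap)
  also have "\<dots> = (\<Sum>j<n. \<Sum>l<n. \<Sum>i<n. cnj (v $ j) * (cnj (A $$ (i, j)) * A $$ (i, l)) * v $ l)"
    by (intro sum.cong refl sum.swap)
  also have "\<dots> = (\<Sum>j<n. \<Sum>l<n. cnj (v $ j) * (\<Sum>i<n. cnj (A $$ (i, j)) * A $$ (i, l)) * v $ l)"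
    by (simp add: sum_distrib_left sum_distrib_right)
  also have "\<dots> = (\<Sum>j<n. \<Sum>l<n. if j = l then cnj (v $ j) * v $ l else 0)"
    by (intro sum.cong refl) (simp add: I)
  also have "\<dots> = (\<Sum>j<n. cnj (v $ j) * v $ j)" by simp
  also have "\<dots> = complex_of_real ((l2 n (\<lambda>i. v $ i))\<^sup>2)" by (rule sum_mult_cnj_eq_l2)
  finally have "(l2 n ?w)\<^sup>2 = (l2 n (\<lambda>i. v $ i))\<^sup>2" using of_real_eq_iff by blast
  then have "l2 n ?w = l2 n (\<lambda>i. v $ i)" by (simp add: L2_set_nonneg)
  moreover have "A *\<^sub>v v \<in> carrier_vec n" using assms(1) v by simp
  ultimately show "vnorm (A *\<^sub>v v) \<le> 1 * vnorm v" using vnorm_eq_l2 v by (metis mult_1 order_refl)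
qed

lemma opnorm_le:
  assumes "op_bounded A c" "0 \<le> c"
  shows "opnorm A \<le> c"
  unfolding opnorm_def
proof (rule cSup_least)
  have "vnorm (0\<^sub>v (dim_col A)) \<le> 1" by (simp add: vnorm_def)
  then show "{vnorm (A *\<^sub>v v) |v. v \<in> carrier_vec (dim_col A) \<and> vnorm v \<le> 1} \<noteq> {}"
    using zero_carrier_vec by blast
next
  fix x assume "x \<in> {vnorm (A *\<^sub>v v) |v. v \<in> carrier_vec (dim_col A) \<and> vnorm v \<le> 1}"
  then obtain v where v: "x = vnorm (A *\<^sub>v v)" "v \<in> carrier_vec (dim_col A)" "vnorm v \<le> 1" by blast
  then have "x \<le> c * vnorm v" using assms(1) by (simp add: op_bounded_def)
  also have "\<dots> \<le> c" using v(3) assms(2) by (simp add: mult_left_le)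
  finally show "x \<le> c" .
qed

section \<open>Operators diagonal in the computational basis\<close>

definition diag_op :: "nat \<Rightarrow> (nat \<Rightarrow> complex) \<Rightarrow> complex mat" where
  "diag_op m f = mat (2 ^ m) (2 ^ m) (\<lambda>(x, y). if x = y then f x else 0)"

lemma diag_op_carrier [simp]: "diag_op m f \<in> carrier_mat (2 ^ m) (2 ^ m)"
  by (simp add: diag_op_def)

lemma index_diag_op: "x < 2 ^ m \<Longrightarrow> y < 2 ^ m \<Longrightarrow> diag_op m f $$ (x, y) = (if x = y then f x else 0)"
  by (simp add: diag_op_def)

lemma index_diag_op_mult:
  assumes "A \<in> carrier_mat (2 ^ m) (2 ^ m)" "x < 2 ^ m" "y < 2 ^ m"
  shows "(diag_op m f * A) $$ (x, y) = f x * A $$ (x, y)"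
proof -
  have "(diag_op m f * A) $$ (x, y) = (\<Sum>l<2 ^ m. if l = x then f x * A $$ (x, y) else 0)"
    unfolding index_mult_mat_sum[OF diag_op_carrier assms]
    by (intro sum.cong) (use assms in \<open>auto simp: index_diag_op\<close>)
  then show ?thesis using assms by simp
qed

lemma index_mult_diag_op:
  assumes "A \<in> carrier_mat (2 ^ m) (2 ^ m)" "x < 2 ^ m" "y < 2 ^ m"
  shows "(A * diag_op m f) $$ (x, y) = A $$ (x, y) * f y"
proof -
  have "(A * diag_op m f) $$ (x, y) = (\<Sum>l<2 ^ m. if l = y then A $$ (x, y) * f y else 0)"
    unfolding index_mult_mat_sum[OF assms(1) diag_op_carrier assms(2,3)]
    by (intro sum.cong) (use assms in \<open>auto simp: index_diag_op\<close>)
  then show ?thesis using assms by simp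
qed

lemma diag_op_mult: "diag_op m f * diag_op m g = diag_op m (\<lambda>x. f x * g x)"
  by (rule eq_matI)
    (simp_all add: diag_op_def[of m "\<lambda>x. f x * g x"] index_diag_op_mult[OF diag_op_carrier] index_diag_op
      del: index_mult_mat(1), simp_all add: diag_op_def)

lemma diag_op_add: "diag_op m f + diag_op m g = diag_op m (\<lambda>x. f x + g x)"
  by (auto simp: diag_op_def intro!: eq_matI)

lemma diag_op_smult: "c \<cdot>\<^sub>m diag_op m f = diag_op m (\<lambda>x. c * f x)"
  by (auto simp: diag_op_def intro!: eq_matI)

lemma diag_op_one: "diag_op m (\<lambda>_. 1) = 1\<^sub>m (2 ^ m)"
  by (auto simp: diag_op_def intro!: eq_matI)

lemma diag_op_diff: "diag_op m f - diag_op m g = diag_op m (\<lambda>x. f x - g x)"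
  by (auto simp: diag_op_def intro!: eq_matI)

lemma op_bounded_diag_op:
  assumes "\<And>x. x < 2 ^ m \<Longrightarrow> cmod (f x) \<le> c" "0 \<le> c"
  shows "op_bounded (diag_op m f) c"
proof (rule op_boundedI[OF diag_op_carrier assms(2)])
  fix u v
  have "(\<Sum>i<2 ^ m. \<Sum>j<2 ^ m. u i * diag_op m f $$ (i, j) * v j)
      = (\<Sum>i<2 ^ m. \<Sum>j<2 ^ m. if i = j then u i * f i * v i else 0)"
    by (intro sum.cong refl) (auto simp: index_diag_op)
  also have "\<dots> = (\<Sum>i<2 ^ m. u i * f i * v i)" by simp
  also have "cmod \<dots> \<le> (\<Sum>i<2 ^ m. cmod (u i) * cmod (f i) * cmod (v i))"
    by (intro order_trans[OF norm_sum]) (simp add: norm_mult)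
  also have "\<dots> \<le> (\<Sum>i<2 ^ m. cmod (u i) * c * cmod (v i))"
    using assms(1) by (intro sum_mono mult_right_mono mult_left_mono) auto
  also have "\<dots> = c * (\<Sum>i<2 ^ m. \<bar>cmod (u i)\<bar> * \<bar>cmod (v i)\<bar>)"
    by (simp add: sum_distrib_left mult_ac)
  also have "\<dots> \<le> c * (l2 (2 ^ m) u * l2 (2 ^ m) v)"
    using assms(2) by (intro mult_left_mono L2_set_mult_ineq) auto
  finally show "cmod (\<Sum>i<2 ^ m. \<Sum>j<2 ^ m. u i * diag_op m f $$ (i, j) * v j)
      \<le> c * l2 (2 ^ m) u * l2 (2 ^ m) v" by (simp add: mult.assoc)
qed

section \<open>Layers of single-qubit unitaries\<close>

lemma unitary2_adj_mult: "unitary2 u \<Longrightarrow> adj u * u = 1\<^sub>m 2"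
  unfolding unitary2_def using mat_mult_left_right_inverse adj_carrier by blast

lemma is_single_layer_unitary:
  assumes "is_single_layer m L"
  shows "L \<in> carrier_mat (2 ^ m) (2 ^ m)" "adj L * L = 1\<^sub>m (2 ^ m)" "L * adj L = 1\<^sub>m (2 ^ m)"
proof -
  obtain u where u: "\<And>i. i < m \<Longrightarrow> unitary2 (u i)" and L: "L = single_layer m u"
    using assms by (auto simp: is_single_layer_def)
  have c: "\<And>i. i < m \<Longrightarrow> u i \<in> carrier_mat 2 2" using u by (simp add: unitary2_def)
  show L1: "L \<in> carrier_mat (2 ^ m) (2 ^ m)" by (simp add: L)
  have "adj L * L = single_layer m (\<lambda>i. adj (u i) * u i)"
    using c by (simp add: L adj_single_layer single_layer_mult)
  also have "\<dots> = single_layer m (\<lambda>_. 1\<^sub>m 2)"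
    by (rule single_layer_cong) (simp add: unitary2_adj_mult u)
  finally show L2: "adj L * L = 1\<^sub>m (2 ^ m)" by (simp add: single_layer_one)
  show "L * adj L = 1\<^sub>m (2 ^ m)"
    by (rule mat_mult_left_right_inverse[OF adj_carrier[OF L1] L1 L2])
qed

lemma adj_adj: "adj (adj A) = A"
  by (auto simp: adj_def intro!: eq_matI)

lemma op_bounded_single_layer:
  assumes "is_single_layer m L"
  shows "op_bounded L 1" "op_bounded (adj L) 1"
  using is_single_layer_unitary[OF assms] op_bounded_isometry[of L "2 ^ m"] op_bounded_isometry[of "adj L" "2 ^ m"]
  by (auto simp: adj_adj)

lemma conj_linear:
  fixes P A B R :: "complex mat"
  assumes "P \<in> carrier_mat n n" "R \<in> carrier_mat n n" "A \<in> carrier_mat n n" "B \<in> carrier_mat n n"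
  shows "P * (c \<cdot>\<^sub>m A) * R = c \<cdot>\<^sub>m (P * A * R)" "P * (A + B) * R = P * A * R + P * B * R"
    "P * (A - B) * R = P * A * R - P * B * R"
proof -
  note PA = mult_carrier_mat[OF assms(1,3)] and PB = mult_carrier_mat[OF assms(1,4)]
  show "P * (c \<cdot>\<^sub>m A) * R = c \<cdot>\<^sub>m (P * A * R)"
    by (simp only: mult_smult_distrib[OF assms(1,3)] mult_smult_assoc_mat[OF PA assms(2)])
  show "P * (A + B) * R = P * A * R + P * B * R"
    by (simp only: mult_add_distrib_mat[OF assms(1,3,4)] add_mult_distrib_mat[OF PA PB assms(2)])
  show "P * (A - B) * R = P * A * R - P * B * R"
    by (simp only: mult_minus_distrib_mat[OF assms(1,3,4)] minus_mult_distrib_mat[OF PA PB assms(2)])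
qed

text \<open>Conjugation acts on each factor separately and, by unitarity, fixes an identity factor;
  so supports cannot grow.\<close>

lemma low_degree_conj_single_layer:
  assumes "low_degree m l A" "is_single_layer m L"
  shows "low_degree m l (adj L * A * L)"
proof -
  obtain u where u: "\<And>i. i < m \<Longrightarrow> unitary2 (u i)" and L: "L = single_layer m u"
    using assms(2) by (auto simp: is_single_layer_def)
  have c: "\<And>i. i < m \<Longrightarrow> u i \<in> carrier_mat 2 2" using u by (simp add: unitary2_def)
  have Lc: "L \<in> carrier_mat (2 ^ m) (2 ^ m)" "adj L \<in> carrier_mat (2 ^ m) (2 ^ m)" by (simp_all add: L)
  from assms(1) show ?thesis
  proof (induction rule: spanned.induct)
    case (spanned_product v)
    have eq: "adj L * single_layer m v * L = single_layer m (\<lambda>i. adj (u i) * v i * u i)"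
      using c spanned_product(1) by (simp add: L adj_single_layer single_layer_mult)
    have "factor_support m (\<lambda>i. adj (u i) * v i * u i) \<subseteq> factor_support m v"
      using u unitary2_adj_mult c right_mult_one_mat[OF adj_carrier[OF c]] by (auto simp: factor_support_def)
    then have "card (factor_support m (\<lambda>i. adj (u i) * v i * u i)) \<le> card (factor_support m v)"
      by (intro card_mono) (auto intro: finite_subset[OF factor_support_subset])
    then have "real (card (factor_support m (\<lambda>i. adj (u i) * v i * u i))) \<le> l"
      using spanned_product(2) by linarith
    then show ?case unfolding eq using c spanned_product(1) by (intro spanned.spanned_product) simp_all
  next
    case (spanned_smult A d)
    note A = spanned_carrier[OF spanned_smult(1)]
    show ?case using spanned_smult(2) by (simp add: conj_linear[OF Lc(2,1) A A] spanned.spanned_smult)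
  next
    case (spanned_add A B)
    note A = spanned_carrier[OF spanned_add(1)] and B = spanned_carrier[OF spanned_add(2)]
    show ?case using spanned_add(3,4) by (simp add: conj_linear[OF Lc(2,1) A B] spanned.spanned_add)
  qed
qed

lemma low_degree_one: "0 \<le> l \<Longrightarrow> low_degree m l (1\<^sub>m (2 ^ m))"
  using spanned_product[of m "\<lambda>_. 1\<^sub>m 2" "\<lambda>T. real (card T) \<le> l"]
  by (simp add: single_layer_one factor_support_def)

section \<open>Chebyshev approximation of conjunctions\<close>

fun chebyshev :: "nat \<Rightarrow> real \<Rightarrow> real" where
  "chebyshev 0 x = 1"
| "chebyshev (Suc 0) x = x"
| "chebyshev (Suc (Suc n)) x = 2 * x * chebyshev (Suc n) x - chebyshev n x"

lemma chebyshev_cos: "chebyshev n (cos t) = cos (real n * t)"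
proof (induction n rule: induct_nat_012)
  case (ge2 n)
  then show ?case using cos_times_cos[of t "real (Suc n) * t"] by (simp add: algebra_simps)
qed auto

lemma abs_chebyshev_le_1: "\<bar>x\<bar> \<le> 1 \<Longrightarrow> \<bar>chebyshev n x\<bar> \<le> 1"
  using chebyshev_cos[of n "arccos x"] by (simp add: abs_le_iff cos_arccos)

text \<open>Outside [-1, 1] the cosine parametrisation is replaced by (w + 1/w) / 2; it exhibits the
  exponential growth that normalises the approximate conjunction.\<close>

lemma chebyshev_joukowsky:
  assumes "w \<noteq> 0"
  shows "chebyshev n ((w + 1 / w) / 2) = (w ^ n + 1 / w ^ n) / 2"
proof (induction n rule: induct_nat_012)
  case (ge2 n)
  show ?case unfolding chebyshev.simps(3) ge2 using assms by (simp add: field_simps)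
qed auto

text \<open>The square of a Chebyshev polynomial that is rescaled so that \<open>{0..s - 1}\<close> lies in \<open>[-1, 1]\<close>
  while \<open>s\<close> is mapped to the Joukowsky image of \<open>1 + 1 / sqrt s\<close>, just outside that interval.\<close>
definition and_poly :: "nat \<Rightarrow> nat \<Rightarrow> real \<Rightarrow> real" where
  "and_poly D s x = (let w = 1 + 1 / sqrt s; y = (w + 1 / w) / 2
     in (chebyshev D (x * (y / s)) / chebyshev D y)\<^sup>2)"

text \<open>On [0, s - 1] the numerator is at most 1 in absolute value, while the denominator is at
  least exp L / 2; squaring the quotient gives 4 exp (-2 L). A degree of order L sqrt s suffices
  because w exceeds 1 by 1 / sqrt s.\<close>

lemma and_poly:
  assumes s: "1 \<le> s" and D: "2 * sqrt s * L \<le> real D"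
  shows "and_poly D s s = 1" "0 \<le> and_poly D s x"
    "\<lbrakk>0 \<le> x; x \<le> real s - 1\<rbrakk> \<Longrightarrow> and_poly D s x \<le> 4 * exp (- 2 * L)"
proof -
  define z where "z = 1 / sqrt s"
  define w where "w = 1 + z"
  define y where "y = (w + 1 / w) / 2"
  have q: "and_poly D s x = (chebyshev D (x * (y / s)) / chebyshev D y)\<^sup>2" for x
    by (simp add: and_poly_def Let_def y_def w_def z_def)
  have z: "0 < z" "z \<le> 1" using s by (auto simp: z_def)
  have z2: "z\<^sup>2 = 1 / s" using s by (simp add: z_def power_divide)
  have w: "0 < w" using z by (simp add: w_def)
  \<comment> \<open>Bounds w below by an exponential; raised to the power D >= 2 L / z it gives w^D
    >= exp L.\<close>
  have "exp (z / 2) \<le> 1 + z / 2 + (z / 2)\<^sup>2" using z by (intro exp_bound) auto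
  also have "\<dots> \<le> w"
  proof -
    have "(z / 2)\<^sup>2 \<le> z / 2" using z by (simp add: power2_eq_square mult_left_le)
    then show ?thesis unfolding w_def by linarith
  qed
  finally have "exp (z / 2) ^ D \<le> w ^ D" by (intro power_mono) auto
  then have "exp (real D * (z / 2)) \<le> w ^ D" by (simp only: exp_of_nat_mult)
  moreover have "L \<le> real D * (z / 2)" using D s by (simp add: z_def field_simps)
  then have "exp L \<le> exp (real D * (z / 2))" by (simp only: exp_le_cancel_iff)
  ultimately have expL: "exp L \<le> w ^ D" by (rule order_trans[rotated])
  have T: "exp L / 2 \<le> chebyshev D y"
  proof -
    have "exp L + 0 \<le> w ^ D + 1 / w ^ D" using w by (intro add_mono expL) simp
    moreover have "chebyshev D y = (w ^ D + 1 / w ^ D) / 2"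
      unfolding y_def by (rule chebyshev_joukowsky) (use w in simp)
    ultimately show ?thesis by simp
  qed
  then have T0: "0 < chebyshev D y" by (rule less_le_trans[rotated]) simp
  show "and_poly D s s = 1" using T0 s by (simp add: q)
  show "0 \<le> and_poly D s x" by (simp add: q)
  assume x: "0 \<le> x" "x \<le> real s - 1"
  have "y = 1 + z\<^sup>2 / (2 * (1 + z))" using z by (simp add: y_def w_def field_simps power2_eq_square)
  also have "\<dots> \<le> 1 + z\<^sup>2 / 1" using z by (intro add_left_mono divide_left_mono) auto
  finally have y: "y \<le> 1 + 1 / s" by (simp add: z2)
  have y0: "0 < y" using w by (simp add: y_def add_pos_pos)
  \<comment> \<open>The gap between s - 1 and s shrinks the argument by the factor 1 - 1/s, which
    outweighs y <= 1 + 1/s: the product is 1 - 1/s^2.\<close>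
  have "x * (y / s) \<le> (real s - 1) * ((1 + 1 / s) / s)"
    using x y y0 s by (intro mult_mono divide_right_mono) auto
  also have "\<dots> = 1 - 1 / (real s)\<^sup>2" using s by (simp add: field_simps power2_eq_square)
  also have "\<dots> \<le> 1" by simp
  finally have "\<bar>x * (y / s)\<bar> \<le> 1" using x y0 s by simp
  then have "\<bar>chebyshev D (x * (y / s))\<bar> \<le> 1" by (rule abs_chebyshev_le_1)
  then have "(chebyshev D (x * (y / s)))\<^sup>2 \<le> 1" by (simp add: abs_square_le_1)
  moreover have "(exp L / 2)\<^sup>2 \<le> (chebyshev D y)\<^sup>2" using T by (intro power_mono) auto
  ultimately have "and_poly D s x \<le> 1 / (exp L / 2)\<^sup>2"
    unfolding q power_divide[of "chebyshev D (x * (y / s))"] by (intro frac_le) auto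
  also have "\<dots> = 4 * exp (- 2 * L)"
  proof -
    have "exp (- 2 * L) = inverse (exp (2 * L))" using exp_minus[of "2 * L"] by simp
    then show ?thesis unfolding exp_double by (simp add: power_divide inverse_eq_divide)
  qed
  finally show "and_poly D s x \<le> 4 * exp (- 2 * L)" .
qed

section \<open>Degree calculus for diagonal operators\<close>

lemma low_degree_diag_const: "0 \<le> l \<Longrightarrow> low_degree m l (diag_op m (\<lambda>_. c))"
  using spanned_smult[OF low_degree_one, of l m c] diag_op_smult[of c m "\<lambda>_. 1"]
  by (simp add: diag_op_one)

lemma low_degree_diag_add:
  "low_degree m l (diag_op m f) \<Longrightarrow> low_degree m l (diag_op m g) \<Longrightarrow>
   low_degree m l (diag_op m (\<lambda>x. f x + g x))"
  using spanned_add[of m _ "diag_op m f" "diag_op m g"] by (simp add: diag_op_add)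

lemma low_degree_diag_cmult:
  "low_degree m l (diag_op m f) \<Longrightarrow> low_degree m l (diag_op m (\<lambda>x. c * f x))"
  using spanned_smult[of m _ "diag_op m f" c] by (simp add: diag_op_smult)

lemma low_degree_diag_mult:
  "low_degree m l (diag_op m f) \<Longrightarrow> low_degree m l' (diag_op m g) \<Longrightarrow>
   low_degree m (l + l') (diag_op m (\<lambda>x. f x * g x))"
  using low_degree_mult[of m l "diag_op m f" l' "diag_op m g"] by (simp add: diag_op_mult)

lemma low_degree_diag_sum:
  assumes "finite I" "0 \<le> l" "\<And>i. i \<in> I \<Longrightarrow> low_degree m l (diag_op m (f i))"
  shows "low_degree m l (diag_op m (\<lambda>x. \<Sum>i\<in>I. f i x))"
  using assms
  by (induction I rule: finite_induct) (auto intro: low_degree_diag_add low_degree_diag_const)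

lemma low_degree_diag_prod:
  assumes "finite I" "\<And>i. i \<in> I \<Longrightarrow> low_degree m (l i) (diag_op m (f i))"
  shows "low_degree m (\<Sum>i\<in>I. l i) (diag_op m (\<lambda>x. \<Prod>i\<in>I. f i x))"
  using assms
  by (induction I rule: finite_induct)
    (use low_degree_diag_const[of 0 m 1] in \<open>auto intro: low_degree_diag_mult\<close>)

text \<open>Reading bit i is the projector |1><1| at qubit i. The diagonal operators of low degree
  that follow are polynomials in these projectors.\<close>

lemma diag_op_qbit:
  assumes "i < m"
  shows "diag_op m (\<lambda>x. of_nat (qbit x i))
    = single_layer m (\<lambda>j. if j = i then mat 2 2 (\<lambda>(a, b). if a = b then of_nat a else 0) else 1\<^sub>m 2)"
proof (rule eq_matI)
  let ?v = "\<lambda>j. if j = i then mat 2 2 (\<lambda>(a, b). if a = b then of_nat a else 0) else 1\<^sub>m 2 :: complex mat"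
  fix x y assume "x < dim_row (single_layer m ?v)" "y < dim_col (single_layer m ?v)"
  then have xy: "x < 2 ^ m" "y < 2 ^ m" by (simp_all add: single_layer_def)
  show "diag_op m (\<lambda>x. of_nat (qbit x i)) $$ (x, y) = single_layer m ?v $$ (x, y)"
  proof (cases "x = y")
    case True
    have "(\<Prod>j<m. ?v j $$ (qbit x j, qbit x j)) = (\<Prod>j<m. if j = i then of_nat (qbit x i) else 1)"
      by (intro prod.cong) auto
    then show ?thesis using True xy assms by (simp add: index_diag_op index_single_layer)
  next
    case False
    then obtain j where "j < m" "qbit x j \<noteq> qbit y j" using qbit_eqI[OF xy] by blast
    then have "(\<Prod>j<m. ?v j $$ (qbit x j, qbit y j)) = (0 :: complex)"
      by (intro prod_zero) (auto intro!: bexI[of _ j])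
    then show ?thesis using False xy by (simp add: index_diag_op index_single_layer)
  qed
qed (simp_all add: single_layer_def diag_op_def)

lemma spanned_diag_qbit:
  assumes "i < m" "\<And>T. T \<subseteq> {i} \<Longrightarrow> Q T"
  shows "spanned m Q (diag_op m (\<lambda>x. of_nat (qbit x i)))"
  unfolding diag_op_qbit[OF assms(1)]
  by (rule spanned_product) (auto simp: factor_support_def intro!: assms(2))

lemma low_degree_diag_qbit: "i < m \<Longrightarrow> low_degree m 1 (diag_op m (\<lambda>x. of_nat (qbit x i)))"
  by (rule spanned_diag_qbit) (auto dest: subset_singletonD)

text \<open>The three-term recurrence multiplies by \<open>f\<close> once per step, which costs l
  each time.\<close>

lemma low_degree_diag_chebyshev:
  assumes "low_degree m l (diag_op m (\<lambda>x. complex_of_real (f x)))" "0 \<le> l"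
  shows "low_degree m (real n * l) (diag_op m (\<lambda>x. complex_of_real (chebyshev n (f x))))"
proof (induction n rule: induct_nat_012)
  case 0
  then show ?case using low_degree_diag_const[of 0 m 1] by simp
next
  case 1
  then show ?case using assms by simp
next
  case (ge2 j)
  have "low_degree m (l + real (Suc j) * l)
    (diag_op m (\<lambda>x. complex_of_real (f x) * complex_of_real (chebyshev (Suc j) (f x))))"
    by (intro low_degree_diag_mult assms ge2)
  then have a: "low_degree m (real (Suc (Suc j)) * l)
    (diag_op m (\<lambda>x. 2 * (complex_of_real (f x) * complex_of_real (chebyshev (Suc j) (f x)))))"
    by (intro low_degree_diag_cmult) (simp add: algebra_simps)
  have b: "low_degree m (real (Suc (Suc j)) * l) (diag_op m (\<lambda>x. (- 1) * complex_of_real (chebyshev j (f x))))"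
    by (intro low_degree_diag_cmult low_degree_mono[OF ge2(1)] mult_right_mono assms(2)) simp
  show ?case using low_degree_diag_add[OF a b] by (simp add: mult.assoc)
qed

lemma low_degree_diag_and_poly:
  assumes "low_degree m l (diag_op m (\<lambda>x. complex_of_real (f x)))" "0 \<le> l"
  shows "low_degree m (2 * real D * l) (diag_op m (\<lambda>x. complex_of_real (and_poly D s (f x))))"
proof -
  define w where "w = 1 + 1 / sqrt s"
  define y where "y = (w + 1 / w) / 2"
  have q: "and_poly D s x = (1 / (chebyshev D y)\<^sup>2) * (chebyshev D ((y / s) * x) * chebyshev D ((y / s) * x))" for x
    by (simp add: and_poly_def Let_def y_def w_def power_divide power2_eq_square mult.commute)
  have "low_degree m l (diag_op m (\<lambda>x. complex_of_real ((y / s) * f x)))"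
    using low_degree_diag_cmult[OF assms(1), of "complex_of_real (y / s)"] by simp
  then have c: "low_degree m (real D * l) (diag_op m (\<lambda>x. complex_of_real (chebyshev D ((y / s) * f x))))"
    by (rule low_degree_diag_chebyshev) (rule assms(2))
  show ?thesis
    using low_degree_diag_cmult[OF low_degree_diag_mult[OF c c], of "complex_of_real (1 / (chebyshev D y)\<^sup>2)"]
    unfolding q by (simp add: algebra_simps)
qed

section \<open>Conjugation by a CZ layer\<close>

lemma op_bounded_mult3:
  assumes "op_bounded P a" "op_bounded A b" "op_bounded R c" "0 \<le> a" "0 \<le> b"
    and "P \<in> carrier_mat n n" "A \<in> carrier_mat n n" "R \<in> carrier_mat n n"
  shows "op_bounded (P * A * R) (a * b * c)"
proof -
  have "0 \<le> a * b" using assms(4,5) by simp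
  then show ?thesis
    by (rule op_bounded_mult[OF op_bounded_mult[OF assms(1,2,6,7,4)] assms(3) mult_carrier_mat[OF assms(6,7)] assms(8)])
qed

lemma dim_diag_op [simp]: "dim_row (diag_op m f) = 2 ^ m" "dim_col (diag_op m f) = 2 ^ m"
  by (simp_all add: diag_op_def)

section \<open>CZ layers as diagonal sign matrices\<close>

definition cz_phase :: "nat set \<Rightarrow> nat \<Rightarrow> complex" where
  "cz_phase S x = (if \<forall>i\<in>S. qbit x i = 1 then -1 else 1)"

lemma cz_layer_eq_diag_op: "cz_layer m G = diag_op m (\<lambda>x. \<Prod>S\<in>G. cz_phase S x)"
  by (auto simp: cz_layer_def diag_op_def cz_phase_def intro!: eq_matI)

lemma cz_phase_square [simp]: "cz_phase S x * cz_phase S x = 1"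
  by (simp add: cz_phase_def)

lemma cz_phase_eq:
  assumes "finite S"
  shows "cz_phase S x = 1 + (- 2) * (\<Prod>i\<in>S. of_nat (qbit x i))"
proof (cases "\<forall>i\<in>S. qbit x i = 1")
  case True
  then show ?thesis by (simp add: cz_phase_def)
next
  case False
  then have "\<exists>i\<in>S. qbit x i = 0" using qbit_cases by blast
  then have "(\<Prod>i\<in>S. of_nat (qbit x i)) = (0 :: complex)" using assms by (auto intro: prod_zero)
  then show ?thesis using False by (simp add: cz_phase_def)
qed

lemma spanned_subset_diag_mult:
  "spanned m (\<lambda>T. T \<subseteq> R) (diag_op m f) \<Longrightarrow> spanned m (\<lambda>T. T \<subseteq> R) (diag_op m g) \<Longrightarrow>
   spanned m (\<lambda>T. T \<subseteq> R) (diag_op m (\<lambda>x. f x * g x))"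
  unfolding diag_op_mult[symmetric] by (erule (1) spanned_mult) auto

lemma spanned_subset_diag_const: "spanned m (\<lambda>T. T \<subseteq> R) (diag_op m (\<lambda>_. c))"
proof -
  have "spanned m (\<lambda>T. T \<subseteq> R) (c \<cdot>\<^sub>m single_layer m (\<lambda>_. 1\<^sub>m 2))"
    by (intro spanned_smult spanned_product) (auto simp: factor_support_def)
  then show ?thesis using diag_op_smult[of c m "\<lambda>_. 1"] by (simp add: single_layer_one diag_op_one)
qed

lemma spanned_subset_diag_prod:
  assumes "finite I" "\<And>i. i \<in> I \<Longrightarrow> spanned m (\<lambda>T. T \<subseteq> R) (diag_op m (f i))"
  shows "spanned m (\<lambda>T. T \<subseteq> R) (diag_op m (\<lambda>x. \<Prod>i\<in>I. f i x))"
  using assms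
  by (induction I rule: finite_induct) (auto intro: spanned_subset_diag_const spanned_subset_diag_mult)

lemma spanned_subset_cz_phase:
  assumes "finite S" "S \<subseteq> R" "S \<subseteq> {..<m}"
  shows "spanned m (\<lambda>T. T \<subseteq> R) (diag_op m (cz_phase S))"
proof -
  have "spanned m (\<lambda>T. T \<subseteq> R) (diag_op m (\<lambda>x. \<Prod>i\<in>S. of_nat (qbit x i)))"
    using assms by (intro spanned_subset_diag_prod spanned_diag_qbit) auto
  then have "spanned m (\<lambda>T. T \<subseteq> R) (diag_op m (\<lambda>_. 1) + (- 2) \<cdot>\<^sub>m diag_op m (\<lambda>x. \<Prod>i\<in>S. of_nat (qbit x i)))"
    by (intro spanned_add spanned_smult spanned_subset_diag_const)
  then show ?thesis
    by (simp add: diag_op_smult diag_op_add cz_phase_eq[OF assms(1), abs_def])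
qed

text \<open>Gates that do not meet the support of a product operator cancel against their mirror image,
  so conjugation enlarges the support by the gates that meet it only.\<close>
lemma low_degree_conj_small_gates:
  assumes A: "low_degree m l A"
    and G: "\<And>S. S \<in> G \<Longrightarrow> S \<subseteq> {..<m}" "\<And>S T. S \<in> G \<Longrightarrow> T \<in> G \<Longrightarrow> S \<noteq> T \<Longrightarrow> S \<inter> T = {}"
    and s: "\<And>S. S \<in> G \<Longrightarrow> card S \<le> s" "1 \<le> s"
  shows "low_degree m (real s * l) (cz_layer m G * A * cz_layer m G)"
proof -
  have fin: "finite G" using G(1) by (intro finite_subset[of G "Pow {..<m}"]) auto
  have finS: "finite S" if "S \<in> G" for S using G(1)[OF that] finite_subset by blast
  have Mc: "cz_layer m G \<in> carrier_mat (2 ^ m) (2 ^ m)" for G by (simp add: cz_layer_def)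
  from A show ?thesis
  proof (induction rule: spanned.induct)
    case (spanned_product v)
    define T where "T = factor_support m v"
    define N where "N = {S \<in> G. S \<inter> T \<noteq> {}}"
    define R where "R = T \<union> \<Union>N"
    have finT: "finite T" unfolding T_def by (rule finite_subset[OF factor_support_subset]) simp
    have eq: "cz_layer m G * single_layer m v * cz_layer m G = cz_layer m N * single_layer m v * cz_layer m N"
    proof (rule eq_matI)
      fix x y assume "x < dim_row (cz_layer m N * single_layer m v * cz_layer m N)"
        "y < dim_col (cz_layer m N * single_layer m v * cz_layer m N)"
      then have xy: "x < 2 ^ m" "y < 2 ^ m" by (simp_all add: cz_layer_def)
      define V where "V = single_layer m v $$ (x, y)"
      have entry: "(cz_layer m K * single_layer m v * cz_layer m K) $$ (x, y)
         = (\<Prod>S\<in>K. cz_phase S x) * V * (\<Prod>S\<in>K. cz_phase S y)" for K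
        unfolding cz_layer_eq_diag_op V_def using xy
        by (simp add: index_mult_diag_op index_diag_op_mult del: index_mult_mat(1))
      show "(cz_layer m G * single_layer m v * cz_layer m G) $$ (x, y)
          = (cz_layer m N * single_layer m v * cz_layer m N) $$ (x, y)"
      proof (cases "V = 0")
        case False
        \<comment> \<open>A nonzero entry (x, y) of a product operator forces x and y to agree
          wherever the factor is the identity, hence on every gate that misses T. Such a gate
          contributes the same sign on both sides, and the two signs cancel.\<close>
        have agree: "qbit x i = qbit y i" if "i < m" "i \<notin> T" for i
        proof (rule ccontr)
          assume "qbit x i \<noteq> qbit y i"
          moreover have "v i = 1\<^sub>m 2" using that by (simp add: T_def factor_support_def)
          ultimately have "(\<Prod>i<m. v i $$ (qbit x i, qbit y i)) = 0"
            using that(1) by (intro prod_zero) (auto intro!: bexI[of _ i])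
          then show False using False xy by (simp add: V_def index_single_layer)
        qed
        have far: "cz_phase S x = cz_phase S y" if "S \<in> G - N" for S
        proof -
          have "qbit x i = qbit y i" if "i \<in> S" for i
            using that \<open>S \<in> G - N\<close> G(1) by (intro agree) (auto simp: N_def)
          then show ?thesis by (simp add: cz_phase_def)
        qed
        have split: "(\<Prod>S\<in>G. cz_phase S z) = (\<Prod>S\<in>G - N. cz_phase S z) * (\<Prod>S\<in>N. cz_phase S z)" for z
          using fin by (intro prod.subset_diff) (auto simp: N_def)
        have "(\<Prod>S\<in>G - N. cz_phase S x) * (\<Prod>S\<in>G - N. cz_phase S y)
            = (\<Prod>S\<in>G - N. cz_phase S x * cz_phase S x)"
          unfolding prod.distrib[symmetric] by (intro prod.cong) (auto simp: far)
        then have "(\<Prod>S\<in>G - N. cz_phase S x) * (\<Prod>S\<in>G - N. cz_phase S y) = 1" by simp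
        then show ?thesis unfolding entry split by (simp add: algebra_simps)
      qed (simp add: entry)
    qed (simp_all add: cz_layer_def)
    have "spanned m (\<lambda>T. T \<subseteq> R) (cz_layer m N)"
      unfolding cz_layer_eq_diag_op
      by (intro spanned_subset_diag_prod spanned_subset_cz_phase[unfolded eta_contract_eq])
        (use fin finS G(1) in \<open>auto simp: N_def R_def\<close>)
    moreover have "spanned m (\<lambda>T. T \<subseteq> R) (single_layer m v)"
      using spanned_product(1) by (intro spanned.spanned_product) (auto simp: R_def T_def)
    ultimately have span: "spanned m (\<lambda>T. T \<subseteq> R) (cz_layer m N * single_layer m v * cz_layer m N)"
      by (intro spanned_mult[where ?Q1.0="\<lambda>T. T \<subseteq> R" and ?Q2.0="\<lambda>T. T \<subseteq> R"]) auto
    \<comment> \<open>\<open>g i\<close> is the gate through i, or {i} if there is none.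
      Disjointness makes that gate unique, so each support qubit drags in at most s qubits, and the
      sets \<open>g i\<close> cover R.\<close>
    define g where "g i = insert i (\<Union>{S \<in> G. i \<in> S})" for i
    have g: "finite (g i) \<and> card (g i) \<le> s" for i
    proof (cases "\<exists>S\<in>G. i \<in> S")
      case True
      then obtain S where S: "S \<in> G" "i \<in> S" by blast
      then have "g i = S" using G(2) unfolding g_def by blast
      then show ?thesis using S finS s(1) by auto
    next
      case False
      then have "g i = {i}" by (auto simp: g_def)
      then show ?thesis using s(2) by simp
    qed
    have "R \<subseteq> (\<Union>i\<in>T. g i)" by (auto simp: R_def N_def g_def)
    then have "card R \<le> card (\<Union>i\<in>T. g i)" using finT g by (intro card_mono) auto
    also have "\<dots> \<le> (\<Sum>i\<in>T. card (g i))" by (rule card_UN_le[OF finT])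
    also have "\<dots> \<le> (\<Sum>i\<in>T. s)" using g by (intro sum_mono) auto
    finally have "card R \<le> s * card T" by (simp add: mult.commute)
    then have "real (card R) \<le> real s * real (card T)" by (simp only: of_nat_le_iff of_nat_mult[symmetric])
    also have "\<dots> \<le> real s * l" using spanned_product(2) by (intro mult_left_mono) (auto simp: T_def)
    finally have R: "real (card R) \<le> real s * l" .
    have finR: "finite R" using finT fin finS unfolding R_def N_def by (intro finite_UnI finite_Union) auto
    have "real (card T') \<le> real s * l" if "T' \<subseteq> R" for T'
      using card_mono[OF finR that] R by linarith
    then have "spanned m (\<lambda>T. real (card T) \<le> real s * l) (cz_layer m N * single_layer m v * cz_layer m N)"
      by (rule spanned_mono[OF span])
    then show ?case by (simp only: eq)
  next
    case (spanned_smult A d)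
    note A = spanned_carrier[OF spanned_smult(1)]
    show ?case using spanned_smult(2) by (simp add: conj_linear[OF Mc Mc A A] spanned.spanned_smult)
  next
    case (spanned_add A B)
    note A = spanned_carrier[OF spanned_add(1)] and B = spanned_carrier[OF spanned_add(2)]
    show ?case using spanned_add(3,4) by (simp add: conj_linear[OF Mc Mc A B] spanned.spanned_add)
  qed
qed

text \<open>Keeps the approximate conjunctions q in [0, 1]; then 1 - 2 q lies in [-1, 1] and the
  approximate gates are contractions.\<close>

lemma exp_error_le_1: "1 \<le> L \<Longrightarrow> 4 * exp (- 2 * L) \<le> (1 :: real)"
proof -
  assume "1 \<le> L"
  then have "(2 :: real) \<le> exp L" using exp_ge_add_one_self[of L] by linarith
  then have "2 * 2 \<le> exp L * exp L" by (intro mult_mono) auto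
  then have "4 \<le> exp (2 * L)" by (simp add: exp_double power2_eq_square)
  then show ?thesis by (simp add: exp_minus field_simps)
qed

lemma approx_large_gates:
  fixes s L :: real
  assumes G: "\<And>S. S \<in> G \<Longrightarrow> S \<noteq> {} \<and> S \<subseteq> {..<m}" "\<And>S T. S \<in> G \<Longrightarrow> T \<in> G \<Longrightarrow> S \<noteq> T \<Longrightarrow> S \<inter> T = {}"
    and s: "\<And>S. S \<in> G \<Longrightarrow> s \<le> card S" "0 < s" and L: "1 \<le> L"
  obtains f where "low_degree m (6 * L * m / sqrt s) (diag_op m f)" "op_bounded (diag_op m f) 1"
    "op_bounded (cz_layer m G - diag_op m f) (2 * real m * (4 * exp (- 2 * L)))"
proof -
  define \<delta> where "\<delta> = 4 * exp (- 2 * L)"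
  define D where "D S = nat \<lceil>2 * sqrt (card S) * L\<rceil>" for S :: "nat set"
  define q where "q S x = and_poly (D S) (card S) (real (\<Sum>i\<in>S. qbit x i))" for S x
  define f where "f x = (\<Prod>S\<in>G. 1 - 2 * complex_of_real (q S x))" for x
  have \<delta>: "0 \<le> \<delta>" "\<delta> \<le> 1" using exp_error_le_1[OF L] by (auto simp: \<delta>_def)
  have fin: "finite G" using G(1) by (intro finite_subset[of G "Pow {..<m}"]) auto
  have finS: "finite S" if "S \<in> G" for S
    using finite_subset[OF conjunct2[OF G(1)[OF that]]] by simp
  have card1: "1 \<le> card S" if "S \<in> G" for S
    using G(1)[OF that] finS[OF that] by (simp add: Suc_leI card_gt_0_iff)
  have total: "(\<Sum>S\<in>G. card S) \<le> m"
  proof -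
    have "card (\<Union>G) = (\<Sum>S\<in>G. card S)"
    proof (rule card_Union_disjoint)
      show "pairwise disjnt G" unfolding pairwise_def disjnt_def by (intro ballI impI G(2))
    qed (rule finS)
    moreover have "\<Union>G \<subseteq> {..<m}" using G(1) by blast
    then have "card (\<Union>G) \<le> card {..<m}" by (intro card_mono) simp
    ultimately show ?thesis by simp
  qed
  have D: "2 * sqrt (card S) * L \<le> D S" for S unfolding D_def by linarith
  \<comment> \<open>Rounding up costs at most 1, which sqrt |S| L >= 1 absorbs by turning the factor
    2 into 3; the square in \<open>and_poly\<close> doubles it to 6. As |S| >= s, sqrt |S| is at
    most |S| / sqrt s, so the bound is linear in |S| and can be summed over disjoint gates.\<close>
  have D': "2 * real (D S) \<le> 6 * L / sqrt s * card S" if "S \<in> G" for S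
  proof -
    have sq: "1 \<le> sqrt (card S)" using card1[OF that] by simp
    have sL: "1 * 1 \<le> sqrt (card S) * L" using sq L by (intro mult_mono) auto
    have "0 \<le> 2 * sqrt (card S) * L" using L by simp
    then have "real (D S) \<le> 2 * sqrt (card S) * L + 1" unfolding D_def by linarith
    then have "real (D S) \<le> 3 * L * sqrt (card S)" using sL by (simp add: algebra_simps)
    moreover have "sqrt (card S) * sqrt s \<le> sqrt (card S) * sqrt (card S)"
      using s(1)[OF that] by (intro mult_left_mono) auto
    then have "sqrt (card S) \<le> card S / sqrt s" using s(2) by (simp add: pos_le_divide_eq)
    then have "3 * L * sqrt (card S) \<le> 3 * L * (card S / sqrt s)" using L by (intro mult_left_mono) auto
    moreover have "2 * (3 * L * (card S / sqrt s)) = 6 * L / sqrt s * card S" by simp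
    ultimately show ?thesis by linarith
  qed
  have low: "low_degree m (6 * L * m / sqrt s) (diag_op m f)"
  proof -
    have "low_degree m (2 * real (D S)) (diag_op m (\<lambda>x. 1 - 2 * complex_of_real (q S x)))" if "S \<in> G" for S
    proof -
      have "low_degree m 1 (diag_op m (\<lambda>x. \<Sum>i\<in>S. of_nat (qbit x i)))"
        using G(1)[OF that] finS[OF that] by (intro low_degree_diag_sum low_degree_diag_qbit) auto
      then have "low_degree m 1 (diag_op m (\<lambda>x. complex_of_real (real (\<Sum>i\<in>S. qbit x i))))" by simp
      from low_degree_diag_and_poly[OF this, of "D S" "card S"]
      have "low_degree m (2 * real (D S)) (diag_op m (\<lambda>x. complex_of_real (q S x)))" by (simp add: q_def)
      from low_degree_diag_add[OF low_degree_diag_const low_degree_diag_cmult[OF this], of 1 "- 2"]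
      show ?thesis by simp
    qed
    then have "low_degree m (\<Sum>S\<in>G. 2 * real (D S)) (diag_op m f)"
      unfolding f_def by (intro low_degree_diag_prod fin)
    moreover have "(\<Sum>S\<in>G. 2 * real (D S)) \<le> (\<Sum>S\<in>G. (6 * L / sqrt s) * real (card S))"
      using D' by (intro sum_mono) auto
    moreover have "\<dots> = (6 * L / sqrt s) * real (\<Sum>S\<in>G. card S)" by (simp add: sum_distrib_left)
    moreover have "\<dots> \<le> (6 * L / sqrt s) * m" using total L s(2)
      by (intro mult_left_mono) (auto simp del: of_nat_sum)
    ultimately show ?thesis by (elim low_degree_mono) simp
  qed
  \<comment> \<open>If all bits of S are set, the polynomial and hence the sign are exact. Otherwise
    at most |S| - 1 bits are set, so q lies between 0 and \<open>\<delta>\<close>, and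
    \<open>\<delta>\<close> is at most 1.\<close>
  have factor: "cmod (1 - 2 * complex_of_real (q S x)) \<le> 1
      \<and> cmod (cz_phase S x - (1 - 2 * complex_of_real (q S x))) \<le> 2 * \<delta>" if S: "S \<in> G" for S x
  proof (cases "\<forall>i\<in>S. qbit x i = 1")
    case True
    then have "q S x = 1" unfolding q_def using and_poly(1)[OF card1[OF S] D] by simp
    then show ?thesis using True \<delta> by (simp add: cz_phase_def)
  next
    case False
    then obtain i where i: "i \<in> S" "qbit x i = 0" using qbit_cases by blast
    have "(\<Sum>j\<in>S. qbit x j) = (\<Sum>j\<in>S - {i}. qbit x j)" using i finS[OF S] by (simp add: sum.remove)
    also have "\<dots> \<le> (\<Sum>j\<in>S - {i}. 1)" 
      by (intro sum_mono) (use qbit_less_2[of x] in \<open>simp add: less_Suc_eq_le numeral_2_eq_2\<close>)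
    also have "\<dots> = card S - 1" using i finS[OF S] by simp
    finally have "real (\<Sum>j\<in>S. qbit x j) \<le> real (card S) - 1" using card1[OF S] by linarith
    then have "q S x \<le> \<delta>" "0 \<le> q S x"
      unfolding q_def \<delta>_def using and_poly(2,3)[OF card1[OF S] D] by (simp_all del: of_nat_sum)
    moreover have "cmod (1 - 2 * complex_of_real (q S x)) = \<bar>1 - 2 * q S x\<bar>"
      using norm_of_real[of "1 - 2 * q S x"] by simp
    moreover have "cz_phase S x = 1" using False by (auto simp: cz_phase_def)
    moreover have "cmod (1 - (1 - 2 * complex_of_real (q S x))) = \<bar>2 * q S x\<bar>"
      using norm_of_real[of "2 * q S x"] by simp
    ultimately show ?thesis using \<delta> by (simp only:) linarith
  qed
  have "op_bounded (diag_op m f) 1"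
  proof (rule op_bounded_diag_op)
    fix x
    have "cmod (f x) \<le> (\<Prod>S\<in>G. cmod (1 - 2 * complex_of_real (q S x)))"
      unfolding f_def by (rule norm_prod_le)
    also have "\<dots> \<le> 1" by (intro prod_le_1 conjI norm_ge_zero conjunct1[OF factor])
    finally show "cmod (f x) \<le> 1" .
  qed simp
  moreover have "op_bounded (cz_layer m G - diag_op m f) (2 * real m * \<delta>)"
    unfolding cz_layer_eq_diag_op diag_op_diff
  proof (rule op_bounded_diag_op)
    fix x
    \<comment> \<open>Products of factors of modulus at most one differ by at most the sum of the
      factorwise differences.\<close>
    have "cmod ((\<Prod>S\<in>G. cz_phase S x) - f x)
        \<le> (\<Sum>S\<in>G. cmod (cz_phase S x - (1 - 2 * complex_of_real (q S x))))"
      unfolding f_def by (intro norm_prod_diff conjunct1[OF factor]) (simp_all add: cz_phase_def)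
    also have "\<dots> \<le> (\<Sum>S\<in>G. 2 * \<delta>)" by (intro sum_mono conjunct2[OF factor])
    also have "\<dots> \<le> 2 * real m * \<delta>"
    proof -
      have "(\<Sum>S\<in>G. 1) \<le> (\<Sum>S\<in>G. card S)" by (intro sum_mono card1)
      then have "card G \<le> m" using total by simp
      then show ?thesis using \<delta> by (simp add: mult_right_mono)
    qed
    finally show "cmod ((\<Prod>S\<in>G. cz_phase S x) - f x) \<le> 2 * real m * \<delta>" .
  qed (use \<delta> in simp)
  ultimately show ?thesis unfolding \<delta>_def by (intro that[OF low])
qed

section \<open>One CZ layer, split by gate size\<close>

lemma is_cz_layer_carrier: "is_cz_layer m M \<Longrightarrow> M \<in> carrier_mat (2 ^ m) (2 ^ m)"
  by (auto simp: is_cz_layer_def cz_layer_def)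

lemma adj_cz_layer: "adj (cz_layer m G) = cz_layer m G"
  unfolding cz_layer_eq_diag_op
proof -
  have "cnj (cz_phase S x) = cz_phase S x" for S x by (simp add: cz_phase_def)
  then show "adj (diag_op m (\<lambda>x. \<Prod>S\<in>G. cz_phase S x)) = diag_op m (\<lambda>x. \<Prod>S\<in>G. cz_phase S x)"
    by (intro eq_matI) (auto simp: adj_def diag_op_def)
qed

lemma op_bounded_cz_layer: "op_bounded (cz_layer m G) 1"
  unfolding cz_layer_eq_diag_op
proof (rule op_bounded_diag_op)
  have "cmod (cz_phase S x) = 1" for S x by (simp add: cz_phase_def)
  then show "cmod (\<Prod>S\<in>G. cz_phase S x) \<le> 1" for x
    using norm_prod_le[of "\<lambda>S. cz_phase S x" G] by simp
qed simp

text \<open>Diagonal gates commute, so M = M1 M2 = M2 M1 with the small gates M1 placed next to A: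
  these are conjugated exactly, and only M2 is approximated, by F on both sides. The two copies of F
  account for 12 = 2 * 6 in the degree and 4 = 2 * 2 in the error.\<close>

lemma approx_conj_cz_layer:
  assumes A: "low_degree m l A" "op_bounded A 1" and M: "is_cz_layer m M" and L: "1 \<le> L" and s: "1 \<le> s"
  obtains B where "low_degree m (real s * l + 12 * L * m / sqrt s) B" "op_bounded B 1"
    "op_bounded (M * A * M - B) (4 * real m * (4 * exp (- 2 * L)))"
proof -
  obtain G where G0: "\<forall>S\<in>G. S \<noteq> {} \<and> S \<subseteq> {..<m}"
      "\<forall>S\<in>G. \<forall>T\<in>G. S \<noteq> T \<longrightarrow> S \<inter> T = {}" and M: "M = cz_layer m G"
    using M unfolding is_cz_layer_def by (elim exE conjE)
  have G: "S \<noteq> {} \<and> S \<subseteq> {..<m}" "T \<in> G \<Longrightarrow> S \<noteq> T \<Longrightarrow> S \<inter> T = {}" if "S \<in> G" for S T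
    using G0 that by blast+
  have fin: "finite G" using G(1) by (intro finite_subset[of G "Pow {..<m}"]) auto
  define G1 where "G1 = {S \<in> G. card S \<le> s}"
  define G2 where "G2 = {S \<in> G. \<not> card S \<le> s}"
  define M1 where "M1 = cz_layer m G1"
  define M2 where "M2 = cz_layer m G2"
  note Ac = spanned_carrier[OF A(1)]
  have c: "M1 \<in> carrier_mat (2 ^ m) (2 ^ m)" "M2 \<in> carrier_mat (2 ^ m) (2 ^ m)"
    by (simp_all add: M1_def M2_def cz_layer_def)
  have "(\<Prod>S\<in>G. cz_phase S x) = (\<Prod>S\<in>G1. cz_phase S x) * (\<Prod>S\<in>G2. cz_phase S x)" for x
  proof -
    have "G = G1 \<union> G2" by (auto simp: G1_def G2_def)
    moreover have "prod (\<lambda>S. cz_phase S x) (G1 \<union> G2) = (\<Prod>S\<in>G1. cz_phase S x) * (\<Prod>S\<in>G2. cz_phase S x)"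
      by (rule prod.union_disjoint) (use fin in \<open>auto simp: G1_def G2_def\<close>)
    ultimately show ?thesis by simp
  qed
  then have M12: "M = M1 * M2" "M = M2 * M1"
    by (simp_all add: M M1_def M2_def cz_layer_eq_diag_op diag_op_mult mult.commute)
  define A' where "A' = M1 * A * M1"
  have A'c: "A' \<in> carrier_mat (2 ^ m) (2 ^ m)" using c Ac by (simp add: A'_def)
  have "M * A * M = M2 * M1 * A * (M1 * M2)" by (simp only: M12[symmetric])
  also have "\<dots> = M2 * A' * M2"
    using c Ac by (simp add: A'_def assoc_mult_mat[of _ "2 ^ m" "2 ^ m" _ "2 ^ m" _ "2 ^ m"])
  finally have MAM: "M * A * M = M2 * A' * M2" .
  have A'low: "low_degree m (real s * l) A'"
    unfolding A'_def M1_def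
    by (rule low_degree_conj_small_gates[OF A(1)]) (use G s in \<open>auto simp: G1_def\<close>)
  have A'b: "op_bounded A' 1"
    using op_bounded_mult3[OF op_bounded_cz_layer A(2) op_bounded_cz_layer _ _ c(1)[unfolded M1_def] Ac c(1)[unfolded M1_def]]
    by (simp add: A'_def M1_def)
  obtain f where f: "low_degree m (6 * L * m / sqrt s) (diag_op m f)" "op_bounded (diag_op m f) 1"
      "op_bounded (cz_layer m G2 - diag_op m f) (2 * real m * (4 * exp (- 2 * L)))"
    by (rule approx_large_gates[of G2 m "real s" L]) (use G s L in \<open>auto simp: G2_def\<close>)
  define F where "F = diag_op m f"
  have Fc: "F \<in> carrier_mat (2 ^ m) (2 ^ m)" by (simp add: F_def)
  define B where "B = F * A' * F"
  have "low_degree m (6 * L * m / sqrt s + real s * l + 6 * L * m / sqrt s) B"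
    unfolding B_def F_def by (intro low_degree_mult f A'low)
  then have 1: "low_degree m (real s * l + 12 * L * m / sqrt s) B" by (simp add: algebra_simps)
  have 2: "op_bounded B 1"
    using op_bounded_mult3[OF f(2) A'b f(2) _ _ diag_op_carrier A'c diag_op_carrier] by (simp add: B_def F_def)
  \<comment> \<open>Replacing M2 by F on one side at a time leaves each difference multiplied by
    contractions only.\<close>
  have "M2 * A' * M2 - B = (M2 - F) * A' * M2 + F * A' * (M2 - F)"
  proof (rule eq_matI)
    fix x y assume "x < dim_row ((M2 - F) * A' * M2 + F * A' * (M2 - F))"
      "y < dim_col ((M2 - F) * A' * M2 + F * A' * (M2 - F))"
    then have xy: "x < 2 ^ m" "y < 2 ^ m" using c Fc A'c by simp_all
    have "M2 = diag_op m (\<lambda>x. \<Prod>S\<in>G2. cz_phase S x)" by (simp add: M2_def cz_layer_eq_diag_op)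
    then show "(M2 * A' * M2 - B) $$ (x, y) = ((M2 - F) * A' * M2 + F * A' * (M2 - F)) $$ (x, y)"
      using xy A'c
      by (simp add: B_def F_def diag_op_diff index_mult_diag_op index_diag_op_mult algebra_simps
          del: index_mult_mat(1))
  qed (use c Fc A'c in \<open>simp_all add: B_def\<close>)
  moreover have "op_bounded ((M2 - F) * A' * M2 + F * A' * (M2 - F))
      (2 * real m * (4 * exp (- 2 * L)) * 1 * 1 + 1 * 1 * (2 * real m * (4 * exp (- 2 * L))))"
  proof (rule op_bounded_add)
    note d = minus_carrier_mat[OF Fc, of M2]
    show "op_bounded ((M2 - F) * A' * M2) (2 * real m * (4 * exp (- 2 * L)) * 1 * 1)"
      by (rule op_bounded_mult3[OF _ A'b _ _ _ d A'c c(2)])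
        (use f(3) op_bounded_cz_layer in \<open>simp_all add: M2_def F_def\<close>)
    show "op_bounded (F * A' * (M2 - F)) (1 * 1 * (2 * real m * (4 * exp (- 2 * L))))"
      by (rule op_bounded_mult3[OF _ A'b _ _ _ Fc A'c d])
        (use f(2,3) in \<open>simp_all add: M2_def F_def\<close>)
    show "(M2 - F) * A' * M2 \<in> carrier_mat (2 ^ m) (2 ^ m)" "F * A' * (M2 - F) \<in> carrier_mat (2 ^ m) (2 ^ m)"
      by (intro mult_carrier_square d Fc A'c c)+
  qed
  ultimately have 3: "op_bounded (M * A * M - B) (4 * real m * (4 * exp (- 2 * L)))"
    unfolding MAM by (simp add: mult_ac)
  show ?thesis by (rule that[OF 1 2 3])
qed

text \<open>Equating s l with m / sqrt s gives sqrt s = (m/l)^(1/3), called t, and the common value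
  m / t = m^(2/3) l^(1/3). Rounding s = t^2 up at most doubles it, whence 14 = 2 + 12.\<close>

lemma approx_conj_cz_layer_balanced:
  assumes A: "low_degree m l A" "op_bounded A 1" and M: "is_cz_layer m M" and L: "1 \<le> L"
    and l: "0 < l" and m: "1 \<le> m"
  obtains B where "low_degree m (14 * L * (m powr (2/3) * l powr (1/3))) B" "op_bounded B 1"
    "op_bounded (M * A * M - B) (4 * real m * (4 * exp (- 2 * L)))"
proof -
  \<comment> \<open>Degree m is always available, so l may be capped at m. This gives t >= 1, and
    then the integer s is at most t^2 + 1 <= 2 t^2.\<close>
  define k where "k = min l (real m)"
  have k: "0 < k" "k \<le> m" "k \<le> l" using l m by (auto simp: k_def)
  define t where "t = (m / k) powr (1/3)"
  define s where "s = nat \<lceil>t\<^sup>2\<rceil>"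
  have Ak: "low_degree m k A" using A(1) low_degree_trivial[OF A(1)] by (auto simp: k_def min_def)
  have t1: "1 \<le> t" unfolding t_def using k by (intro ge_one_powr_ge_zero) auto
  have t3: "t ^ 3 = m / k" using k m by (simp add: t_def powr_power)
  have t2: "1 \<le> t\<^sup>2" using t1 by simp
  have s: "t\<^sup>2 \<le> real s" "real s \<le> 2 * t\<^sup>2" "1 \<le> s" unfolding s_def using t2 by linarith+
  have st: "t \<le> sqrt s" using s(1) t1 by (intro real_le_rsqrt) auto
  have mt: "m / t = m powr (2/3) * k powr (1/3)"
  proof -
    have "m / t = m powr 1 * (k powr (1/3) / m powr (1/3))" using k m by (simp add: t_def powr_divide)
    also have "\<dots> = m powr (1 - 1/3) * k powr (1/3)" using m by (simp only: powr_diff) simp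
    finally show ?thesis by simp
  qed
  have "real s * k \<le> 2 * t\<^sup>2 * k" using s(2) k by (intro mult_right_mono) auto
  also have "t\<^sup>2 * k = m / t"
    using t3 t1 k by (simp add: field_simps power2_eq_square power3_eq_cube)
  then have "2 * t\<^sup>2 * k = 2 * (m / t)" by simp
  finally have a: "real s * k \<le> 2 * (m / t)" .
  have b: "12 * L * m / sqrt s \<le> 12 * (L * (m / t))"
  proof -
    have "12 * L * m / sqrt s \<le> 12 * L * m / t"
      using st t1 L s(3) by (intro divide_left_mono mult_pos_pos) auto
    then show ?thesis by simp
  qed
  have "1 * (m / t) \<le> L * (m / t)" using L t1 by (intro mult_right_mono) auto
  then have "real s * k + 12 * L * m / sqrt s \<le> 14 * (L * (m / t))" using a b by linarith
  then have "real s * k + 12 * L * m / sqrt s \<le> 14 * L * (m / t)" by simp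
  also have "\<dots> \<le> 14 * L * (m powr (2/3) * l powr (1/3))"
    unfolding mt using L k by (intro mult_left_mono powr_mono2) auto
  finally have deg: "real s * k + 12 * L * m / sqrt s \<le> 14 * L * (m powr (2/3) * l powr (1/3))" .
  show ?thesis
    by (rule approx_conj_cz_layer[OF Ak A(2) M L s(3)]) (rule that[OF low_degree_mono[OF _ deg]])
qed

section \<open>Circuits\<close>

lemma diff_eq_add_diff:
  fixes X Y B :: "complex mat"
  assumes "X \<in> carrier_mat n n" "Y \<in> carrier_mat n n" "B \<in> carrier_mat n n"
  shows "X - B = (X - Y) + (Y - B)"
  by (rule eq_matI) (use assms in auto)

lemma op_bounded_diff_triangle:
  assumes "op_bounded (X - Y) c" "op_bounded (Y - B) c'"
    and "X \<in> carrier_mat n n" "Y \<in> carrier_mat n n" "B \<in> carrier_mat n n"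
  shows "op_bounded (X - B) (c + c')"
  unfolding diff_eq_add_diff[OF assms(3-5)]
  by (rule op_bounded_add[OF assms(1,2)]) (use assms(3-5) in \<open>auto intro: minus_carrier_mat\<close>)

lemma op_bounded_conj_diff:
  assumes "op_bounded (X - Y) c" "op_bounded P 1" "op_bounded R 1" "0 \<le> c"
    and "X \<in> carrier_mat n n" "Y \<in> carrier_mat n n" "P \<in> carrier_mat n n" "R \<in> carrier_mat n n"
  shows "op_bounded (P * X * R - P * Y * R) c"
proof -
  have "op_bounded (P * (X - Y) * R) (1 * c * 1)"
    by (rule op_bounded_mult3[OF assms(2,1,3) _ assms(4,7) minus_carrier_mat[OF assms(6)] assms(8)]) simp
  then show ?thesis by (simp add: conj_linear(3)[OF assms(7,8,5,6)])
qed

lemma op_bounded_self_diff: "op_bounded (X - X) 0"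
proof -
  have "(X - X) *\<^sub>v v = 0\<^sub>v (dim_row X)" if "v \<in> carrier_vec (dim_col X)" for v
    using that by (intro eq_vecI) (auto simp: scalar_prod_def)
  then show ?thesis by (simp add: op_bounded_def vnorm_def)
qed

text \<open>Contractivity of the circuit and of its adjoint lets an error made at one layer pass
  through the remaining layers without growing.\<close>

lemma circ_bounded:
  assumes "\<And>j. j \<le> d \<Longrightarrow> is_single_layer m (L j)" "\<And>j. j \<in> {1..d} \<Longrightarrow> is_cz_layer m (M j)"
  shows "circ d L M \<in> carrier_mat (2 ^ m) (2 ^ m)" "op_bounded (circ d L M) 1" "op_bounded (adj (circ d L M)) 1"
proof -
  have "circ d L M \<in> carrier_mat (2 ^ m) (2 ^ m) \<and> op_bounded (circ d L M) 1 \<and> op_bounded (adj (circ d L M)) 1"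
    using assms
  proof (induction d)
    case 0
    then show ?case using is_single_layer_unitary(1) op_bounded_single_layer by simp
  next
    case (Suc d)
    then have IH: "circ d L M \<in> carrier_mat (2 ^ m) (2 ^ m)" "op_bounded (circ d L M) 1" "op_bounded (adj (circ d L M)) 1"
      by auto
    have l: "is_single_layer m (L (Suc d))" using Suc.prems(1) by blast
    have "is_cz_layer m (M (Suc d))" using Suc.prems(2) by simp
    then obtain G where G: "M (Suc d) = cz_layer m G" by (auto simp: is_cz_layer_def)
    have c: "L (Suc d) \<in> carrier_mat (2 ^ m) (2 ^ m)" "cz_layer m G \<in> carrier_mat (2 ^ m) (2 ^ m)"
      using is_single_layer_unitary(1)[OF l] by (simp_all add: cz_layer_def)
    have adj: "adj (circ (Suc d) L M) = adj (circ d L M) * cz_layer m G * adj (L (Suc d))"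
      using adj_mult[OF mult_carrier_square[OF c] IH(1)] adj_mult[OF c]
        assoc_mult_mat[OF adj_carrier[OF IH(1)] c(2) adj_carrier[OF c(1)]] by (simp add: G adj_cz_layer)
    have "op_bounded (circ (Suc d) L M) (1 * 1 * 1)"
      unfolding circ.simps G
      by (rule op_bounded_mult3[OF op_bounded_single_layer(1)[OF l] op_bounded_cz_layer IH(2) _ _ c IH(1)]) simp_all
    moreover have "op_bounded (adj (circ (Suc d) L M)) (1 * 1 * 1)"
      unfolding adj
      by (rule op_bounded_mult3[OF IH(3) op_bounded_cz_layer op_bounded_single_layer(2)[OF l] _ _
            adj_carrier[OF IH(1)] c(2) adj_carrier[OF c(1)]]) simp_all
    moreover have "circ (Suc d) L M \<in> carrier_mat (2 ^ m) (2 ^ m)" using c IH(1) by (simp add: G)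
    ultimately show ?case by simp
  qed
  then show "circ d L M \<in> carrier_mat (2 ^ m) (2 ^ m)" "op_bounded (circ d L M) 1" "op_bounded (adj (circ d L M)) 1"
    by auto
qed

text \<open>In the Heisenberg picture A meets the outermost layer first, so the induction peels that
  layer off and generalises over A and x. One layer sends a degree bound K x to 14 r m^(2/3) (K
  x)^(1/3). Since K = (14 r)^(3/2) solves 14 r K^(1/3) = K, the prefactor is the same at every
  depth, and only the map x -> m^(2/3) x^(1/3) is iterated.\<close>

lemma approx_conj_circ:
  fixes r x :: real
  assumes "\<And>j. j \<le> d \<Longrightarrow> is_single_layer m (L j)" "\<And>j. j \<in> {1..d} \<Longrightarrow> is_cz_layer m (M j)"
    and r: "1 \<le> r" and m: "1 \<le> m"
    and "low_degree m ((14 * r) powr (3/2) * x) A" "op_bounded A 1" "0 < x"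
  shows "\<exists>B. low_degree m ((14 * r) powr (3/2) * (m powr (1 - 3 powr (- real d)) * x powr (3 powr (- real d)))) B
    \<and> op_bounded (adj (circ d L M) * A * circ d L M - B) (d * (4 * real m * (4 * exp (- 2 * r))))"
  using assms(1,2,5-7)
proof (induction d arbitrary: A x)
  case 0
  have "is_single_layer m (L 0)" using 0 by simp
  from low_degree_conj_single_layer[OF 0(3) this]
  show ?case using m 0(5) by (intro exI[of _ "adj (L 0) * A * L 0"]) (simp add: op_bounded_self_diff)
next
  case (Suc d)
  let ?K = "(14 * r) powr (3/2)"
  let ?e = "4 * real m * (4 * exp (- 2 * r))"
  define L1 where "L1 = L (Suc d)"
  define C where "C = circ d L M"
  define A1 where "A1 = adj L1 * A * L1"
  have l: "is_single_layer m L1" using Suc.prems(1) unfolding L1_def by blast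
  have M: "is_cz_layer m (M (Suc d))" using Suc.prems(2) by simp
  then obtain G where G: "M (Suc d) = cz_layer m G" by (auto simp: is_cz_layer_def)
  define M1 where "M1 = cz_layer m G"
  note Ac = spanned_carrier[OF Suc.prems(3)] and Lc = is_single_layer_unitary(1)[OF l]
  have Mc: "M1 \<in> carrier_mat (2 ^ m) (2 ^ m)" by (simp add: M1_def cz_layer_def)
  have sub: "j \<le> d \<Longrightarrow> is_single_layer m (L j)" "j \<in> {1..d} \<Longrightarrow> is_cz_layer m (M j)" for j
    by (rule Suc.prems, simp)+
  have C: "C \<in> carrier_mat (2 ^ m) (2 ^ m)" "op_bounded C 1" "op_bounded (adj C) 1"
    unfolding C_def
    by (rule circ_bounded(1)[of d m L M, OF sub]; assumption)
      (rule circ_bounded(2)[of d m L M, OF sub] circ_bounded(3)[of d m L M, OF sub]; assumption)+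
  have A1: "low_degree m (?K * x) A1"
    unfolding A1_def by (rule low_degree_conj_single_layer[OF Suc.prems(3) l])
  have "op_bounded A1 (1 * 1 * 1)"
    unfolding A1_def
    by (rule op_bounded_mult3[OF op_bounded_single_layer(2)[OF l] Suc.prems(4) op_bounded_single_layer(1)[OF l]
          _ _ adj_carrier[OF Lc] Ac Lc]) simp_all
  then have A1b: "op_bounded A1 1" by simp
  have A1c: "A1 \<in> carrier_mat (2 ^ m) (2 ^ m)" using spanned_carrier[OF A1] .
  have Kx: "0 < ?K * x" using r Suc.prems(5) by simp
  obtain B1 where B1: "low_degree m (14 * r * (m powr (2/3) * (?K * x) powr (1/3))) B1" "op_bounded B1 1"
      "op_bounded (M1 * A1 * M1 - B1) ?e"
    by (rule approx_conj_cz_layer_balanced[OF A1 A1b M r Kx m]) (simp add: G M1_def)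
  define x1 where "x1 = m powr (2/3) * x powr (1/3)"
  have x1: "0 < x1" using m Suc.prems(5) by (simp add: x1_def)
  have "14 * r * (m powr (2/3) * (?K * x) powr (1/3)) = (14 * r) * ?K powr (1/3) * x1"
    using r Suc.prems(5) by (simp add: x1_def powr_mult)
  also have "(14 * r) * ?K powr (1/3) = (14 * r) powr 1 * (14 * r) powr (1/2)"
    using r by (simp add: powr_powr)
  also have "\<dots> = ?K" by (simp only: powr_add[symmetric]) simp
  finally have B1': "low_degree m (?K * x1) B1" using B1(1) by simp
  note B1c = spanned_carrier[OF B1']
  obtain B where B: "low_degree m (?K * (m powr (1 - 3 powr (- real d)) * x1 powr (3 powr (- real d)))) B"
      "op_bounded (adj C * B1 * C - B) (d * ?e)"
    using Suc.IH[OF sub B1' B1(2) x1] unfolding C_def by blast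
  note Bc = spanned_carrier[OF B(1)]
  \<comment> \<open>Aligns the exponents: with u = 3^(-(d+1)) the powers of m add up to (1 - 3 u) +
    (2/3) (3 u) = 1 - u.\<close>
  have three: "3 powr (- real d) = 3 * 3 powr (- real (Suc d))"
    using powr_add[of "3 :: real" 1 "- real (Suc d)"] by simp
  have "m powr (1 - 3 powr (- real d)) * x1 powr (3 powr (- real d))
      = (m powr (1 - 3 powr (- real d)) * m powr (2/3 * 3 powr (- real d))) * x powr (1/3 * 3 powr (- real d))"
    using Suc.prems(5) by (simp add: x1_def powr_mult powr_powr)
  also have "\<dots> = m powr (1 - 3 powr (- real d) + 2/3 * 3 powr (- real d)) * x powr (1/3 * 3 powr (- real d))"
    by (simp only: powr_add)
  also have "\<dots> = m powr (1 - 3 powr (- real (Suc d))) * x powr (3 powr (- real (Suc d)))"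
    unfolding three by (simp add: field_simps)
  finally have deg: "low_degree m (?K * (m powr (1 - 3 powr (- real (Suc d))) * x powr (3 powr (- real (Suc d))))) B"
    using B(1) by simp
  have eq: "adj (circ (Suc d) L M) * A * circ (Suc d) L M = adj C * (M1 * A1 * M1) * C"
  proof -
    have "adj (circ (Suc d) L M) = adj C * (M1 * adj L1)"
      using adj_mult[OF mult_carrier_square[OF Lc Mc] C(1)] adj_mult[OF Lc Mc]
      by (simp add: C_def L1_def M1_def G adj_cz_layer)
    then show ?thesis
      using C(1) Mc Lc Ac adj_carrier[OF Lc] adj_carrier[OF C(1)]
      by (simp add: A1_def assoc_mult_mat[of _ "2 ^ m" "2 ^ m" _ "2 ^ m" _ "2 ^ m"] G
          flip: C_def L1_def M1_def)
  qed
  have "op_bounded (adj C * (M1 * A1 * M1) * C - adj C * B1 * C) ?e"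
    by (rule op_bounded_conj_diff[OF B1(3) C(3,2) _ _ B1c adj_carrier[OF C(1)] C(1)]) (use Mc A1c in simp_all)
  from op_bounded_diff_triangle[OF this B(2) _ _ Bc]
  have "op_bounded (adj (circ (Suc d) L M) * A * circ (Suc d) L M - B) (?e + d * ?e)"
    unfolding eq using C(1) adj_carrier[OF C(1)] Mc A1c B1c by simp
  moreover have "?e + d * ?e = real (Suc d) * ?e" by (simp add: algebra_simps)
  ultimately show ?case using deg by (intro exI[of _ B] conjI) simp_all
qed

section \<open>Padding a circuit with idle low-order qubits\<close>

definition ext_op :: "nat \<Rightarrow> nat \<Rightarrow> complex mat \<Rightarrow> complex mat" where
  "ext_op k m A = mat (2 ^ (k + m)) (2 ^ (k + m))
     (\<lambda>(i, j). if i mod 2 ^ k = j mod 2 ^ k then A $$ (i div 2 ^ k, j div 2 ^ k) else 0)"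

lemma ext_op_carrier [simp]: "ext_op k m A \<in> carrier_mat (2 ^ (k + m)) (2 ^ (k + m))"
  by (simp add: ext_op_def)

lemma div_less_power: "x < 2 ^ (k + m) \<Longrightarrow> x div 2 ^ k < (2 ^ m :: nat)"
  by (simp add: power_add less_mult_imp_div_less mult.commute)

lemma prod_lessThan_add: "(\<Prod>i<k + m. f i) = (\<Prod>i<k. f i) * (\<Prod>i<m. f (k + i))"
  for f :: "nat \<Rightarrow> 'a::comm_monoid_mult"
  by (induction m) (auto simp: mult.assoc)

lemma ext_op_mult:
  assumes "A \<in> carrier_mat (2 ^ m) (2 ^ m)" "B \<in> carrier_mat (2 ^ m) (2 ^ m)"
  shows "ext_op k m (A * B) = ext_op k m A * ext_op k m B"
proof (rule eq_matI)
  fix x y assume "x < dim_row (ext_op k m A * ext_op k m B)" "y < dim_col (ext_op k m A * ext_op k m B)"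
  then have xy: "x < 2 ^ (k + m)" "y < 2 ^ (k + m)" by (simp_all add: ext_op_def)
  note dv = div_less_power[OF xy(1)] div_less_power[OF xy(2)]
  have "(ext_op k m A * ext_op k m B) $$ (x, y)
      = (\<Sum>l<2 ^ (k + m). ext_op k m A $$ (x, l) * ext_op k m B $$ (l, y))"
    using xy by (intro index_mult_mat_sum) auto
  also have "\<dots> = (\<Sum>z<2 ^ m. \<Sum>i<2 ^ k. ext_op k m A $$ (x, i + 2 ^ k * z) * ext_op k m B $$ (i + 2 ^ k * z, y))"
    by (rule sum_power_split)
  also have "\<dots> = (\<Sum>z<2 ^ m. \<Sum>i<2 ^ k. if i = x mod 2 ^ k then
      (if x mod 2 ^ k = y mod 2 ^ k then A $$ (x div 2 ^ k, z) * B $$ (z, y div 2 ^ k) else 0) else 0)"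
    using xy by (intro sum.cong refl) (auto simp: ext_op_def add_mult_less_power)
  also have "\<dots> = (\<Sum>z<2 ^ m. if x mod 2 ^ k = y mod 2 ^ k then A $$ (x div 2 ^ k, z) * B $$ (z, y div 2 ^ k) else 0)"
    by simp
  also have "\<dots> = ext_op k m (A * B) $$ (x, y)"
    using xy index_mult_mat_sum[OF assms dv] by (simp add: ext_op_def)
  finally show "ext_op k m (A * B) $$ (x, y) = (ext_op k m A * ext_op k m B) $$ (x, y)" by simp
qed (simp_all add: ext_op_def)

lemma ext_op_single_layer:
  "ext_op k m (single_layer m u) = single_layer (k + m) (\<lambda>i. if i < k then 1\<^sub>m 2 else u (i - k))"
proof (rule eq_matI)
  let ?v = "\<lambda>i. if i < k then 1\<^sub>m 2 else u (i - k)"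
  fix x y assume "x < dim_row (single_layer (k + m) ?v)" "y < dim_col (single_layer (k + m) ?v)"
  then have xy: "x < 2 ^ (k + m)" "y < 2 ^ (k + m)" by (simp_all add: single_layer_def)
  note dv = div_less_power[OF xy(1)] div_less_power[OF xy(2)]
  have "(\<Prod>i<k. 1\<^sub>m 2 $$ (qbit x i, qbit y i)) = single_layer k (\<lambda>_. 1\<^sub>m 2) $$ (x mod 2 ^ k, y mod 2 ^ k)"
    by (simp add: index_single_layer qbit_mod)
  also have "\<dots> = (if x mod 2 ^ k = y mod 2 ^ k then 1 else 0)" by (simp add: single_layer_one)
  finally show "ext_op k m (single_layer m u) $$ (x, y) = single_layer (k + m) ?v $$ (x, y)"
    using xy dv by (simp add: ext_op_def index_single_layer prod_lessThan_add qbit_div)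
qed (simp_all add: ext_op_def single_layer_def)

lemma unitary2_one: "unitary2 (1\<^sub>m 2)"
  by (auto simp: unitary2_def adj_def intro!: eq_matI)

lemma is_single_layer_ext_op: "is_single_layer m L \<Longrightarrow> is_single_layer (k + m) (ext_op k m L)"
proof -
  assume "is_single_layer m L"
  then obtain u where u: "\<And>i. i < m \<Longrightarrow> unitary2 (u i)" and L: "L = single_layer m u"
    by (auto simp: is_single_layer_def)
  have "\<forall>i<k + m. unitary2 (if i < k then 1\<^sub>m 2 else u (i - k))" using u unitary2_one by auto
  then show ?thesis unfolding L ext_op_single_layer is_single_layer_def 
    by (intro exI[of _ "\<lambda>i. if i < k then 1\<^sub>m 2 else u (i - k)"] conjI refl)
qed

lemma ext_op_cz_layer: "ext_op k m (cz_layer m G) = cz_layer (k + m) ((\<lambda>S. (+) k ` S) ` G)"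
proof (rule eq_matI)
  let ?G = "(\<lambda>S. (+) k ` S) ` G"
  fix x y assume "x < dim_row (cz_layer (k + m) ?G)" "y < dim_col (cz_layer (k + m) ?G)"
  then have xy: "x < 2 ^ (k + m)" "y < 2 ^ (k + m)" by (simp_all add: cz_layer_def)
  note dv = div_less_power[OF xy(1)] div_less_power[OF xy(2)]
  have "inj_on (\<lambda>S. (+) k ` S) G" by (intro inj_onI) (simp add: inj_image_eq_iff)
  then have "(\<Prod>S\<in>?G. if \<forall>i\<in>S. qbit x i = 1 then - 1 else 1)
      = (\<Prod>S\<in>G. if \<forall>i\<in>S. qbit (x div 2 ^ k) i = 1 then - 1 else (1 :: complex))"
    by (simp add: prod.reindex qbit_div)
  moreover have "x = y \<longleftrightarrow> x mod 2 ^ k = y mod 2 ^ k \<and> x div 2 ^ k = y div 2 ^ k"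
    by (metis div_mult_mod_eq)
  ultimately show "ext_op k m (cz_layer m G) $$ (x, y) = cz_layer (k + m) ?G $$ (x, y)"
    using xy dv by (auto simp: ext_op_def cz_layer_def)
qed (simp_all add: ext_op_def cz_layer_def)

lemma is_cz_layer_ext_op: "is_cz_layer m M \<Longrightarrow> is_cz_layer (k + m) (ext_op k m M)"
proof -
  assume "is_cz_layer m M"
  then obtain G where G: "\<forall>S\<in>G. S \<noteq> {} \<and> S \<subseteq> {..<m}" "\<forall>S\<in>G. \<forall>T\<in>G. S \<noteq> T \<longrightarrow> S \<inter> T = {}"
      "M = cz_layer m G"
    unfolding is_cz_layer_def by (elim exE conjE)
  show ?thesis
    unfolding is_cz_layer_def
  proof (intro exI conjI)
    show "ext_op k m M = cz_layer (k + m) ((\<lambda>S. (+) k ` S) ` G)" by (simp add: G(3) ext_op_cz_layer)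
    show "\<forall>S\<in>(\<lambda>S. (+) k ` S) ` G. S \<noteq> {} \<and> S \<subseteq> {..<k + m}" using G(1) by fastforce
    show "\<forall>S\<in>(\<lambda>S. (+) k ` S) ` G. \<forall>T\<in>(\<lambda>S. (+) k ` S) ` G. S \<noteq> T \<longrightarrow> S \<inter> T = {}"
    proof (intro ballI impI)
      fix S' T' assume "S' \<in> (\<lambda>S. (+) k ` S) ` G" "T' \<in> (\<lambda>S. (+) k ` S) ` G" "S' \<noteq> T'"
      then obtain S T where "S \<in> G" "T \<in> G" "S \<noteq> T" and S'T': "S' = (+) k ` S" "T' = (+) k ` T" by blast
      then have "S \<inter> T = {}" using G(2) by blast
      then show "S' \<inter> T' = {}" unfolding S'T' by auto
    qed
  qed
qed

text \<open>The k idle qubits hold the EPR partners of the circuit's outputs and later form the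
  output register of the Choi operator. Padding keeps depth and layer structure, so the padded
  circuit is again subject to \<open>approx_conj_circ\<close>.\<close>

lemma qac0_circuit_ext_op:
  assumes "qac0_circuit m d U"
  shows "qac0_circuit (k + m) d (ext_op k m U)"
proof -
  obtain L M where LM0: "\<forall>j\<le>d. is_single_layer m (L j)" "\<forall>j\<in>{1..d}. is_cz_layer m (M j)"
      and U: "U = circ d L M"
    using assms unfolding qac0_circuit_def by (elim exE conjE)
  have LM: "j \<le> d \<Longrightarrow> is_single_layer m (L j)" "j \<in> {1..d} \<Longrightarrow> is_cz_layer m (M j)" for j
    using LM0 by blast+
  have "ext_op k m (circ d L M) = circ d (\<lambda>j. ext_op k m (L j)) (\<lambda>j. ext_op k m (M j))"
    using LM
  proof (induction d)
    case (Suc d)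
    have sub: "j \<le> d \<Longrightarrow> is_single_layer m (L j)" "j \<in> {1..d} \<Longrightarrow> is_cz_layer m (M j)" for j
      by (rule Suc.prems, simp)+
    have c: "L (Suc d) \<in> carrier_mat (2 ^ m) (2 ^ m)" "M (Suc d) \<in> carrier_mat (2 ^ m) (2 ^ m)"
      by (rule is_single_layer_unitary(1)[OF Suc.prems(1)], simp)
        (rule is_cz_layer_carrier[OF Suc.prems(2)], simp)
    have c': "circ d L M \<in> carrier_mat (2 ^ m) (2 ^ m)" by (rule circ_bounded(1)[OF sub])
    have "ext_op k m (circ d L M) = circ d (\<lambda>j. ext_op k m (L j)) (\<lambda>j. ext_op k m (M j))"
      by (rule Suc.IH[OF sub])
    then show ?case by (simp add: ext_op_mult[OF mult_carrier_square[OF c] c'] ext_op_mult[OF c])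
  qed simp
  then show ?thesis
    unfolding U qac0_circuit_def
    by (intro exI[of _ "\<lambda>j. ext_op k m (L j)"] exI[of _ "\<lambda>j. ext_op k m (M j)"])
      (auto intro!: is_single_layer_ext_op is_cz_layer_ext_op LM)
qed

section \<open>Contraction with a density operator\<close>

text \<open>Cholesky decomposition: the induction splits off the last index and passes to the Schur
  complement, which is again positive semidefinite.\<close>

lemma psd_sum_of_rank_one:
  fixes g :: "nat \<Rightarrow> nat \<Rightarrow> complex"
  assumes "\<And>i j. i < n \<Longrightarrow> j < n \<Longrightarrow> g i j = cnj (g j i)"
    and "\<And>u. 0 \<le> Re (\<Sum>i<n. \<Sum>j<n. cnj (u i) * g i j * u j)"
  shows "\<exists>w. \<forall>i<n. \<forall>j<n. g i j = (\<Sum>r<n. w r i * cnj (w r j))"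
  using assms
proof (induction n arbitrary: g)
  case (Suc n)
  define S where "S u = (\<Sum>j<n. g n j * u j)" for u
  define Q where "Q u = (\<Sum>i<n. \<Sum>j<n. cnj (u i) * g i j * u j)" for u
  define c where "c = Re (g n n)"
  have herm: "g i j = cnj (g j i)" if "i \<le> n" "j \<le> n" for i j
    using that by (intro Suc.prems(1)) auto
  have "Im (g n n) = - Im (g n n)"
    using arg_cong[OF herm[OF order_refl order_refl], of Im] unfolding cnj.sel .
  then have gnn: "g n n = complex_of_real c" by (simp add: c_def complex_eq_iff)
  have S': "(\<Sum>i<n. cnj (u i) * g i n) = cnj (S u)" for u
    unfolding S_def cnj_sum
  proof (intro sum.cong refl)
    fix i assume "i \<in> {..<n}"
    then have "g i n = cnj (g n i)" by (intro herm) auto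
    then show "cnj (u i) * g i n = cnj (g n i * u i)" by simp
  qed
  \<comment> \<open>Positivity evaluated at the vector u extended by an entry b in the last
    position; b will be chosen freely.\<close>
  have expand: "0 \<le> Re (Q u) + 2 * Re (cnj b * S u) + c * (cmod b)\<^sup>2" for u b
  proof -
    define u' where "u' = u(n := b)"
    have "(\<Sum>i<Suc n. \<Sum>j<Suc n. cnj (u' i) * g i j * u' j)
        = (\<Sum>i<n. (\<Sum>j<n. cnj (u i) * g i j * u j) + cnj (u i) * g i n * b)
          + ((\<Sum>j<n. cnj b * g n j * u j) + cnj b * g n n * b)"
      by (simp add: u'_def)
    also have "\<dots> = Q u + cnj (S u) * b + (cnj b * S u + cnj b * b * complex_of_real c)"
      unfolding S'[symmetric] by (simp add: sum.distrib Q_def S_def sum_distrib_left sum_distrib_right gnn mult_ac)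
    finally have "0 \<le> Re (Q u + cnj (S u) * b + (cnj b * S u + cnj b * b * complex_of_real c))"
      using Suc.prems(2)[of u'] by simp
    then show ?thesis unfolding cmod_power2 by (simp add: algebra_simps power2_eq_square)
  qed
  have c0: "0 \<le> c" using expand[of "\<lambda>_. 0" 1] by (simp add: Q_def S_def)
  show ?case
  proof (cases "c = 0")
    case True
    have S0: "S u = 0" for u
    proof (rule ccontr)
      assume "S u \<noteq> 0"
      then have p: "0 < (cmod (S u))\<^sup>2" by simp
      \<comment> \<open>With c = 0 the form is linear in b, so a nonzero S u could make it negative:
        b = -T S u gives Re Q - 2 (|Re Q| + 1) < 0. Hence the last row and column vanish.\<close>
      define T where "T = (\<bar>Re (Q u)\<bar> + 1) / (cmod (S u))\<^sup>2"
      have "Re (cnj (- complex_of_real T * S u) * S u) = - T * (cmod (S u))\<^sup>2"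
        unfolding cmod_power2 by (simp add: algebra_simps power2_eq_square)
      also have "\<dots> = - (\<bar>Re (Q u)\<bar> + 1)" using p by (simp add: T_def)
      finally show False using expand[of u "- complex_of_real T * S u"] True by simp
    qed
    have gn0: "g n j = 0" if "j < n" for j
    proof -
      have "S (\<lambda>i. if i = j then 1 else 0) = g n j" using that by (simp add: S_def if_distrib cong: if_cong)
      then show ?thesis using S0 by simp
    qed
    have "\<exists>w. \<forall>i<n. \<forall>j<n. g i j = (\<Sum>r<n. w r i * cnj (w r j))"
    proof (rule Suc.IH)
      show "g i j = cnj (g j i)" if "i < n" "j < n" for i j using that by (intro herm) auto
      show "0 \<le> Re (\<Sum>i<n. \<Sum>j<n. cnj (u i) * g i j * u j)" for u
        using expand[of u 0] by (simp add: Q_def)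
    qed
    then obtain w where w: "\<forall>i<n. \<forall>j<n. g i j = (\<Sum>r<n. w r i * cnj (w r j))" by blast
    have gj0: "g j n = 0" if "j < n" for j using gn0[OF that] herm[of j n] that by simp
    show ?thesis
      by (intro exI[of _ "\<lambda>r i. if r < n \<and> i < n then w r i else 0"])
        (use w gn0 gj0 True gnn in \<open>auto simp: less_Suc_eq\<close>)
  next
    case False
    then have cpos: "0 < c" using c0 by simp
    \<comment> \<open>The Schur complement of the last diagonal entry; the subtracted matrix is the
      rank-one term that \<open>w'\<close> adds back.\<close>
    define h where "h i j = g i j - g i n * g n j / complex_of_real c" for i j
    have "\<exists>w. \<forall>i<n. \<forall>j<n. h i j = (\<Sum>r<n. w r i * cnj (w r j))"
    proof (rule Suc.IH)
      show "h i j = cnj (h j i)" if "i < n" "j < n" for i j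
        using herm[of i j] herm[of i n] herm[of n j] that by (simp add: h_def)
      fix u
      have "(\<Sum>i<n. \<Sum>j<n. cnj (u i) * h i j * u j)
          = (\<Sum>i<n. \<Sum>j<n. cnj (u i) * g i j * u j - (cnj (u i) * g i n) * (g n j * u j) / complex_of_real c)"
        by (intro sum.cong refl) (simp add: h_def algebra_simps)
      also have "\<dots> = Q u - (\<Sum>i<n. cnj (u i) * g i n) * S u / complex_of_real c"
        by (simp add: Q_def S_def sum_subtractf sum_product sum_divide_distrib)
      also have "\<dots> = Q u - complex_of_real ((cmod (S u))\<^sup>2 / c)"
        unfolding S' by (simp add: complex_norm_square[symmetric] mult.commute[of "cnj _"])
      finally have eq: "Re (\<Sum>i<n. \<Sum>j<n. cnj (u i) * h i j * u j) = Re (Q u) - (cmod (S u))\<^sup>2 / c" by simp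
      \<comment> \<open>\<open>A\<close> and \<open>B\<close> evaluate \<open>expand\<close> at b =
        - S u / c, the minimiser in b. Completing the square leaves Re Q - |S u|^2 / c, which is the
        form of \<open>h\<close>.\<close>
      have A: "Re (cnj (- (S u / complex_of_real c)) * S u) = - ((cmod (S u))\<^sup>2 / c)"
        unfolding cmod_power2 by (simp add: power2_eq_square add_divide_distrib)
      have B: "c * (cmod (- (S u / complex_of_real c)))\<^sup>2 = (cmod (S u))\<^sup>2 / c"
        using cpos by (simp add: norm_divide power_divide power2_eq_square)
      show "0 \<le> Re (\<Sum>i<n. \<Sum>j<n. cnj (u i) * h i j * u j)"
        using expand[of u "- (S u / complex_of_real c)"] unfolding eq A B by linarith
    qed
    then obtain w where w: "\<forall>i<n. \<forall>j<n. h i j = (\<Sum>r<n. w r i * cnj (w r j))" by blast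
    define w' where "w' r i = (if r < n then (if i < n then w r i else 0) else g i n / complex_of_real (sqrt c))" for r i
    have "g i j = (\<Sum>r<Suc n. w' r i * cnj (w' r j))" if ij: "i < Suc n" "j < Suc n" for i j
    proof -
      have "complex_of_real (sqrt c) * complex_of_real (sqrt c) = complex_of_real c"
        using c0 by (simp flip: of_real_mult)
      then have last: "w' n i * cnj (w' n j) = g i n * g n j / complex_of_real c"
        using herm[of n j] ij by (simp add: w'_def)
      have "(\<Sum>r<n. w' r i * cnj (w' r j)) = (if i < n \<and> j < n then h i j else 0)"
        using w by (auto simp: w'_def)
      moreover have "g i j = g i n * g n j / complex_of_real c" if "\<not> (i < n \<and> j < n)"
      proof -
        have "i = n \<or> j = n" using that ij by linarith
        then show ?thesis using gnn cpos by auto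
      qed
      ultimately show ?thesis using last by (auto simp: h_def)
    qed
    then show ?thesis by blast
  qed
qed simp

text \<open>A mixed state as a mixture of unnormalised pure states; trace one says that their
  squared lengths are the weights of a probability distribution.\<close>

lemma density_op_decomp:
  assumes "density_op a \<psi>"
  obtains w :: "nat \<Rightarrow> nat \<Rightarrow> complex" where "\<And>y y'. y < 2 ^ a \<Longrightarrow> y' < 2 ^ a \<Longrightarrow> \<psi> $$ (y, y') = (\<Sum>r<2 ^ a. w r y * cnj (w r y'))"
    "(\<Sum>r<2 ^ a. (l2 (2 ^ a) (w r))\<^sup>2) = 1"
proof -
  let ?n = "2 ^ a :: nat"
  have c: "\<psi> \<in> carrier_mat ?n ?n" and adj: "adj \<psi> = \<psi>" and tr: "tr \<psi> = 1"
    and pos: "\<And>v. v \<in> carrier_vec ?n \<Longrightarrow> 0 \<le> Re (v \<bullet>c (\<psi> *\<^sub>v v))"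
    using assms by (auto simp: density_op_def is_op_def)
  have herm: "\<psi> $$ (i, j) = cnj (\<psi> $$ (j, i))" if "i < ?n" "j < ?n" for i j
    using index_adj[OF c that] adj by simp
  have "\<exists>w. \<forall>i<?n. \<forall>j<?n. \<psi> $$ (i, j) = (\<Sum>r<?n. w r i * cnj (w r j))"
  proof (rule psd_sum_of_rank_one)
    show "\<psi> $$ (i, j) = cnj (\<psi> $$ (j, i))" if "i < ?n" "j < ?n" for i j using herm that .
    fix u :: "nat \<Rightarrow> complex"
    let ?v = "Matrix.vec ?n u"
    have v: "?v \<in> carrier_vec ?n" by simp
    have pv: "\<psi> *\<^sub>v ?v \<in> carrier_vec ?n" using c by simp
    \<comment> \<open>The scalar product conjugates its second argument, so it yields the conjugate
      of the quadratic form; the real part is the same.\<close>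
    have "?v \<bullet>c (\<psi> *\<^sub>v ?v) = (\<Sum>i<?n. u i * cnj ((\<psi> *\<^sub>v ?v) $ i))"
      using carrier_vecD[OF pv] by (simp add: scalar_prod_def atLeast0LessThan del: index_mult_mat_vec dim_mult_mat_vec)
    also have "\<dots> = cnj (\<Sum>i<?n. \<Sum>j<?n. cnj (u i) * \<psi> $$ (i, j) * u j)"
      unfolding cnj_sum using c
      by (intro sum.cong refl) (simp add: index_mult_mat_vec_sum[OF c v] sum_distrib_left mult.assoc del: index_mult_mat_vec)
    finally show "0 \<le> Re (\<Sum>i<?n. \<Sum>j<?n. cnj (u i) * \<psi> $$ (i, j) * u j)" using pos[OF v] by (simp only: cnj.sel)
  qed
  then obtain w where w: "\<And>i j. i < ?n \<Longrightarrow> j < ?n \<Longrightarrow> \<psi> $$ (i, j) = (\<Sum>r<?n. w r i * cnj (w r j))" by blast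
  have "complex_of_real (\<Sum>r<?n. (l2 ?n (w r))\<^sup>2) = (\<Sum>r<?n. \<Sum>y<?n. cnj (w r y) * w r y)"
    by (simp add: sum_mult_cnj_eq_l2)
  also have "\<dots> = (\<Sum>y<?n. \<Sum>r<?n. cnj (w r y) * w r y)" by (rule sum.swap)
  also have "\<dots> = tr \<psi>" using c w by (simp add: tr_def mult.commute)
  finally have w1: "(\<Sum>r<?n. (l2 ?n (w r))\<^sup>2) = 1" unfolding tr using of_real_eq_1_iff by blast
  show ?thesis by (rule that[of w]) (fact w, fact w1)
qed

text \<open>The transpose of the partial trace over the last \<open>a\<close> qubits of \<open>(I \<otimes> \<psi>) X\<close>.\<close>
definition slice_op :: "nat \<Rightarrow> nat \<Rightarrow> complex mat \<Rightarrow> complex mat \<Rightarrow> complex mat" where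
  "slice_op m a \<psi> X = mat (2 ^ m) (2 ^ m)
     (\<lambda>(i, j). \<Sum>y<2 ^ a. \<Sum>y'<2 ^ a. \<psi> $$ (y, y') * X $$ (j + 2 ^ m * y', i + 2 ^ m * y))"

lemma slice_op_carrier [simp]: "slice_op m a \<psi> X \<in> carrier_mat (2 ^ m) (2 ^ m)"
  by (simp add: slice_op_def)

lemma slice_op_linear:
  assumes "X \<in> carrier_mat (2 ^ (m + a)) (2 ^ (m + a))" "Y \<in> carrier_mat (2 ^ (m + a)) (2 ^ (m + a))"
  shows "slice_op m a \<psi> (X + Y) = slice_op m a \<psi> X + slice_op m a \<psi> Y"
    and "slice_op m a \<psi> (X - Y) = slice_op m a \<psi> X - slice_op m a \<psi> Y"
    and "slice_op m a \<psi> (c \<cdot>\<^sub>m X) = c \<cdot>\<^sub>m slice_op m a \<psi> X"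
  by (rule eq_matI; use assms in \<open>simp add: slice_op_def add_mult_less_power sum.distrib sum_subtractf
      sum_distrib_left distrib_left right_diff_distrib mult.left_commute\<close>)+

lemma slice_op_single_layer:
  assumes "\<And>i. i < m + a \<Longrightarrow> v i \<in> carrier_mat 2 2"
  shows "slice_op m a \<psi> (single_layer (m + a) v)
    = (\<Sum>y<2 ^ a. \<Sum>y'<2 ^ a. \<psi> $$ (y, y') * (\<Prod>t<a. v (m + t) $$ (qbit y' t, qbit y t)))
        \<cdot>\<^sub>m single_layer m (\<lambda>t. transpose_mat (v t))"
proof (rule eq_matI)
  let ?c = "\<Sum>y<2 ^ a. \<Sum>y'<2 ^ a. \<psi> $$ (y, y') * (\<Prod>t<a. v (m + t) $$ (qbit y' t, qbit y t))"
  fix i j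
  assume "i < dim_row (?c \<cdot>\<^sub>m single_layer m (\<lambda>t. transpose_mat (v t)))"
    "j < dim_col (?c \<cdot>\<^sub>m single_layer m (\<lambda>t. transpose_mat (v t)))"
  then have ij: "i < 2 ^ m" "j < 2 ^ m" by (simp_all add: single_layer_def)
  have T: "transpose_mat (v t) $$ (qbit i t, qbit j t) = v t $$ (qbit j t, qbit i t)" if "t < m" for t
    using assms[of t] that by auto
  have "single_layer (m + a) v $$ (j + 2 ^ m * y', i + 2 ^ m * y)
      = (\<Prod>t<m. transpose_mat (v t) $$ (qbit i t, qbit j t)) * (\<Prod>t<a. v (m + t) $$ (qbit y' t, qbit y t))"
    if "y < 2 ^ a" "y' < 2 ^ a" for y y'
    using ij that by (simp add: index_single_layer add_mult_less_power prod_lessThan_add qbit_low qbit_high T)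
  then have "slice_op m a \<psi> (single_layer (m + a) v) $$ (i, j) = (\<Sum>y<2 ^ a. \<Sum>y'<2 ^ a.
      \<psi> $$ (y, y') * ((\<Prod>t<m. transpose_mat (v t) $$ (qbit i t, qbit j t)) * (\<Prod>t<a. v (m + t) $$ (qbit y' t, qbit y t))))"
    using ij by (simp add: slice_op_def)
  also have "\<dots> = ?c * (\<Prod>t<m. transpose_mat (v t) $$ (qbit i t, qbit j t))"
    unfolding sum_distrib_right by (intro sum.cong refl) (simp add: mult_ac)
  finally show "slice_op m a \<psi> (single_layer (m + a) v) $$ (i, j)
      = (?c \<cdot>\<^sub>m single_layer m (\<lambda>t. transpose_mat (v t))) $$ (i, j)"
    using ij by (simp add: index_single_layer single_layer_def)
qed (simp_all add: slice_op_def single_layer_def)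

text \<open>On a product operator the ancilla factors contract with \<open>\<psi>\<close> to a
  scalar, and the remaining factors are transposed. Transposition fixes the identity, so the support
  can only shrink.\<close>

lemma low_degree_slice_op:
  assumes "low_degree (m + a) l X"
  shows "low_degree m l (slice_op m a \<psi> X)"
  using assms
proof (induction rule: spanned.induct)
  case (spanned_product v)
  have "factor_support m (\<lambda>t. transpose_mat (v t)) \<subseteq> factor_support (m + a) v"
    by (auto simp: factor_support_def)
  then have "card (factor_support m (\<lambda>t. transpose_mat (v t))) \<le> card (factor_support (m + a) v)"
    by (intro card_mono) (auto intro: finite_subset[OF factor_support_subset])
  then have "real (card (factor_support m (\<lambda>t. transpose_mat (v t)))) \<le> l" using spanned_product(2) by linarith
  then have "low_degree m l (single_layer m (\<lambda>t. transpose_mat (v t)))"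
    by (intro spanned.spanned_product) (use spanned_product(1) in auto)
  moreover have "slice_op m a \<psi> (single_layer (m + a) v)
    = (\<Sum>y<2 ^ a. \<Sum>y'<2 ^ a. \<psi> $$ (y, y') * (\<Prod>t<a. v (m + t) $$ (qbit y' t, qbit y t)))
        \<cdot>\<^sub>m single_layer m (\<lambda>t. transpose_mat (v t))"
    by (rule slice_op_single_layer) (rule spanned_product(1))
  ultimately show ?case by (simp only: spanned.spanned_smult)
next
  case (spanned_smult X c)
  note X = spanned_carrier[OF spanned_smult(1)]
  show ?case unfolding slice_op_linear(3)[OF X X] by (rule spanned.spanned_smult[OF spanned_smult(2)])
next
  case (spanned_add X Y)
  note X = spanned_carrier[OF spanned_add(1)] and Y = spanned_carrier[OF spanned_add(2)]
  show ?case unfolding slice_op_linear(1)[OF X Y] by (rule spanned.spanned_add[OF spanned_add(3,4)])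
qed

lemma l2_tensor: "l2 (2 ^ (m + a)) (\<lambda>I. u (I mod 2 ^ m) * w (I div 2 ^ m)) = l2 (2 ^ m) u * l2 (2 ^ a) w"
proof -
  have "(\<Sum>I<2 ^ (m + a). (cmod (u (I mod 2 ^ m) * w (I div 2 ^ m)))\<^sup>2)
      = (\<Sum>y<2 ^ a. \<Sum>i<2 ^ m. (cmod (u i))\<^sup>2 * (cmod (w y))\<^sup>2)"
    unfolding sum_power_split by (intro sum.cong refl) (simp add: norm_mult power_mult_distrib)
  also have "\<dots> = (\<Sum>i<2 ^ m. (cmod (u i))\<^sup>2) * (\<Sum>y<2 ^ a. (cmod (w y))\<^sup>2)"
    by (simp add: sum_distrib_left sum_distrib_right)
  finally show ?thesis by (simp add: L2_set_def real_sqrt_mult)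
qed

text \<open>By the decomposition of \<open>\<psi>\<close>, the bilinear form of the contraction at
  u, v is a sum over r of the form of X at vectors extended by w_r or its conjugate. Each term is at
  most c |u| |v| |w_r|^2, and the weights |w_r|^2 add up to one.\<close>

lemma op_bounded_slice_op:
  assumes \<psi>: "density_op a \<psi>" and X: "X \<in> carrier_mat (2 ^ (m + a)) (2 ^ (m + a))" "op_bounded X c" "0 \<le> c"
  shows "op_bounded (slice_op m a \<psi> X) c"
proof (rule op_boundedI[OF slice_op_carrier X(3)])
  fix u v
  obtain w :: "nat \<Rightarrow> nat \<Rightarrow> complex" where w: "\<And>y y'. y < 2 ^ a \<Longrightarrow> y' < 2 ^ a \<Longrightarrow> \<psi> $$ (y, y') = (\<Sum>r<2 ^ a. w r y * cnj (w r y'))"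
    and w1: "(\<Sum>r<2 ^ a. (l2 (2 ^ a) (w r))\<^sup>2) = 1"
    by (rule density_op_decomp[OF \<psi>]) blast
  \<comment> \<open>Because of the transposition, v goes to the row side of X with the conjugated
    ancilla vector and u to the column side.\<close>
  define U where "U r I = u (I mod 2 ^ m) * w r (I div 2 ^ m)" for r I
  define V where "V r I = v (I mod 2 ^ m) * cnj (w r (I div 2 ^ m))" for r I
  define F where "F r = (\<Sum>J<2 ^ (m + a). \<Sum>I<2 ^ (m + a). V r J * X $$ (J, I) * U r I)" for r
  define t where "t r i j y y' = u i * (w r y * cnj (w r y') * X $$ (j + 2 ^ m * y', i + 2 ^ m * y)) * v j" for r i j y y'
  have F: "F r = (\<Sum>i<2 ^ m. \<Sum>j<2 ^ m. \<Sum>y<2 ^ a. \<Sum>y'<2 ^ a. t r i j y y')" for r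
  proof -
    have "F r = (\<Sum>y'<2 ^ a. \<Sum>j<2 ^ m. \<Sum>y<2 ^ a. \<Sum>i<2 ^ m. t r i j y y')"
      unfolding F_def sum_power_split
      by (intro sum.cong refl) (simp add: U_def V_def t_def mult_ac)
    also have "\<dots> = (\<Sum>j<2 ^ m. \<Sum>y'<2 ^ a. \<Sum>y<2 ^ a. \<Sum>i<2 ^ m. t r i j y y')" by (rule sum.swap)
    also have "\<dots> = (\<Sum>j<2 ^ m. \<Sum>y'<2 ^ a. \<Sum>i<2 ^ m. \<Sum>y<2 ^ a. t r i j y y')"
      by (intro sum.cong refl sum.swap)
    also have "\<dots> = (\<Sum>j<2 ^ m. \<Sum>i<2 ^ m. \<Sum>y'<2 ^ a. \<Sum>y<2 ^ a. t r i j y y')"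
      by (intro sum.cong refl sum.swap)
    also have "\<dots> = (\<Sum>i<2 ^ m. \<Sum>j<2 ^ m. \<Sum>y'<2 ^ a. \<Sum>y<2 ^ a. t r i j y y')" by (rule sum.swap)
    also have "\<dots> = (\<Sum>i<2 ^ m. \<Sum>j<2 ^ m. \<Sum>y<2 ^ a. \<Sum>y'<2 ^ a. t r i j y y')"
      by (intro sum.cong refl sum.swap)
    finally show ?thesis .
  qed
  have S: "u i * slice_op m a \<psi> X $$ (i, j) * v j = (\<Sum>r<2 ^ a. \<Sum>y<2 ^ a. \<Sum>y'<2 ^ a. t r i j y y')"
    if "i < 2 ^ m" "j < 2 ^ m" for i j
  proof -
    have "u i * slice_op m a \<psi> X $$ (i, j) * v j = (\<Sum>y<2 ^ a. \<Sum>y'<2 ^ a. \<Sum>r<2 ^ a. t r i j y y')"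
      using that by (simp add: slice_op_def sum_distrib_left sum_distrib_right w t_def)
    also have "\<dots> = (\<Sum>y<2 ^ a. \<Sum>r<2 ^ a. \<Sum>y'<2 ^ a. t r i j y y')" by (intro sum.cong refl sum.swap)
    also have "\<dots> = (\<Sum>r<2 ^ a. \<Sum>y<2 ^ a. \<Sum>y'<2 ^ a. t r i j y y')" by (rule sum.swap)
    finally show ?thesis .
  qed
  have "(\<Sum>i<2 ^ m. \<Sum>j<2 ^ m. u i * slice_op m a \<psi> X $$ (i, j) * v j)
      = (\<Sum>i<2 ^ m. \<Sum>j<2 ^ m. \<Sum>r<2 ^ a. \<Sum>y<2 ^ a. \<Sum>y'<2 ^ a. t r i j y y')"
    by (intro sum.cong refl S) auto
  also have "\<dots> = (\<Sum>i<2 ^ m. \<Sum>r<2 ^ a. \<Sum>j<2 ^ m. \<Sum>y<2 ^ a. \<Sum>y'<2 ^ a. t r i j y y')"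
    by (intro sum.cong refl sum.swap)
  also have "\<dots> = (\<Sum>r<2 ^ a. F r)" unfolding F by (rule sum.swap)
  also have "cmod \<dots> \<le> (\<Sum>r<2 ^ a. c * l2 (2 ^ m) u * l2 (2 ^ m) v * (l2 (2 ^ a) (w r))\<^sup>2)"
  proof (rule order_trans[OF norm_sum sum_mono])
    fix r
    have "cmod (F r) \<le> c * l2 (2 ^ (m + a)) (V r) * l2 (2 ^ (m + a)) (U r)"
      unfolding F_def by (rule op_boundedD[OF X(2,1)])
    also have "l2 (2 ^ (m + a)) (V r) = l2 (2 ^ m) v * l2 (2 ^ a) (w r)"
      unfolding V_def using l2_tensor[where u=v and w="\<lambda>y. cnj (w r y)"] by simp
    also have "l2 (2 ^ (m + a)) (U r) = l2 (2 ^ m) u * l2 (2 ^ a) (w r)"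
      unfolding U_def by (rule l2_tensor)
    finally show "cmod (F r) \<le> c * l2 (2 ^ m) u * l2 (2 ^ m) v * (l2 (2 ^ a) (w r))\<^sup>2"
      by (simp add: power2_eq_square mult_ac)
  qed
  also have "\<dots> = c * l2 (2 ^ m) u * l2 (2 ^ m) v" unfolding sum_distrib_left[symmetric] w1 by simp
  finally show "cmod (\<Sum>i<2 ^ m. \<Sum>j<2 ^ m. u i * slice_op m a \<psi> X $$ (i, j) * v j)
      \<le> c * l2 (2 ^ m) u * l2 (2 ^ m) v" .
qed

section \<open>The EPR projector\<close>

definition hadamard :: "complex mat" where
  "hadamard = mat 2 2 (\<lambda>(a, b). if a = 1 \<and> b = 1 then - complex_of_real (1 / sqrt 2) else complex_of_real (1 / sqrt 2))"

lemma hadamard_carrier [simp]: "hadamard \<in> carrier_mat 2 2"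
  by (simp add: hadamard_def)

lemma index_hadamard:
  "a < 2 \<Longrightarrow> b < 2 \<Longrightarrow> hadamard $$ (a, b)
    = (if a = 1 \<and> b = 1 then - complex_of_real (1 / sqrt 2) else complex_of_real (1 / sqrt 2))"
  by (simp add: hadamard_def)

lemma inverse_sqrt_2_square: "complex_of_real (1 / sqrt 2) * complex_of_real (1 / sqrt 2) = 1 / 2"
proof -
  have "1 / sqrt 2 * (1 / sqrt 2) = (1 / 2 :: real)" by simp
  then show ?thesis by (metis of_real_1 of_real_divide of_real_mult of_real_numeral)
qed

lemma unitary2_hadamard: "unitary2 hadamard"
  unfolding unitary2_def
proof (intro conjI eq_matI)
  fix i j assume "i < dim_row (1\<^sub>m 2 :: complex mat)" "j < dim_col (1\<^sub>m 2 :: complex mat)"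
  then have ij: "i < 2" "j < 2" by simp_all
  have "(hadamard * adj hadamard) $$ (i, j) = hadamard $$ (i, 0) * cnj (hadamard $$ (j, 0)) + hadamard $$ (i, 1) * cnj (hadamard $$ (j, 1))"
    using index_mult_mat_sum[OF hadamard_carrier adj_carrier[OF hadamard_carrier] ij] ij
    by (simp add: sum_lessThan_2 index_adj[OF hadamard_carrier])
  also have "\<dots> = 1\<^sub>m 2 $$ (i, j)"
    using ij inverse_sqrt_2_square by (auto simp: index_hadamard less_2_cases_iff)
  finally show "(hadamard * adj hadamard) $$ (i, j) = 1\<^sub>m 2 $$ (i, j)" .
qed (simp_all add: hadamard_def adj_def)

definition paired :: "nat \<Rightarrow> nat \<Rightarrow> bool" where
  "paired k x \<longleftrightarrow> x mod 2 ^ k = x div 2 ^ k mod 2 ^ k"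

lemma paired_iff: "paired k x \<longleftrightarrow> (\<forall>i<k. qbit x i = qbit x (k + i))"
proof
  assume "paired k x"
  then show "\<forall>i<k. qbit x i = qbit x (k + i)"
    unfolding paired_def by (metis qbit_mod qbit_div)
next
  assume *: "\<forall>i<k. qbit x i = qbit x (k + i)"
  show "paired k x"
    unfolding paired_def
  proof (rule qbit_eqI)
    fix i assume "i < k"
    then show "qbit (x mod 2 ^ k) i = qbit (x div 2 ^ k mod 2 ^ k) i"
      using * by (simp add: qbit_mod qbit_div)
  qed simp_all
qed

text \<open>The normalised projector \<open>2\<^bsup>-k\<^esup> EPR\<^bsub>k\<^esub>\<close> on the qubit pairs \<open>(i, k + i)\<close>, tensored with the identity on
  \<open>m\<close> further qubits. It is the product of its \<open>X\<close>- and \<open>Z\<close>-type stabiliser projectors; these are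
  Hadamard conjugates of each other, and the latter is the conjunction of the \<open>k\<close> tests
  \<open>x\<^bsub>i\<^esub> = x\<^bsub>k+i\<^esub>\<close>.\<close>
definition epr_op :: "nat \<Rightarrow> nat \<Rightarrow> complex mat" where
  "epr_op k m = mat (2 ^ (k + (k + m))) (2 ^ (k + (k + m)))
     (\<lambda>(x, y). if paired k x \<and> paired k y \<and> x div 2 ^ k div 2 ^ k = y div 2 ^ k div 2 ^ k then 1 / 2 ^ k else 0)"

definition pair_op :: "nat \<Rightarrow> nat \<Rightarrow> complex mat" where
  "pair_op k m = diag_op (k + (k + m)) (\<lambda>x. if paired k x then 1 else 0)"

definition hadamard_layer :: "nat \<Rightarrow> nat \<Rightarrow> complex mat" where
  "hadamard_layer k m = single_layer (k + (k + m)) (\<lambda>i. if i < k + k then hadamard else 1\<^sub>m 2)"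

lemma is_single_layer_hadamard_layer: "is_single_layer (k + (k + m)) (hadamard_layer k m)"
  unfolding is_single_layer_def hadamard_layer_def
  by (intro exI[of _ "\<lambda>i. if i < k + k then hadamard else 1\<^sub>m 2"])
    (simp add: unitary2_hadamard unitary2_one)

lemma hadamard_layer_carrier [simp]: "hadamard_layer k m \<in> carrier_mat (2 ^ (k + (k + m))) (2 ^ (k + (k + m)))"
  by (simp add: hadamard_layer_def)

text \<open>Only rows whose first two k-bit blocks coincide are computed, as the pair projector
  removes all others.\<close>

lemma index_hadamard_layer:
  assumes "p < 2 ^ k" "r < 2 ^ m" "x < 2 ^ (k + (k + m))"
  shows "hadamard_layer k m $$ (p + 2 ^ k * (p + 2 ^ k * r), x)
    = (\<Prod>i<k. hadamard $$ (qbit p i, qbit x i) * hadamard $$ (qbit p i, qbit x (k + i)))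
      * (if r = x div 2 ^ k div 2 ^ k then 1 else 0)"
proof -
  let ?v = "\<lambda>i. if i < k + k then hadamard else 1\<^sub>m 2"
  let ?l = "p + 2 ^ k * (p + 2 ^ k * r)"
  have l: "?l < 2 ^ (k + (k + m))" using assms by (intro add_mult_less_power)
  have x2: "x div 2 ^ k div 2 ^ k < 2 ^ m" using assms(3) by (intro div_less_power)
  have "(\<Prod>i<m. 1\<^sub>m 2 $$ (qbit r i, qbit x (k + (k + i))))
      = single_layer m (\<lambda>_. 1\<^sub>m 2) $$ (r, x div 2 ^ k div 2 ^ k)"
    using assms x2 by (simp add: index_single_layer qbit_div)
  also have "\<dots> = (if r = x div 2 ^ k div 2 ^ k then 1 else 0)" using assms x2 by (simp add: single_layer_one)
  finally have rest: "(\<Prod>i<m. 1\<^sub>m 2 $$ (qbit r i, qbit x (k + (k + i)))) = (if r = x div 2 ^ k div 2 ^ k then 1 else 0 :: complex)" .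
  have b1: "qbit ?l i = qbit p i" if "i < k" for i using that by (rule qbit_low)
  have b2: "qbit ?l (k + i) = qbit p i" if "i < k" for i
    using qbit_high[OF assms(1)] qbit_low[OF that] by simp
  have b3: "qbit ?l (k + (k + i)) = qbit r i" for i
    using qbit_high[OF assms(1)] by simp
  have "hadamard_layer k m $$ (?l, x) = (\<Prod>i<k + (k + m). ?v i $$ (qbit ?l i, qbit x i))"
    using l assms(3) unfolding hadamard_layer_def by (rule index_single_layer)
  also have "\<dots> = (\<Prod>i<k. ?v i $$ (qbit ?l i, qbit x i)) * ((\<Prod>i<k. ?v (k + i) $$ (qbit ?l (k + i), qbit x (k + i)))
      * (\<Prod>i<m. ?v (k + (k + i)) $$ (qbit ?l (k + (k + i)), qbit x (k + (k + i)))))"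
    by (simp only: prod_lessThan_add)
  also have "(\<Prod>i<k. ?v i $$ (qbit ?l i, qbit x i)) = (\<Prod>i<k. hadamard $$ (qbit p i, qbit x i))"
    by (intro prod.cong refl) (simp add: b1)
  also have "(\<Prod>i<k. ?v (k + i) $$ (qbit ?l (k + i), qbit x (k + i))) = (\<Prod>i<k. hadamard $$ (qbit p i, qbit x (k + i)))"
    by (intro prod.cong refl) (simp add: b2)
  also have "(\<Prod>i<m. ?v (k + (k + i)) $$ (qbit ?l (k + (k + i)), qbit x (k + (k + i))))
      = (\<Prod>i<m. 1\<^sub>m 2 $$ (qbit r i, qbit x (k + (k + i))))"
    by (intro prod.cong refl) (simp add: b3)
  finally show ?thesis unfolding rest by (simp add: prod.distrib)
qed

lemma sum_paired:
  fixes F :: "nat \<Rightarrow> complex"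
  shows "(\<Sum>l<2 ^ (k + (k + m)). if paired k l then F l else 0) = (\<Sum>r<2 ^ m. \<Sum>p<2 ^ k. F (p + 2 ^ k * (p + 2 ^ k * r)))"
proof -
  have "(\<Sum>l<2 ^ (k + (k + m)). if paired k l then F l else 0)
      = (\<Sum>r<2 ^ m. \<Sum>q<2 ^ k. \<Sum>p<2 ^ k. if p = q then F (p + 2 ^ k * (p + 2 ^ k * r)) else 0)"
    unfolding sum_power_split by (intro sum.cong refl) (auto simp: paired_def)
  then show ?thesis by simp
qed

text \<open>The contribution of one qubit pair whose column bits agree: the squared entry is 1/2
  throughout, and what remains is orthonormality of the Hadamard columns.\<close>

lemma hadamard_sum:
  assumes "a < 2" "a' < 2" "b < 2"
  shows "(\<Sum>c<2. cnj (hadamard $$ (c, a) * hadamard $$ (c, a')) * (hadamard $$ (c, b) * hadamard $$ (c, b)))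
    = (if a = a' then 1 / 2 else 0)"
proof -
  have s: "complex_of_real (sqrt 2) * complex_of_real (sqrt 2) = 2"
    by (simp flip: of_real_mult)
  have "complex_of_real (sqrt 2) * (complex_of_real (sqrt 2) * z) = 2 * z" for z
    by (simp only: mult.assoc[symmetric] s)
  then show ?thesis
    using assms s by (auto simp: sum_lessThan_2 index_hadamard less_2_cases_iff)
qed

text \<open>The pair projector on the right restricts to paired columns, where the entry factors
  over the pairs. Each pair gives 1/2 if the two row bits agree and 0 otherwise, which produces both
  the row condition and the normalisation of the EPR projector.\<close>

lemma epr_op_factor:
  "adj (hadamard_layer k m) * pair_op k m * hadamard_layer k m * pair_op k m = epr_op k m"
proof (rule eq_matI)
  let ?H = "hadamard_layer k m" and ?P = "pair_op k m" and ?N = "k + (k + m)"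
  fix x y assume "x < dim_row (epr_op k m)" "y < dim_col (epr_op k m)"
  then have xy: "x < 2 ^ ?N" "y < 2 ^ ?N" by (simp_all add: epr_op_def)
  have Hc: "?H \<in> carrier_mat (2 ^ ?N) (2 ^ ?N)" "adj ?H \<in> carrier_mat (2 ^ ?N) (2 ^ ?N)" by simp_all
  have Pc: "?P \<in> carrier_mat (2 ^ ?N) (2 ^ ?N)" by (simp add: pair_op_def)
  let ?x = "x div 2 ^ k div 2 ^ k" and ?y = "y div 2 ^ k div 2 ^ k"
  have x2: "?x < 2 ^ m" using xy(1) by (intro div_less_power)
  have "(adj ?H * ?P * ?H) $$ (x, y) = (adj ?H * (?P * ?H)) $$ (x, y)"
    using assoc_mult_mat[OF Hc(2) Pc Hc(1)] by simp
  also have "\<dots> = (\<Sum>l<2 ^ ?N. adj ?H $$ (x, l) * (?P * ?H) $$ (l, y))"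
    using Hc Pc xy by (intro index_mult_mat_sum) auto
  also have "\<dots> = (\<Sum>l<2 ^ ?N. if paired k l then cnj (?H $$ (l, x)) * ?H $$ (l, y) else 0)"
    using xy by (intro sum.cong refl)
      (simp add: pair_op_def index_diag_op_mult[OF Hc(1)] index_adj[OF Hc(1)] del: index_mult_mat(1))
  also have "\<dots> = (\<Sum>r<2 ^ m. \<Sum>p<2 ^ k. cnj (?H $$ (p + 2 ^ k * (p + 2 ^ k * r), x)) * ?H $$ (p + 2 ^ k * (p + 2 ^ k * r), y))"
    by (rule sum_paired)
  also have "\<dots> = (\<Sum>r<2 ^ m. if r = ?x then (if ?x = ?y then
      (\<Sum>p<2 ^ k. \<Prod>i<k. cnj (hadamard $$ (qbit p i, qbit x i) * hadamard $$ (qbit p i, qbit x (k + i)))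
        * (hadamard $$ (qbit p i, qbit y i) * hadamard $$ (qbit p i, qbit y (k + i)))) else 0) else 0)"
    using xy by (intro sum.cong refl) (auto simp: index_hadamard_layer prod.distrib)
  also have "\<dots> = (if ?x = ?y then (\<Sum>p<2 ^ k. \<Prod>i<k.
      cnj (hadamard $$ (qbit p i, qbit x i) * hadamard $$ (qbit p i, qbit x (k + i)))
        * (hadamard $$ (qbit p i, qbit y i) * hadamard $$ (qbit p i, qbit y (k + i)))) else 0)"
    using x2 by simp
  finally have entry: "(adj ?H * ?P * ?H) $$ (x, y) = \<dots>" .
  have "(adj ?H * ?P * ?H * ?P) $$ (x, y) = (adj ?H * ?P * ?H) $$ (x, y) * (if paired k y then 1 else 0)"
    unfolding pair_op_def by (rule index_mult_diag_op) (use xy Hc in auto)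
  also have "\<dots> = epr_op k m $$ (x, y)"
  proof (cases "paired k y \<and> ?x = ?y")
    case True
    define f where "f i c = cnj (hadamard $$ (c, qbit x i) * hadamard $$ (c, qbit x (k + i)))
        * (hadamard $$ (c, qbit y i) * hadamard $$ (c, qbit y (k + i)))" for i c
    have f: "f i 0 + f i 1 = (if qbit x i = qbit x (k + i) then 1 / 2 else 0)" if "i < k" for i
    proof -
      have "qbit y (k + i) = qbit y i" using True that by (simp add: paired_iff)
      then show ?thesis using hadamard_sum[of "qbit x i" "qbit x (k + i)" "qbit y i"]
        by (simp add: f_def sum_lessThan_2)
    qed
    have "(adj ?H * ?P * ?H) $$ (x, y) = (\<Sum>p<2 ^ k. \<Prod>i<k. f i (qbit p i))"
      unfolding entry using True by (simp add: f_def)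
    also have "\<dots> = (\<Prod>i<k. f i 0 + f i 1)" by (rule sum_prod_qbit)
    also have "\<dots> = (\<Prod>i<k. if qbit x i = qbit x (k + i) then 1 / 2 else 0)" by (intro prod.cong refl f) simp
    also have "\<dots> = (if paired k x then 1 / 2 ^ k else 0)"
    proof (cases "paired k x")
      case True
      then have "(\<Prod>i<k. if qbit x i = qbit x (k + i) then 1 / 2 else 0) = (\<Prod>i<k. 1 / 2 :: complex)"
        by (intro prod.cong refl) (simp add: paired_iff)
      then show ?thesis using True by (simp add: power_one_over)
    next
      case False
      then obtain i where "i < k" "qbit x i \<noteq> qbit x (k + i)" by (auto simp: paired_iff)
      then have "(\<Prod>i<k. if qbit x i = qbit x (k + i) then 1 / 2 else 0) = (0 :: complex)"
        by (intro prod_zero) auto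
      then show ?thesis using False by simp
    qed
    finally show ?thesis using True xy by (simp add: epr_op_def)
  next
    case False
    then show ?thesis using xy unfolding entry by (auto simp: epr_op_def)
  qed
  finally show "(adj ?H * ?P * ?H * ?P) $$ (x, y) = epr_op k m $$ (x, y)" .
qed (simp_all add: epr_op_def pair_op_def hadamard_layer_def single_layer_def adj_def)

lemma epr_op_carrier [simp]: "epr_op k m \<in> carrier_mat (2 ^ (k + (k + m))) (2 ^ (k + (k + m)))"
  by (simp add: epr_op_def)

text \<open>\<open>and_poly\<close> is applied to the number of passed tests. A test has degree 2
  and the polynomial degree 2 D, so 4 D <= 12 sqrt k r after rounding.\<close>

lemma approx_pair_op:
  assumes k: "1 \<le> k" and r: "1 \<le> r"
  obtains f where "low_degree (k + (k + m)) (12 * (sqrt k * r)) (diag_op (k + (k + m)) f)"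
    "op_bounded (diag_op (k + (k + m)) f) 1"
    "op_bounded (pair_op k m - diag_op (k + (k + m)) f) (4 * exp (- 2 * r))"
proof -
  let ?N = "k + (k + m)"
  define D where "D = nat \<lceil>2 * sqrt k * r\<rceil>"
  define e where "e i x = (if qbit x i = qbit x (k + i) then 1 else 0 :: nat)" for i x
  define q where "q x = and_poly D k (real (\<Sum>i<k. e i x))" for x
  have sk: "1 * 1 \<le> sqrt k * r" using k r by (intro mult_mono) auto
  have D: "2 * sqrt k * r \<le> D" unfolding D_def by linarith
  have "0 \<le> 2 * sqrt k * r" using r by simp
  then have "real D \<le> 2 * sqrt k * r + 1" unfolding D_def by linarith
  moreover have "2 * sqrt k * r = 2 * (sqrt k * r)" by simp
  ultimately have D': "4 * real D \<le> 12 * (sqrt k * r)" using sk by linarith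
  have "low_degree ?N 2 (diag_op ?N (\<lambda>x. of_nat (e i x)))" if "i < k" for i
  proof -
    have 1: "low_degree ?N 2 (diag_op ?N (\<lambda>x. (- 1) * of_nat (qbit x j)))" if "j < ?N" for j
      by (intro low_degree_diag_cmult low_degree_mono[OF low_degree_diag_qbit[OF that]]) simp
    have 2: "low_degree ?N 2 (diag_op ?N (\<lambda>x. 2 * (of_nat (qbit x i) * of_nat (qbit x (k + i)))))"
      using low_degree_diag_mult[OF low_degree_diag_qbit low_degree_diag_qbit, of i ?N "k + i"] that
      by (intro low_degree_diag_cmult) simp
    have "low_degree ?N 2 (diag_op ?N (\<lambda>x. 1 + (((- 1) * of_nat (qbit x i) + (- 1) * of_nat (qbit x (k + i)))
        + 2 * (of_nat (qbit x i) * of_nat (qbit x (k + i))))))"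
      by (intro low_degree_diag_add low_degree_diag_const 1 2) (use that in auto)
    \<comment> \<open>Equality of two bits b and b' as the polynomial 1 - b - b' + 2 b b'.\<close>
    moreover have "of_nat (e i x) = 1 + (((- 1) * of_nat (qbit x i) + (- 1) * of_nat (qbit x (k + i)))
        + 2 * (of_nat (qbit x i) * of_nat (qbit x (k + i)) :: complex))" for x
      using qbit_cases[of x i] qbit_cases[of x "k + i"] by (auto simp: e_def)
    ultimately show ?thesis by (simp only:)
  qed
  then have "low_degree ?N 2 (diag_op ?N (\<lambda>x. \<Sum>i<k. of_nat (e i x)))"
    by (intro low_degree_diag_sum) auto
  then have "low_degree ?N 2 (diag_op ?N (\<lambda>x. complex_of_real (real (\<Sum>i<k. e i x))))" by simp
  from low_degree_diag_and_poly[OF this, of D k]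
  have "low_degree ?N (4 * real D) (diag_op ?N (\<lambda>x. complex_of_real (q x)))" by (simp add: q_def)
  then have 1: "low_degree ?N (12 * (sqrt k * r)) (diag_op ?N (\<lambda>x. complex_of_real (q x)))"
    using D' by (rule low_degree_mono)
  have q: "(paired k x \<longrightarrow> q x = 1) \<and> (\<not> paired k x \<longrightarrow> 0 \<le> q x \<and> q x \<le> 4 * exp (- 2 * r))" for x
  proof (cases "paired k x")
    case True
    then have "(\<Sum>i<k. e i x) = k" by (simp add: paired_iff e_def)
    then show ?thesis using True and_poly(1)[OF k D] by (simp add: q_def)
  next
    case False
    then obtain i where i: "i < k" "qbit x i \<noteq> qbit x (k + i)" by (auto simp: paired_iff)
    have "(\<Sum>j<k. e j x) = (\<Sum>j\<in>{..<k} - {i}. e j x)" using i by (simp add: sum.remove[of _ i] e_def)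
    also have "\<dots> \<le> (\<Sum>j\<in>{..<k} - {i}. 1)" by (intro sum_mono) (simp add: e_def)
    also have "\<dots> = k - 1" using i by simp
    finally have "real (\<Sum>j<k. e j x) \<le> real k - 1" using k by linarith
    then show ?thesis using False and_poly(2,3)[OF k D] by (simp add: q_def del: of_nat_sum)
  qed
  have d1: "4 * exp (- 2 * r) \<le> 1" by (rule exp_error_le_1[OF r])
  have 2: "op_bounded (diag_op ?N (\<lambda>x. complex_of_real (q x))) 1"
  proof (rule op_bounded_diag_op)
    show "cmod (complex_of_real (q x)) \<le> 1" for x using q[of x] d1 by (cases "paired k x") auto
  qed simp
  have 3: "op_bounded (pair_op k m - diag_op ?N (\<lambda>x. complex_of_real (q x))) (4 * exp (- 2 * r))"
    unfolding pair_op_def diag_op_diff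
  proof (rule op_bounded_diag_op)
    show "cmod ((if paired k x then 1 else 0) - complex_of_real (q x)) \<le> 4 * exp (- 2 * r)" for x
      using q[of x] by (cases "paired k x") auto
  qed simp
  show ?thesis by (rule that[OF 1 2 3])
qed

text \<open>Both stabiliser projectors use the same approximant, once conjugated by Hadamards; 24 =
  2 * 12. The error follows from X P - Y F = (X - Y) P + Y (P - F), where \<open>P\<close>,
  \<open>Y\<close> and \<open>F\<close> are contractions.\<close>

lemma approx_epr_op:
  assumes k: "1 \<le> k" and r: "1 \<le> r"
  obtains B where "low_degree (k + (k + m)) (24 * (sqrt k * r)) B" "op_bounded B 1"
    "op_bounded (epr_op k m - B) (2 * (4 * exp (- 2 * r)))"
proof -
  let ?N = "k + (k + m)" and ?e = "4 * exp (- 2 * r)"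
  define H where "H = hadamard_layer k m"
  define P where "P = pair_op k m"
  obtain f where f: "low_degree ?N (12 * (sqrt k * r)) (diag_op ?N f)" "op_bounded (diag_op ?N f) 1"
      "op_bounded (pair_op k m - diag_op ?N f) ?e"
    by (rule approx_pair_op[OF k r])
  define F where "F = diag_op ?N f"
  have H: "is_single_layer ?N H" unfolding H_def by (rule is_single_layer_hadamard_layer)
  note Hb = op_bounded_single_layer[OF H]
  have c: "H \<in> carrier_mat (2 ^ ?N) (2 ^ ?N)" "adj H \<in> carrier_mat (2 ^ ?N) (2 ^ ?N)"
    "P \<in> carrier_mat (2 ^ ?N) (2 ^ ?N)" "F \<in> carrier_mat (2 ^ ?N) (2 ^ ?N)"
    by (simp_all add: H_def P_def F_def pair_op_def)
  have Pb: "op_bounded P 1" unfolding P_def pair_op_def by (rule op_bounded_diag_op) auto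
  define X where "X = adj H * P * H"
  define Y where "Y = adj H * F * H"
  have XY: "X \<in> carrier_mat (2 ^ ?N) (2 ^ ?N)" "Y \<in> carrier_mat (2 ^ ?N) (2 ^ ?N)"
    unfolding X_def Y_def using c by simp_all
  have Fb: "op_bounded F 1" "op_bounded (P - F) ?e" using f(2,3) by (simp_all add: F_def P_def)
  have "op_bounded Y (1 * 1 * 1)"
    unfolding Y_def by (rule op_bounded_mult3[OF Hb(2) Fb(1) Hb(1) _ _ c(2,4,1)]) simp_all
  then have Yb: "op_bounded Y 1" by simp
  have XYb: "op_bounded (X - Y) ?e"
    unfolding X_def Y_def by (rule op_bounded_conj_diff[OF Fb(2) Hb(2,1) _ c(3,4,2,1)]) simp
  have "low_degree ?N (12 * (sqrt k * r) + 12 * (sqrt k * r)) (Y * F)"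
    unfolding Y_def F_def by (intro low_degree_mult low_degree_conj_single_layer f(1) H)
  then have 1: "low_degree ?N (24 * (sqrt k * r)) (Y * F)" by (elim low_degree_mono) simp
  have 2: "op_bounded (Y * F) 1" using op_bounded_mult[OF Yb Fb(1) XY(2) c(4)] by simp
  have "op_bounded ((X - Y) * P) (?e * 1)"
    by (rule op_bounded_mult[OF XYb Pb minus_carrier_mat[OF XY(2)] c(3)]) simp
  then have a: "op_bounded (X * P - Y * P) ?e"
    by (simp add: minus_mult_distrib_mat[OF XY c(3)])
  have "op_bounded (Y * (P - F)) (1 * ?e)"
    by (rule op_bounded_mult[OF Yb Fb(2) XY(2) minus_carrier_mat[OF c(4)]]) simp
  then have b: "op_bounded (Y * P - Y * F) ?e"
    by (simp add: mult_minus_distrib_mat[OF XY(2) c(3,4)])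
  have "op_bounded (X * P - Y * F) (?e + ?e)"
    by (rule op_bounded_diff_triangle[OF a b, where n="2 ^ ?N"]) (use XY c in simp_all)
  then have 3: "op_bounded (epr_op k m - Y * F) (2 * ?e)"
    unfolding X_def P_def H_def epr_op_factor by simp
  show ?thesis by (rule that[OF 1 2 3])
qed

section \<open>The Choi representation\<close>

lemma sum_mod_eq:
  fixes F :: "nat \<Rightarrow> complex"
  assumes "p < 2 ^ k"
  shows "(\<Sum>b<2 ^ (k + m). if b mod 2 ^ k = p then F b else 0) = (\<Sum>z<2 ^ m. F (p + 2 ^ k * z))"
proof -
  have "(\<Sum>b<2 ^ (k + m). if b mod 2 ^ k = p then F b else 0)
      = (\<Sum>z<2 ^ m. \<Sum>i<2 ^ k. if i = p then F (p + 2 ^ k * z) else 0)"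
    unfolding sum_power_split by (intro sum.cong refl) auto
  then show ?thesis using assms by simp
qed

text \<open>The padded circuit does not touch the idle bits p' and p, and the EPR projector copies
  them to the output bits of U in the row and in the column. The other output bits r are left alike
  on both sides and summed, which is the partial trace.\<close>

lemma index_conj_epr_op:
  assumes U: "U \<in> carrier_mat (2 ^ (k + m)) (2 ^ (k + m))"
    and p: "p < 2 ^ k" "p' < 2 ^ k" and AB: "A < 2 ^ (k + m)" "B < 2 ^ (k + m)"
  shows "(adj (ext_op k (k + m) U) * epr_op k m * ext_op k (k + m) U) $$ (p' + 2 ^ k * B, p + 2 ^ k * A)
    = 1 / 2 ^ k * (\<Sum>r<2 ^ m. cnj (U $$ (p' + 2 ^ k * r, B)) * U $$ (p + 2 ^ k * r, A))"
proof -
  let ?N = "k + (k + m)"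
  define W where "W = ext_op k (k + m) U"
  define E where "E = epr_op k m"
  define x where "x = p' + 2 ^ k * B"
  define y where "y = p + 2 ^ k * A"
  have Wc: "W \<in> carrier_mat (2 ^ ?N) (2 ^ ?N)" and Ec: "E \<in> carrier_mat (2 ^ ?N) (2 ^ ?N)"
    by (simp_all add: W_def E_def)
  have xy: "x < 2 ^ ?N" "y < 2 ^ ?N" unfolding x_def y_def using p AB by (simp_all add: add_mult_less_power)
  have W: "W $$ (c, q + 2 ^ k * C) = (if c mod 2 ^ k = q then U $$ (c div 2 ^ k, C) else 0)"
    if "c < 2 ^ ?N" "q < 2 ^ k" "C < 2 ^ (k + m)" for c q C
    using that by (simp add: W_def ext_op_def add_mult_less_power)
  have left: "(adj W * E) $$ (x, p + 2 ^ k * b) = (if b mod 2 ^ k = p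
      then cnj (U $$ (p' + 2 ^ k * (b div 2 ^ k), B)) * (1 / 2 ^ k) else 0)" if b: "b < 2 ^ (k + m)" for b
  proof -
    let ?c = "p + 2 ^ k * b"
    have c: "?c < 2 ^ ?N" using p b by (simp add: add_mult_less_power)
    have bd: "b div 2 ^ k < 2 ^ m" using b by (rule div_less_power)
    have "(adj W * E) $$ (x, ?c) = (\<Sum>l<2 ^ ?N. adj W $$ (x, l) * E $$ (l, ?c))"
      by (rule index_mult_mat_sum[OF adj_carrier[OF Wc] Ec xy(1) c])
    also have "\<dots> = (\<Sum>l<2 ^ ?N. if l mod 2 ^ k = p' then cnj (U $$ (l div 2 ^ k, B)) * E $$ (l, ?c) else 0)"
      by (intro sum.cong refl) (use xy p AB in \<open>simp add: index_adj[OF Wc] x_def W\<close>)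
    also have "\<dots> = (\<Sum>z<2 ^ (k + m). cnj (U $$ (z, B)) * E $$ (p' + 2 ^ k * z, ?c))"
      using p(2) by (simp add: sum_mod_eq)
    also have "\<dots> = (\<Sum>z<2 ^ (k + m). if z mod 2 ^ k = p' then
        (if z div 2 ^ k = b div 2 ^ k then (if b mod 2 ^ k = p then cnj (U $$ (z, B)) * (1 / 2 ^ k) else 0) else 0) else 0)"
      by (intro sum.cong refl)
        (use p b c in \<open>auto simp: E_def epr_op_def paired_def add_mult_less_power\<close>)
    also have "\<dots> = (\<Sum>r<2 ^ m. if r = b div 2 ^ k then
        (if b mod 2 ^ k = p then cnj (U $$ (p' + 2 ^ k * (b div 2 ^ k), B)) * (1 / 2 ^ k) else 0) else 0)"
      unfolding sum_mod_eq[OF p(2)] by (intro sum.cong refl) (use p in auto)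
    finally show ?thesis using bd by simp
  qed
  have "(adj W * E * W) $$ (x, y) = (\<Sum>l<2 ^ ?N. (adj W * E) $$ (x, l) * W $$ (l, y))"
    using Wc Ec xy by (intro index_mult_mat_sum) auto
  also have "\<dots> = (\<Sum>l<2 ^ ?N. if l mod 2 ^ k = p then (adj W * E) $$ (x, l) * U $$ (l div 2 ^ k, A) else 0)"
    by (intro sum.cong refl) (use p AB in \<open>simp add: y_def W del: index_mult_mat(1)\<close>)
  also have "\<dots> = (\<Sum>b<2 ^ (k + m). (adj W * E) $$ (x, p + 2 ^ k * b) * U $$ (b, A))"
    using p(1) by (simp add: sum_mod_eq del: index_mult_mat(1))
  also have "\<dots> = (\<Sum>b<2 ^ (k + m). if b mod 2 ^ k = p
      then cnj (U $$ (p' + 2 ^ k * (b div 2 ^ k), B)) * (1 / 2 ^ k) * U $$ (b, A) else 0)"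
    by (intro sum.cong refl) (simp add: left del: index_mult_mat(1))
  also have "\<dots> = (\<Sum>r<2 ^ m. 1 / 2 ^ k * (cnj (U $$ (p' + 2 ^ k * r, B)) * U $$ (p + 2 ^ k * r, A)))"
    unfolding sum_mod_eq[OF p(1)] by (intro sum.cong refl) (use p in simp)
  finally show ?thesis unfolding W_def E_def x_def y_def by (simp only: sum_distrib_left)
qed

lemma index_channel:
  assumes U: "U \<in> carrier_mat (2 ^ (n + a)) (2 ^ (n + a))" and nm: "n + a = k + m"
    and q: "q < 2 ^ n" "q' < 2 ^ n" and p: "p < 2 ^ k" "p' < 2 ^ k"
  shows "channel n a k U \<psi> (ket_bra n q q') $$ (p, p')
    = (\<Sum>r<2 ^ m. \<Sum>y'<2 ^ a. \<Sum>y<2 ^ a. U $$ (p + 2 ^ k * r, q + 2 ^ n * y) * \<psi> $$ (y, y')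
        * cnj (U $$ (p' + 2 ^ k * r, q' + 2 ^ n * y')))"
proof -
  let ?N = "n + a"
  define T where "T = tensor n a (ket_bra n q q') \<psi>"
  have Tc: "T \<in> carrier_mat (2 ^ ?N) (2 ^ ?N)" by (simp add: T_def tensor_def)
  have T: "T $$ (c, b) = (if c mod 2 ^ n = q then (if b mod 2 ^ n = q' then \<psi> $$ (c div 2 ^ n, b div 2 ^ n) else 0) else 0)"
    if "c < 2 ^ ?N" "b < 2 ^ ?N" for b c
    using that by (simp add: T_def tensor_def ket_bra_def)
  have UT: "(U * T) $$ (s, b) = (if b mod 2 ^ n = q' then \<Sum>y<2 ^ a. U $$ (s, q + 2 ^ n * y) * \<psi> $$ (y, b div 2 ^ n) else 0)"
    if "s < 2 ^ ?N" "b < 2 ^ ?N" for s b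
  proof -
    have "(U * T) $$ (s, b) = (\<Sum>c<2 ^ ?N. U $$ (s, c) * T $$ (c, b))"
      by (rule index_mult_mat_sum[OF U Tc that])
    also have "\<dots> = (\<Sum>c<2 ^ ?N. if c mod 2 ^ n = q then
        (if b mod 2 ^ n = q' then U $$ (s, c) * \<psi> $$ (c div 2 ^ n, b div 2 ^ n) else 0) else 0)"
      by (intro sum.cong refl) (use that in \<open>simp add: T\<close>)
    finally show ?thesis using q(1) by (simp add: sum_mod_eq)
  qed
  have UTU: "(U * T * adj U) $$ (s, t) = (\<Sum>y'<2 ^ a. \<Sum>y<2 ^ a. U $$ (s, q + 2 ^ n * y) * \<psi> $$ (y, y')
        * cnj (U $$ (t, q' + 2 ^ n * y')))"
    if "s < 2 ^ ?N" "t < 2 ^ ?N" for s t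
  proof -
    have "(U * T * adj U) $$ (s, t) = (\<Sum>b<2 ^ ?N. (U * T) $$ (s, b) * adj U $$ (b, t))"
      by (rule index_mult_mat_sum[OF mult_carrier_square[OF U Tc] adj_carrier[OF U] that])
    also have "\<dots> = (\<Sum>b<2 ^ ?N. if b mod 2 ^ n = q' then
        (\<Sum>y<2 ^ a. U $$ (s, q + 2 ^ n * y) * \<psi> $$ (y, b div 2 ^ n)) * cnj (U $$ (t, b)) else 0)"
      by (intro sum.cong refl) (use that in \<open>simp add: UT index_adj[OF U] del: index_mult_mat(1)\<close>)
    finally show ?thesis using q(2) by (simp add: sum_mod_eq sum_distrib_right)
  qed
  have nk: "n + a - k = m" using nm by simp
  have lt: "p + 2 ^ k * r < 2 ^ ?N" "p' + 2 ^ k * r < 2 ^ ?N" if "r < 2 ^ m" for r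
    unfolding nm using p that by (simp_all add: add_mult_less_power)
  have "channel n a k U \<psi> (ket_bra n q q') $$ (p, p') = (\<Sum>r<2 ^ m. (U * T * adj U) $$ (p + 2 ^ k * r, p' + 2 ^ k * r))"
    using p by (simp add: channel_def ptrace_keep_def nk T_def del: index_mult_mat(1))
  also have "\<dots> = (\<Sum>r<2 ^ m. \<Sum>y'<2 ^ a. \<Sum>y<2 ^ a. U $$ (p + 2 ^ k * r, q + 2 ^ n * y) * \<psi> $$ (y, y')
        * cnj (U $$ (p' + 2 ^ k * r, q' + 2 ^ n * y')))"
    by (intro sum.cong refl UTU lt) auto
  finally show ?thesis .
qed

text \<open>The Heisenberg form of the Choi operator. Conjugation places the conjugated entry of U
  on the row side, the channel places it on the column side; the transposition in
  \<open>slice_op\<close> reconciles the two, after which only the order of summation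
  differs.\<close>

lemma slice_op_conj_epr_op:
  assumes U: "U \<in> carrier_mat (2 ^ (n + a)) (2 ^ (n + a))" and nm: "n + a = k + m"
  shows "slice_op (k + n) a \<psi> (adj (ext_op k (k + m) U) * epr_op k m * ext_op k (k + m) U)
    = (1 / 2 ^ k) \<cdot>\<^sub>m choi n a k U \<psi>"
proof (rule eq_matI)
  define X where "X = adj (ext_op k (k + m) U) * epr_op k m * ext_op k (k + m) U"
  fix i j assume "i < dim_row ((1 / 2 ^ k) \<cdot>\<^sub>m choi n a k U \<psi>)" "j < dim_col ((1 / 2 ^ k) \<cdot>\<^sub>m choi n a k U \<psi>)"
  then have ij: "i < 2 ^ (k + n)" "j < 2 ^ (k + n)" by (simp_all add: choi_def)
  define p where "p = i mod 2 ^ k"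
  define q where "q = i div 2 ^ k"
  define p' where "p' = j mod 2 ^ k"
  define q' where "q' = j div 2 ^ k"
  have pq: "p < 2 ^ k" "p' < 2 ^ k" "q < 2 ^ n" "q' < 2 ^ n"
    using ij by (simp_all add: p_def p'_def q_def q'_def div_less_power)
  have i: "i = p + 2 ^ k * q" and j: "j = p' + 2 ^ k * q'" by (simp_all add: p_def q_def p'_def q'_def)
  define t where "t r y y' = U $$ (p + 2 ^ k * r, q + 2 ^ n * y) * \<psi> $$ (y, y')
      * cnj (U $$ (p' + 2 ^ k * r, q' + 2 ^ n * y'))" for r y y'
  have X: "\<psi> $$ (y, y') * X $$ (j + 2 ^ (k + n) * y', i + 2 ^ (k + n) * y) = (\<Sum>r<2 ^ m. 1 / 2 ^ k * t r y y')"
    if "y < 2 ^ a" "y' < 2 ^ a" for y y'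
  proof -
    have split: "j + 2 ^ (k + n) * y' = p' + 2 ^ k * (q' + 2 ^ n * y')"
      "i + 2 ^ (k + n) * y = p + 2 ^ k * (q + 2 ^ n * y)"
      by (simp_all add: i j power_add algebra_simps)
    have lt: "q + 2 ^ n * y < 2 ^ (k + m)" "q' + 2 ^ n * y' < 2 ^ (k + m)"
      using add_mult_less_power[OF pq(3) that(1)] add_mult_less_power[OF pq(4) that(2)] by (simp_all add: nm)
    have "X $$ (j + 2 ^ (k + n) * y', i + 2 ^ (k + n) * y)
        = 1 / 2 ^ k * (\<Sum>r<2 ^ m. cnj (U $$ (p' + 2 ^ k * r, q' + 2 ^ n * y')) * U $$ (p + 2 ^ k * r, q + 2 ^ n * y))"
      unfolding split X_def by (rule index_conj_epr_op[OF _ pq(1,2) lt]) (use U nm in simp)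
    then show ?thesis by (simp add: t_def sum_distrib_left mult_ac)
  qed
  have "slice_op (k + n) a \<psi> X $$ (i, j)
      = (\<Sum>y<2 ^ a. \<Sum>y'<2 ^ a. \<psi> $$ (y, y') * X $$ (j + 2 ^ (k + n) * y', i + 2 ^ (k + n) * y))"
    using ij by (simp add: slice_op_def)
  also have "\<dots> = (\<Sum>y<2 ^ a. \<Sum>y'<2 ^ a. \<Sum>r<2 ^ m. 1 / 2 ^ k * t r y y')"
    by (intro sum.cong refl X) auto
  also have "\<dots> = (\<Sum>y'<2 ^ a. \<Sum>y<2 ^ a. \<Sum>r<2 ^ m. 1 / 2 ^ k * t r y y')" by (rule sum.swap)
  also have "\<dots> = (\<Sum>y'<2 ^ a. \<Sum>r<2 ^ m. \<Sum>y<2 ^ a. 1 / 2 ^ k * t r y y')"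
    by (intro sum.cong refl sum.swap)
  also have "\<dots> = (\<Sum>r<2 ^ m. \<Sum>y'<2 ^ a. \<Sum>y<2 ^ a. 1 / 2 ^ k * t r y y')" by (rule sum.swap)
  also have "\<dots> = 1 / 2 ^ k * (\<Sum>r<2 ^ m. \<Sum>y'<2 ^ a. \<Sum>y<2 ^ a. t r y y')"
    by (simp only: sum_distrib_left)
  also have "\<dots> = 1 / 2 ^ k * channel n a k U \<psi> (ket_bra n q q') $$ (p, p')"
    unfolding index_channel[OF U nm pq(3,4,1,2)] t_def ..
  also have "\<dots> = ((1 / 2 ^ k) \<cdot>\<^sub>m choi n a k U \<psi>) $$ (i, j)"
    using ij by (simp add: choi_def p_def q_def p'_def q'_def)
  finally show "slice_op (k + n) a \<psi> (adj (ext_op k (k + m) U) * epr_op k m * ext_op k (k + m) U) $$ (i, j)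
      = ((1 / 2 ^ k) \<cdot>\<^sub>m choi n a k U \<psi>) $$ (i, j)" unfolding X_def .
qed (simp_all add: slice_op_def choi_def)

section \<open>Assembling the bound\<close>

lemma approx_degree_le:
  assumes "A \<in> carrier_mat (2 ^ m) (2 ^ m)" "low_degree m l B" "0 \<le> l"
    and "op_bounded (A - B) c" "0 \<le> c" "c \<le> \<epsilon>"
  shows "real (approx_degree m \<epsilon> A) \<le> l"
proof -
  have "opnorm (A - B) \<le> \<epsilon>" using opnorm_le[OF assms(4,5)] assms(6) by linarith
  moreover have "is_op m B" using spanned_carrier[OF assms(2)] by (simp add: is_op_def)
  ultimately have "approx_degree m \<epsilon> A \<le> pauli_degree m B"
    unfolding approx_degree_def by (intro Least_le) blast
  then show ?thesis using pauli_degree_le[OF assms(2,3)] by linarith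
qed

lemma cz_layer_square: "cz_layer m G * cz_layer m G = 1\<^sub>m (2 ^ m)"
  unfolding cz_layer_eq_diag_op diag_op_mult diag_op_one[symmetric]
  by (simp flip: prod.distrib)

text \<open>For k = 0 the conjugated operator is the identity, and unitarity keeps it so.\<close>

lemma adj_circ_mult_circ:
  assumes "\<And>j. j \<le> d \<Longrightarrow> is_single_layer m (L j)" "\<And>j. j \<in> {1..d} \<Longrightarrow> is_cz_layer m (M j)"
  shows "adj (circ d L M) * circ d L M = 1\<^sub>m (2 ^ m)"
  using assms
proof (induction d)
  case 0
  then show ?case using is_single_layer_unitary(2) by simp
next
  case (Suc d)
  define C where "C = circ d L M"
  define L1 where "L1 = L (Suc d)"
  have sub: "j \<le> d \<Longrightarrow> is_single_layer m (L j)" "j \<in> {1..d} \<Longrightarrow> is_cz_layer m (M j)" for j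
    by (rule Suc.prems, simp)+
  have l: "is_single_layer m L1" unfolding L1_def by (rule Suc.prems) simp
  have "is_cz_layer m (M (Suc d))" by (rule Suc.prems) simp
  then obtain G where G: "M (Suc d) = cz_layer m G" by (auto simp: is_cz_layer_def)
  define M1 where "M1 = cz_layer m G"
  have c: "C \<in> carrier_mat (2 ^ m) (2 ^ m)"
    unfolding C_def by (rule circ_bounded(1)[of d m L M, OF sub]; assumption)
  have IH: "adj C * C = 1\<^sub>m (2 ^ m)" unfolding C_def by (rule Suc.IH) (fact sub)+
  note Lc = is_single_layer_unitary(1)[OF l]
  have Mc: "M1 \<in> carrier_mat (2 ^ m) (2 ^ m)" by (simp add: M1_def cz_layer_def)
  note ac = adj_carrier[OF c] and aL = adj_carrier[OF Lc]
  have "adj (circ (Suc d) L M) * circ (Suc d) L M = (adj C * (M1 * adj L1)) * (L1 * M1 * C)"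
    using adj_mult[OF mult_carrier_square[OF Lc Mc] c] adj_mult[OF Lc Mc]
    by (simp add: C_def L1_def M1_def G adj_cz_layer)
  also have "\<dots> = adj C * (M1 * ((adj L1 * L1) * (M1 * C)))"
    using c Lc Mc ac aL by (simp add: assoc_mult_mat[of _ "2 ^ m" "2 ^ m" _ "2 ^ m" _ "2 ^ m"])
  also have "\<dots> = adj C * (M1 * (M1 * C))"
    using c Mc is_single_layer_unitary(2)[OF l] left_mult_one_mat[OF mult_carrier_square[OF Mc c]] by simp
  also have "M1 * (M1 * C) = C"
    using assoc_mult_mat[OF Mc Mc c] cz_layer_square[of m G] left_mult_one_mat[OF c] by (simp add: M1_def)
  finally show ?case by (simp add: IH)
qed

lemma epr_op_0: "epr_op 0 m = 1\<^sub>m (2 ^ (0 + (0 + m)))"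
  by (rule eq_matI) (auto simp: epr_op_def paired_def)

text \<open>The reason for the accuracy 1 + ln N: the logarithm gives 1/N^2, and the summand 1 pays
  for the factor 4.\<close>

lemma exp_log_error: "0 < N \<Longrightarrow> 4 * exp (- 2 * (1 + ln N)) \<le> 1 / N\<^sup>2" for N :: real
proof -
  assume N: "0 < N"
  have "exp (- 2 * (1 + ln N)) = exp (- 2) * exp (- ln N) * exp (- ln N)"
    by (simp add: algebra_simps flip: exp_add)
  also have "exp (- ln N) = 1 / N" using N by (simp add: exp_minus inverse_eq_divide)
  finally have "4 * exp (- 2 * (1 + ln N)) = 4 * exp (- 2 * 1) * (1 / N\<^sup>2)" by (simp add: power2_eq_square)
  also have "\<dots> \<le> 1 * (1 / N\<^sup>2)" using exp_error_le_1[of 1] by (intro mult_right_mono) auto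
  finally show ?thesis by simp
qed

text \<open>Returns from the N qubits of the padded register to M = n + a. The factor 2 in N <= 2 M
  costs another 2 inside the logarithmic factor, hence 28 = 2 * 14, and at most 2 in the power, as 1
  - s <= 1.\<close>

lemma degree_bound_numeric:
  fixes M k :: real
  assumes M: "1 \<le> M" and N: "0 < N" "N \<le> 2 * M" "1 \<le> 1 + ln N" and s: "0 \<le> s" "s \<le> 1" and k: "0 \<le> k"
  shows "(14 * (1 + ln N)) powr (3/2) * (N powr (1 - s) * sqrt k powr s)
    \<le> 2 * 28 powr (3/2) * M powr (1 - s) * k powr (s / 2) * (1 + ln M) powr (3/2)"
proof -
  have "ln N \<le> ln (2 * M)" using N M by simp
  also have "\<dots> = ln 2 + ln M" using M by (simp add: ln_mult)
  also have "\<dots> \<le> 1 + ln M" using ln_2_less_1 by simp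
  finally have "1 + ln N \<le> 1 + (1 + ln M)" by simp
  also have "\<dots> \<le> 2 * (1 + ln M)" using ln_ge_zero[OF M] by simp
  finally have "1 + ln N \<le> 2 * (1 + ln M)" .
  then have "(14 * (1 + ln N)) powr (3/2) \<le> (28 * (1 + ln M)) powr (3/2)"
    using N by (intro powr_mono2) auto
  also have "\<dots> = 28 powr (3/2) * (1 + ln M) powr (3/2)"
    using ln_ge_zero[OF M] by (simp only: powr_mult)
  finally have a: "(14 * (1 + ln N)) powr (3/2) \<le> 28 powr (3/2) * (1 + ln M) powr (3/2)" .
  have "N powr (1 - s) \<le> (2 * M) powr (1 - s)" using N s by (intro powr_mono2) auto
  also have "\<dots> = 2 powr (1 - s) * M powr (1 - s)" using M by (simp only: powr_mult)
  also have "\<dots> \<le> 2 * M powr (1 - s)"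
    using s powr_mono[of "1 - s" 1 2] by (intro mult_right_mono) auto
  finally have b: "N powr (1 - s) \<le> 2 * M powr (1 - s)" .
  have c: "sqrt k powr s = k powr (s / 2)" using k by (simp add: powr_half_sqrt[symmetric] powr_powr)
  have "(14 * (1 + ln N)) powr (3/2) * (N powr (1 - s) * sqrt k powr s)
      \<le> (28 powr (3/2) * (1 + ln M) powr (3/2)) * ((2 * M powr (1 - s)) * k powr (s / 2))"
    unfolding c by (intro mult_mono a b mult_right_mono) auto
  then show ?thesis by (simp add: mult_ac)
qed

theorem theorem7p2:
  shows "\<exists>C c. 0 < C \<and> 0 \<le> c \<and>
    (\<forall>n a k d U \<psi>. 1 \<le> n \<longrightarrow> 1 \<le> d \<longrightarrow> k \<le> n \<longrightarrow>
       qac0_circuit (n + a) d U \<longrightarrow> density_op a \<psi> \<longrightarrow>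
       real (approx_degree (k + n) (C * real d / real n)
               ((1 / 2 ^ k) \<cdot>\<^sub>m choi n a k U \<psi>))
         \<le> C * real (n + a) powr (1 - 3 powr (- real d)) * real k powr (3 powr (- real d) / 2)
             * (1 + ln (real (n + a))) powr c)"
proof (intro exI conjI allI impI)
  \<comment> \<open>The constant of \<open>degree_bound_numeric\<close>; the error bound needs it to
    be at least 6.\<close>
  let ?C = "2 * 28 powr (3/2) :: real"
  show "0 < ?C" "0 \<le> (3/2 :: real)" by simp_all
  fix n a k d :: nat and U \<psi>
  assume n: "1 \<le> n" and d: "1 \<le> d" and kn: "k \<le> n" and U: "qac0_circuit (n + a) d U" and \<psi>: "density_op a \<psi>"
  \<comment> \<open>m is the number of circuit qubits that the channel traces out.\<close>
  obtain m where nm: "n + a = k + m" using kn le_Suc_ex[of k "n + a"] by auto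
  have N: "k + n + a = k + (k + m)" using nm by simp
  let ?N = "k + (k + m)"
  have "(28 :: real) powr 1 \<le> 28 powr (3/2)" by (intro powr_mono) auto
  then have C6: "6 \<le> ?C" by simp
  define W where "W = ext_op k (k + m) U"
  define A where "A = (1 / 2 ^ k) \<cdot>\<^sub>m choi n a k U \<psi>"
  have Ac: "A \<in> carrier_mat (2 ^ (k + n)) (2 ^ (k + n))" by (simp add: A_def choi_def)
  obtain L0 M0 where U0: "\<forall>j\<le>d. is_single_layer (n + a) (L0 j)" "\<forall>j\<in>{1..d}. is_cz_layer (n + a) (M0 j)"
      "U = circ d L0 M0"
    using U unfolding qac0_circuit_def by (elim exE conjE)
  have Uc: "U \<in> carrier_mat (2 ^ (n + a)) (2 ^ (n + a))"
    unfolding U0(3) by (rule circ_bounded(1)) (use U0 in auto)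
  have "qac0_circuit ?N d W" using qac0_circuit_ext_op[OF U, of k] by (simp add: W_def nm)
  then obtain L M where LM0: "\<forall>j\<le>d. is_single_layer ?N (L j)" "\<forall>j\<in>{1..d}. is_cz_layer ?N (M j)"
      and W: "W = circ d L M"
    unfolding qac0_circuit_def by (elim exE conjE)
  have LM: "j \<le> d \<Longrightarrow> is_single_layer ?N (L j)" "j \<in> {1..d} \<Longrightarrow> is_cz_layer ?N (M j)" for j
    using LM0 by blast+
  have Wb: "W \<in> carrier_mat (2 ^ ?N) (2 ^ ?N)" "op_bounded W 1" "op_bounded (adj W) 1"
    unfolding W by (rule circ_bounded, use LM in blast, use LM in blast)+
  have slice: "slice_op (k + n) a \<psi> (adj W * epr_op k m * W) = A"
    unfolding A_def W_def by (rule slice_op_conj_epr_op[OF Uc nm])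
  show "real (approx_degree (k + n) (?C * real d / real n) ((1 / 2 ^ k) \<cdot>\<^sub>m choi n a k U \<psi>))
      \<le> ?C * real (n + a) powr (1 - 3 powr (- real d)) * real k powr (3 powr (- real d) / 2)
        * (1 + ln (real (n + a))) powr (3/2)"
    unfolding A_def[symmetric]
  proof (cases "k = 0")
    case True
    \<comment> \<open>As 0 powr anything is 0, the right-hand side vanishes and degree 0 has to be
      met. Conjugating the identity by a unitary gives the identity, so this holds without any
      approximation.\<close>
    have "adj W * W = 1\<^sub>m (2 ^ ?N)"
      unfolding W by (rule adj_circ_mult_circ) (use LM in blast)+
    moreover have "adj W * epr_op k m * W = adj W * W"
      using right_mult_one_mat[OF adj_carrier[OF Wb(1)]] True by (simp add: epr_op_0)
    ultimately have "low_degree (k + n + a) 0 (adj W * epr_op k m * W)"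
      using low_degree_one[of 0 "k + n + a"] by (simp add: N)
    then have "low_degree (k + n) 0 A" using low_degree_slice_op[of "k + n" a] slice by metis
    from approx_degree_le[OF Ac this order_refl op_bounded_self_diff]
    have "real (approx_degree (k + n) (?C * real d / real n) A) \<le> 0" by simp
    then show "real (approx_degree (k + n) (?C * real d / real n) A)
      \<le> ?C * real (n + a) powr (1 - 3 powr (- real d)) * real k powr (3 powr (- real d) / 2)
        * (1 + ln (real (n + a))) powr (3/2)" using True by simp
  next
    case False
    then have k: "1 \<le> k" by simp
    define r where "r = 1 + ln (real ?N)"
    define s where "s = 3 powr (- real d)"
    define e where "e = 4 * exp (- 2 * r)"
    have N1: "1 \<le> real ?N" using k by simp
    have r: "1 \<le> r" using ln_ge_zero[OF N1] by (simp add: r_def)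
    have s: "0 \<le> s" "s \<le> 1" using powr_mono[of "- real d" 0 3] by (simp_all add: s_def)
    obtain B0 where B0: "low_degree ?N (24 * (sqrt k * r)) B0" "op_bounded B0 1" "op_bounded (epr_op k m - B0) (2 * e)"
      unfolding e_def by (rule approx_epr_op[OF k r])
    note B0c = spanned_carrier[OF B0(1)]
    \<comment> \<open>Brings the EPR approximant into the form that the layer induction starts from,
      with x = sqrt k: 24 r <= 2 * 14 r, and 2 <= sqrt (14 r).\<close>
    have "24 * r \<le> (14 * r) powr (3/2)"
    proof -
      have "24 * r \<le> 2 * (14 * r)" using r by simp
      also have "\<dots> \<le> sqrt (14 * r) * (14 * r)"
        using r by (intro mult_right_mono real_le_rsqrt) auto
      also have "\<dots> = (14 * r) powr (1/2) * (14 * r) powr 1" using r by (simp add: powr_half_sqrt)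
      also have "\<dots> = (14 * r) powr (3/2)" by (simp only: powr_add[symmetric]) simp
      finally show ?thesis .
    qed
    then have "24 * r * sqrt k \<le> (14 * r) powr (3/2) * sqrt k" by (intro mult_right_mono) auto
    then have B0': "low_degree ?N ((14 * r) powr (3/2) * sqrt k) B0"
      by (intro low_degree_mono[OF B0(1)]) (simp add: mult_ac)
    have "\<exists>B. low_degree ?N ((14 * r) powr (3/2) * (real ?N powr (1 - 3 powr (- real d)) * sqrt k powr (3 powr (- real d)))) B
      \<and> op_bounded (adj (circ d L M) * B0 * circ d L M - B) (d * (4 * real ?N * (4 * exp (- 2 * r))))"
      by (rule approx_conj_circ[OF _ _ r _ B0' B0(2)]) (use LM k in auto)
    then obtain B where B: "low_degree ?N ((14 * r) powr (3/2) * (real ?N powr (1 - s) * sqrt k powr s)) B"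
        "op_bounded (adj W * B0 * W - B) (d * (4 * real ?N * e))"
      unfolding W s_def e_def by (elim exE conjE)
    note Bc = spanned_carrier[OF B(1)]
    have e0: "0 \<le> e" by (simp add: e_def)
    have "op_bounded (adj W * epr_op k m * W - adj W * B0 * W) (2 * e)"
      by (rule op_bounded_conj_diff[OF B0(3) Wb(3,2) _ epr_op_carrier B0c adj_carrier[OF Wb(1)] Wb(1)]) (use e0 in simp)
    from op_bounded_diff_triangle[OF this B(2) _ _ Bc]
    have err: "op_bounded (adj W * epr_op k m * W - B) (2 * e + d * (4 * real ?N * e))"
      using Wb(1) adj_carrier[OF Wb(1)] B0c by simp
    have Xc: "adj W * epr_op k m * W \<in> carrier_mat (2 ^ ?N) (2 ^ ?N)" using Wb(1) adj_carrier[OF Wb(1)] by simp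
    have "op_bounded (slice_op (k + n) a \<psi> (adj W * epr_op k m * W - B)) (2 * e + d * (4 * real ?N * e))"
      by (rule op_bounded_slice_op[OF \<psi> _ err]) (use Bc e0 in \<open>simp_all add: N minus_carrier_mat\<close>)
    moreover have "slice_op (k + n) a \<psi> (adj W * epr_op k m * W - B) = A - slice_op (k + n) a \<psi> B"
      using slice_op_linear(2)[of "adj W * epr_op k m * W" "k + n" a B \<psi>] Xc Bc slice by (simp only: N)
    ultimately have bnd: "op_bounded (A - slice_op (k + n) a \<psi> B) (2 * e + d * (4 * real ?N * e))" by simp
    have deg: "low_degree (k + n) ((14 * r) powr (3/2) * (real ?N powr (1 - s) * sqrt k powr s)) (slice_op (k + n) a \<psi> B)"
      by (rule low_degree_slice_op) (use B(1) in \<open>simp only: N\<close>)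
    \<comment> \<open>The EPR projector costs 2 e and each layer 4 N e; as d N >= 1 and e <= 1/N^2,
      the total is at most 6 d N e <= 6 d / N.\<close>
    have small: "2 * e + d * (4 * real ?N * e) \<le> ?C * real d / real n"
    proof -
      have dN: "1 * 1 \<le> real d * real ?N" using d N1 by (intro mult_mono) auto
      have eN: "e \<le> 1 / (real ?N)\<^sup>2" unfolding e_def r_def by (rule exp_log_error) (use N1 in linarith)
      have "1 * e \<le> (real d * real ?N) * e" using dN e0 by (intro mult_right_mono) auto
      moreover have "d * (4 * real ?N * e) = 4 * ((real d * real ?N) * e)" by (simp only: mult_ac)
      ultimately have "2 * e + d * (4 * real ?N * e) \<le> 6 * ((real d * real ?N) * e)" by linarith
      then have "2 * e + d * (4 * real ?N * e) \<le> 6 * (real d * real ?N) * e" by (simp only: mult.assoc)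
      also have "\<dots> \<le> 6 * (real d * real ?N) * (1 / (real ?N)\<^sup>2)" using eN by (intro mult_left_mono) auto
      also have "\<dots> = 6 * real d / real ?N" using N1 by (simp add: power2_eq_square)
      also have "\<dots> \<le> 6 * real d / real n" using n N by (intro divide_left_mono) auto
      also have "\<dots> \<le> ?C * real d / real n" using C6 by (intro divide_right_mono mult_right_mono) auto
      finally show ?thesis .
    qed
    have "real (approx_degree (k + n) (?C * real d / real n) A)
        \<le> (14 * r) powr (3/2) * (real ?N powr (1 - s) * sqrt k powr s)"
      by (rule approx_degree_le[OF Ac deg _ bnd _ small]) (use e0 in auto)
    also have "\<dots> \<le> ?C * real (n + a) powr (1 - s) * real k powr (s / 2) * (1 + ln (real (n + a))) powr (3/2)"
      unfolding r_def by (rule degree_bound_numeric) (use n kn nm N1 r s in \<open>auto simp: r_def\<close>)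
    finally show "real (approx_degree (k + n) (?C * real d / real n) A)
      \<le> ?C * real (n + a) powr (1 - 3 powr (- real d)) * real k powr (3 powr (- real d) / 2)
        * (1 + ln (real (n + a))) powr (3/2)" unfolding s_def .
  qed
qed

end
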